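(* Let $X$ and $Y$ be proper geodesic Morse center spaces with the small cross-ratio property. If $h:\partial X\to\partial Y$ is a $2$-stable, quasi-möbius homeomorphism whose inverse is also $2$-stable and quasi-möbius, then the map $f_K:X\to Y$ (built from $h$ by sending $K$-centers to $K$-centers, as described in the context) is a quasi-isometry for all sufficiently large $K$.
   Context: **Quasi-geodesics, Morse.** $f:X\to Y$ is a $(\lambda,\varepsilon)$-quasi-isometric embedding ($\lambda\ge1,\varepsilon\ge0$) if $\frac1\lambda d_X(x,y)-\varepsilon\le d_Y(f(x),f(y))\le\lambda d_X(x,y)+\varepsilon$ for all $x,y$; it is a quasi-isometry if moreover there are $\hat f:Y\to X$ and $D\ge0$ with $d_X(\hat f f(x),x)\le D$, $d_Y(f\hat f(y),y)\le D$ for all $x,y$. A $(\lambda,\varepsilon)$-quasi-geodesic is a $(\lambda,\varepsilon)$-quasi-isometric embedding of a closed interval $I\subseteq\mathbb R$. A Morse gauge is a function $N:[1,\infty)\times[0,\infty)\to[0,\infty)$; a quasi-geodesic $\gamma$ is $N$-Morse if every $(\lambda,\varepsilon)$-quasi-geodesic with endpoints on $\gamma$ lies in the $N(\lambda,\varepsilon)$-neighborhood of $\gamma$. Convention: when a geodesic is said to be $N$-Morse, $N$ is assumed large enough that all its subgeodesics are also $N$-Morse. **Morse boundary.** Let $X$ be a proper geodesic metric space, $p\in X$. Rays are asymptotic if their images have finite Hausdorff distance. $\partial_vX_p$ is the set of asymptotism classes of geodesic rays based at $p$; $B\subseteq\partial_vX_p$ is closed iff: whenever $(b_n)$ is a sequence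 in $B$, $\beta_n$ are rays based at $p$ with $[\beta_n]=b_n$, $b\in\partial_vX_p$, and every subsequence of $(\beta_n)$ has a further subsequence converging uniformly on compact sets to a ray in $b$, then $b\in B$. For a Morse gauge $N$, $\partial^NX_p\subseteq\partial_vX_p$ is the set of classes containing an $N$-Morse geodesic ray based at $p$, with the subspace topology. Gauges are partially ordered pointwise, and the Morse boundary is $\partial X=\partial_MX_p=\varinjlim_N\partial^NX_p=\bigcup_N\partial^NX_p$ with the direct limit topology. Changing the basepoint gives canonically homeomorphic boundaries (asymptotic rays correspond). A bi-infinite (quasi-)geodesic $\gamma$ is from $a$ to $b$ ($a,b\in\partial X$) if $\gamma|_{(-\infty,0]}$ is asymptotic to a representative of $a$ and $\gamma|_{[0,\infty)}$ to a representative of $b$. **Centers, cross-ratio.** $\partial X^{(n,N)}$ is the set of $n$-tuples of pairwise distinct points of $\partial X$ such that every geodesic between any two of them is $N$-Morse. For $K>0$ and $(a,b,c)\in\partial X^{(3,N)}$, $m_X^{N,K}(a,b,c)$ is the set of $x\in X$ within $K$ of all three sides of some geodesic triangle with vertices $a,b,c$; its elements are called $K$-centers of $(a,b,c)$. For each gauge $N$, $K_N$ denotes a fixed constant such that every geodesic triangle (with vertices in the space or its Morse boundary) in either of the spaces all of whose sides are $N$-Morse has points $q_1,q_2,q_3$, one on each side, pairwise at distance at most $K_N$ (such constants exist); so $m_X^{N,K}$ takes non-empty values for $K\ge K_N$. The $N$-cross-ratio of $(a,b,c,d)\in\partial X^{(4,N)}$ is $[a,b,c,d]_N=\operatorname{diam}\big(m_X^{N,K_N}(a,b,c)\cup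 m_X^{N,K_N}(a,d,c)\big)$. **2-stable, quasi-möbius.** $h:\partial X\to\partial Y$ is $2$-stable if for every $N$ there is $N'$ with $h(\partial X^{(2,N)})\subseteq\partial Y^{(2,N')}$. A $2$-stable $h$ is quasi-möbius if for every pair of gauges $N,N'$ with $h(\partial X^{(2,N)})\subseteq\partial Y^{(2,N')}$ there is a continuous increasing $\psi:[0,\infty)\to[0,\infty)$ with $[h(a),h(b),h(c),h(d)]_{N'}\le\psi([a,b,c,d]_N)$ for all $(a,b,c,d)\in\partial X^{(4,N)}$. **Small cross-ratio property.** For each gauge $N$ there is $C>0$ such that for every $(a,b,c,d)\in\partial X^{(4,N)}$ at least one of $[a,b,c,d]_N$, $[a,c,b,d]_N$, $[b,a,c,d]_N$ is less than $C$. **Morse center space.** $X$ is an $N$-Morse center space if there is $K$ with $X=\bigcup_{(a,b,c)\in\partial X^{(3,N)}}m_X^{N,K}(a,b,c)$, and a Morse center space if this holds for some gauge $N$. **The map $f_K$.** Fix basepoints $p\in X$, $r\in Y$ and view $h$ as a map $\partial_MX_p\to\partial_MY_r$. Fix a gauge $N$ and a constant $K_0$ such that for all $K\ge K_0$, $X=\bigcup_{V\in\partial X^{(3,N)}}m_X^{N,K}(V)$ and $Y=\bigcup_{V\in\partial Y^{(3,N)}}m_Y^{N,K}(V)$, and a gauge $N_h\ge N$ with $h(\partial X^{(3,N)})\subseteq\partial Y^{(3,N_h)}$ (these exist since $X,Y$ are Morse center spaces and $h$ is $2$-stable). For $K\ge\max\{K_0,K_{N_h}\}$ set $f_K(p)=r$,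 and for each $x\in X\setminus\{p\}$ choose an ideal geodesic triangle $T_x$ with vertex tuple $(a,b,c)\in\partial X^{(3,N)}$ such that $x$ is within $K$ of each side of $T_x$, and let $f_K(x)$ be any chosen point of $m_Y^{N_h,K}(h(a),h(b),h(c))$. *)

theory Defs
  imports "HOL-Analysis.Analysis"
begin

text \<open>A metric space \<open>X\<close> is a type of class \<^class>\<open>metric_space\<close>. Paths are functions on
  \<^typ>\<open>real\<close>, of which only the restriction to an explicitly given closed interval matters.\<close>

section \<open>Quasi-isometries, geodesics, Morse gauges\<close>

definition proper_geodesic :: "'a::metric_space itself \<Rightarrow> bool" where
  "proper_geodesic _ \<longleftrightarrow>
     (\<forall>(x::'a) r. compact (cball x r)) \<and>
     (\<forall>(x::'a) y. \<exists>\<gamma>::real \<Rightarrow> 'a. \<gamma> 0 = x \<and> \<gamma> (dist x y) = y \<and>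
        (\<forall>s\<in>{0..dist x y}. \<forall>t\<in>{0..dist x y}. dist (\<gamma> s) (\<gamma> t) = \<bar>s - t\<bar>))"

definition qi_embedding_on ::
  "'a::metric_space set \<Rightarrow> real \<Rightarrow> real \<Rightarrow> ('a \<Rightarrow> 'b::metric_space) \<Rightarrow> bool" where
  "qi_embedding_on S l e f \<longleftrightarrow> 1 \<le> l \<and> 0 \<le> e \<and>
     (\<forall>x\<in>S. \<forall>y\<in>S. 1 / l * dist x y - e \<le> dist (f x) (f y) \<and> dist (f x) (f y) \<le> l * dist x y + e)"

definition quasi_isometry :: "('a::metric_space \<Rightarrow> 'b::metric_space) \<Rightarrow> bool" where
  "quasi_isometry f \<longleftrightarrow> (\<exists>l e. qi_embedding_on UNIV l e f) \<and>
     (\<exists>g D. 0 \<le> D \<and> (\<forall>x. dist (g (f x)) x \<le> D) \<and> (\<forall>y. dist (f (g y)) y \<le> D))"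

definition closed_interval :: "real set \<Rightarrow> bool" where
  "closed_interval I \<longleftrightarrow> closed I \<and> is_interval I \<and> I \<noteq> {}"

definition quasi_geodesic :: "real \<Rightarrow> real \<Rightarrow> real set \<Rightarrow> (real \<Rightarrow> 'a::metric_space) \<Rightarrow> bool" where
  "quasi_geodesic l e I \<gamma> \<longleftrightarrow> closed_interval I \<and> qi_embedding_on I l e \<gamma>"

definition geodesic :: "real set \<Rightarrow> (real \<Rightarrow> 'a::metric_space) \<Rightarrow> bool" where
  "geodesic I \<gamma> \<longleftrightarrow> closed_interval I \<and> (\<forall>s\<in>I. \<forall>t\<in>I. dist (\<gamma> s) (\<gamma> t) = \<bar>s - t\<bar>)"

definition nbhd :: "real \<Rightarrow> 'a::metric_space set \<Rightarrow> 'a set" where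
  "nbhd r S = (\<Union>y\<in>S. cball y r)"

text \<open>Gauges are extensional functions, so that equality and \<open>\<le>\<close> of gauges (as functions) are
  equality and \<open>\<le>\<close> on \<open>[1,\<infinity>) \<times> [0,\<infinity>)\<close>.\<close>

type_synonym gauge = "real \<times> real \<Rightarrow> real"

definition morse_gauges :: "gauge set" where
  "morse_gauges = ({1..} \<times> {0..}) \<rightarrow>\<^sub>E {0..}"

definition morse :: "gauge \<Rightarrow> real set \<Rightarrow> (real \<Rightarrow> 'a::metric_space) \<Rightarrow> bool" where
  "morse N I \<gamma> \<longleftrightarrow> (\<exists>l e. quasi_geodesic l e I \<gamma>) \<and>
     (\<forall>l e s t \<sigma>. s \<le> t \<longrightarrow> quasi_geodesic l e {s..t} \<sigma> \<longrightarrow> \<sigma> s \<in> \<gamma> ` I \<longrightarrow> \<sigma> t \<in> \<gamma> ` I \<longrightarrow>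
        \<sigma> ` {s..t} \<subseteq> nbhd (N (l, e)) (\<gamma> ` I))"

text \<open>The convention for geodesics: all subgeodesics are required to be \<open>N\<close>-Morse too.\<close>

definition morse_geodesic :: "gauge \<Rightarrow> real set \<Rightarrow> (real \<Rightarrow> 'a::metric_space) \<Rightarrow> bool" where
  "morse_geodesic N I \<gamma> \<longleftrightarrow> geodesic I \<gamma> \<and> (\<forall>J\<subseteq>I. closed_interval J \<longrightarrow> morse N J \<gamma>)"


section \<open>The Morse boundary\<close>

definition finite_hausdorff :: "'a::metric_space set \<Rightarrow> 'a set \<Rightarrow> bool" where
  "finite_hausdorff S T \<longleftrightarrow> (\<exists>C. S \<subseteq> nbhd C T \<and> T \<subseteq> nbhd C S)"

definition rays :: "'a::metric_space \<Rightarrow> (real \<Rightarrow> 'a) set" where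
  "rays p = {\<alpha>. geodesic {0..} \<alpha> \<and> \<alpha> 0 = p}"

definition asymptotic :: "'a::metric_space \<Rightarrow> ((real \<Rightarrow> 'a) \<times> (real \<Rightarrow> 'a)) set" where
  "asymptotic p =
     {(\<alpha>, \<beta>). \<alpha> \<in> rays p \<and> \<beta> \<in> rays p \<and> finite_hausdorff (\<alpha> ` {0..}) (\<beta> ` {0..})}"

type_synonym 'a bpoint = "(real \<Rightarrow> 'a) set"

definition visual_boundary :: "'a::metric_space \<Rightarrow> 'a bpoint set" where
  "visual_boundary p = rays p // asymptotic p"

definition ray_converges :: "(nat \<Rightarrow> real \<Rightarrow> 'a::metric_space) \<Rightarrow> (real \<Rightarrow> 'a) \<Rightarrow> bool" where
  "ray_converges \<beta> \<alpha> \<longleftrightarrow> (\<forall>C. compact C \<and> C \<subseteq> {0..} \<longrightarrow> uniform_limit C \<beta> \<alpha> sequentially)"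

definition visual_closed :: "'a::metric_space \<Rightarrow> 'a bpoint set \<Rightarrow> bool" where
  "visual_closed p B \<longleftrightarrow> B \<subseteq> visual_boundary p \<and>
     (\<forall>\<beta> b. (\<forall>n. \<beta> n \<in> rays p \<and> asymptotic p `` {\<beta> n} \<in> B) \<longrightarrow> b \<in> visual_boundary p \<longrightarrow>
        (\<forall>\<sigma>::nat \<Rightarrow> nat. strict_mono \<sigma> \<longrightarrow>
           (\<exists>\<tau>::nat \<Rightarrow> nat. strict_mono \<tau> \<and> (\<exists>\<alpha>\<in>b. ray_converges (\<beta> \<circ> \<sigma> \<circ> \<tau>) \<alpha>))) \<longrightarrow>
        b \<in> B)"

definition visual_topology :: "'a::metric_space \<Rightarrow> 'a bpoint topology" where
  "visual_topology p =
     topology (\<lambda>U. U \<subseteq> visual_boundary p \<and> visual_closed p (visual_boundary p - U))"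

definition boundary_stratum :: "'a::metric_space \<Rightarrow> gauge \<Rightarrow> 'a bpoint set" where
  "boundary_stratum p N = {a \<in> visual_boundary p. \<exists>\<alpha>\<in>a. morse_geodesic N {0..} \<alpha>}"

definition morse_boundary :: "'a::metric_space \<Rightarrow> 'a bpoint set" where
  "morse_boundary p = (\<Union>N\<in>morse_gauges. boundary_stratum p N)"

definition morse_topology :: "'a::metric_space \<Rightarrow> 'a bpoint topology" where
  "morse_topology p = topology (\<lambda>U. U \<subseteq> morse_boundary p \<and>
     (\<forall>N\<in>morse_gauges. openin (subtopology (visual_topology p) (boundary_stratum p N))
                              (U \<inter> boundary_stratum p N)))"

text \<open>Both uses of \<^const>\<open>topology\<close> above are legitimate.\<close>

lemma visual_closed_Un:
  assumes A: "visual_closed p A" and B: "visual_closed p B"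
  shows "visual_closed p (A \<union> B)"
  unfolding visual_closed_def
proof (intro conjI allI impI)
  show "A \<union> B \<subseteq> visual_boundary p"
    using A B by (auto simp: visual_closed_def)
next
  fix \<beta> b
  assume \<beta>: "\<forall>n. \<beta> n \<in> rays p \<and> asymptotic p `` {\<beta> n} \<in> A \<union> B"
    and b: "b \<in> visual_boundary p"
    and sub: "\<forall>\<sigma>::nat \<Rightarrow> nat. strict_mono \<sigma> \<longrightarrow>
           (\<exists>\<tau>::nat \<Rightarrow> nat. strict_mono \<tau> \<and> (\<exists>\<alpha>\<in>b. ray_converges (\<beta> \<circ> \<sigma> \<circ> \<tau>) \<alpha>))"
  have key: "b \<in> C" if C: "visual_closed p C"
    and inf: "infinite {n. asymptotic p `` {\<beta> n} \<in> C}" for C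
  proof -
    define \<rho> where "\<rho> = enumerate {n. asymptotic p `` {\<beta> n} \<in> C}"
    have \<rho>: "strict_mono \<rho>"
      unfolding \<rho>_def by (rule strict_mono_enumerate[OF inf])
    have mem: "asymptotic p `` {\<beta> (\<rho> n)} \<in> C" for n
      using enumerate_in_set[OF inf, of n] by (simp add: \<rho>_def)
    have "\<exists>\<tau>::nat \<Rightarrow> nat. strict_mono \<tau> \<and> (\<exists>\<alpha>\<in>b. ray_converges ((\<beta> \<circ> \<rho>) \<circ> \<sigma> \<circ> \<tau>) \<alpha>)"
      if "strict_mono \<sigma>" for \<sigma> :: "nat \<Rightarrow> nat"
      using sub[rule_format, OF strict_mono_o[OF \<rho> that]] by (simp add: o_assoc)
    moreover have "\<forall>n. (\<beta> \<circ> \<rho>) n \<in> rays p \<and> asymptotic p `` {(\<beta> \<circ> \<rho>) n} \<in> C"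
      using \<beta> mem by simp
    ultimately show ?thesis
      using C b unfolding visual_closed_def by blast
  qed
  have "UNIV = {n. asymptotic p `` {\<beta> n} \<in> A} \<union> {n. asymptotic p `` {\<beta> n} \<in> B}"
    using \<beta> by auto
  then have "infinite {n. asymptotic p `` {\<beta> n} \<in> A} \<or> infinite {n. asymptotic p `` {\<beta> n} \<in> B}"
    using infinite_UNIV_nat by (metis finite_UnI)
  then show "b \<in> A \<union> B"
    using key A B by blast
qed

lemma istopology_visual:
  "istopology (\<lambda>U. U \<subseteq> visual_boundary p \<and> visual_closed p (visual_boundary p - U))"
  unfolding istopology_def
proof (intro conjI allI impI)
  fix S T
  assume S: "S \<subseteq> visual_boundary p \<and> visual_closed p (visual_boundary p - S)"
    and T: "T \<subseteq> visual_boundary p \<and> visual_closed p (visual_boundary p - T)"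
  show "S \<inter> T \<subseteq> visual_boundary p" using S by blast
  show "visual_closed p (visual_boundary p - S \<inter> T)"
    using visual_closed_Un S T by (metis Diff_Int)
next
  fix \<K> assume K: "\<forall>K\<in>\<K>. K \<subseteq> visual_boundary p \<and> visual_closed p (visual_boundary p - K)"
  show "\<Union>\<K> \<subseteq> visual_boundary p" using K by blast
  show "visual_closed p (visual_boundary p - \<Union>\<K>)"
    unfolding visual_closed_def
  proof (intro conjI allI impI)
    fix \<beta> b
    assume \<beta>: "\<forall>n. \<beta> n \<in> rays p \<and> asymptotic p `` {\<beta> n} \<in> visual_boundary p - \<Union>\<K>"
      and b: "b \<in> visual_boundary p"
      and sub: "\<forall>\<sigma>::nat \<Rightarrow> nat. strict_mono \<sigma> \<longrightarrow>
           (\<exists>\<tau>::nat \<Rightarrow> nat. strict_mono \<tau> \<and> (\<exists>\<alpha>\<in>b. ray_converges (\<beta> \<circ> \<sigma> \<circ> \<tau>) \<alpha>))"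
    have "b \<in> visual_boundary p - K" if "K \<in> \<K>" for K
    proof -
      have "\<forall>n. \<beta> n \<in> rays p \<and> asymptotic p `` {\<beta> n} \<in> visual_boundary p - K"
        using \<beta> that by blast
      then show ?thesis
        using K that b sub unfolding visual_closed_def by blast
    qed
    then show "b \<in> visual_boundary p - \<Union>\<K>" using b by blast
  qed auto
qed

lemma openin_visual_topology:
  "openin (visual_topology p) U \<longleftrightarrow>
     U \<subseteq> visual_boundary p \<and> visual_closed p (visual_boundary p - U)"
  unfolding visual_topology_def by (simp add: topology_inverse'[OF istopology_visual])

lemma istopology_morse:
  "istopology (\<lambda>U. U \<subseteq> morse_boundary p \<and>
     (\<forall>N\<in>morse_gauges. openin (subtopology (visual_topology p) (boundary_stratum p N))
                              (U \<inter> boundary_stratum p N)))"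
  unfolding istopology_def
proof (intro conjI allI impI ballI, goal_cases)
  case (2 S T N)
  have "S \<inter> T \<inter> boundary_stratum p N
      = (S \<inter> boundary_stratum p N) \<inter> (T \<inter> boundary_stratum p N)" by blast
  then show ?case using 2 by (simp add: openin_Int)
next
  case (4 \<K> N)
  have "\<Union>\<K> \<inter> boundary_stratum p N = \<Union>((\<lambda>U. U \<inter> boundary_stratum p N) ` \<K>)" by blast
  also have "openin (subtopology (visual_topology p) (boundary_stratum p N)) \<dots>"
    using 4 by (intro openin_Union) auto
  finally show ?case .
qed blast+

lemma openin_morse_topology:
  "openin (morse_topology p) U \<longleftrightarrow> U \<subseteq> morse_boundary p \<and>
     (\<forall>N\<in>morse_gauges. openin (subtopology (visual_topology p) (boundary_stratum p N))
                              (U \<inter> boundary_stratum p N))"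
  unfolding morse_topology_def by (simp add: topology_inverse'[OF istopology_morse])

lemma topspace_visual_topology: "topspace (visual_topology p) = visual_boundary p"
proof
  show "topspace (visual_topology p) \<subseteq> visual_boundary p"
    unfolding topspace_def by (auto simp: openin_visual_topology)
  have "openin (visual_topology p) (visual_boundary p)"
    by (auto simp: openin_visual_topology visual_closed_def)
  then show "visual_boundary p \<subseteq> topspace (visual_topology p)"
    by (rule openin_subset)
qed

lemma topspace_morse_topology: "topspace (morse_topology p) = morse_boundary p"
proof
  show "topspace (morse_topology p) \<subseteq> morse_boundary p"
    unfolding topspace_def by (auto simp: openin_morse_topology)
  have "openin (subtopology (visual_topology p) (boundary_stratum p N))
          (morse_boundary p \<inter> boundary_stratum p N)" if "N \<in> morse_gauges" for N
  proof -
    have "morse_boundary p \<inter> boundary_stratum p N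
        = topspace (subtopology (visual_topology p) (boundary_stratum p N))"
      using that
      by (auto simp: topspace_visual_topology morse_boundary_def boundary_stratum_def)
    then show ?thesis by (metis openin_topspace)
  qed
  then have "openin (morse_topology p) (morse_boundary p)"
    by (auto simp: openin_morse_topology)
  then show "morse_boundary p \<subseteq> topspace (morse_topology p)"
    by (rule openin_subset)
qed


section \<open>Ideal triangles, centers, cross-ratios\<close>

definition geodesic_from_to :: "'a::metric_space bpoint \<Rightarrow> 'a bpoint \<Rightarrow> (real \<Rightarrow> 'a) \<Rightarrow> bool" where
  "geodesic_from_to a b \<gamma> \<longleftrightarrow> geodesic UNIV \<gamma> \<and>
     (\<exists>\<alpha>\<in>a. finite_hausdorff (\<gamma> ` {..0}) (\<alpha> ` {0..})) \<and>
     (\<exists>\<beta>\<in>b. finite_hausdorff (\<gamma> ` {0..}) (\<beta> ` {0..}))"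

text \<open>\<open>\<partial>X\<^bsup>(n,N)\<^esup>\<close>, with tuples as lists.\<close>

definition morse_tuples :: "'a::metric_space \<Rightarrow> nat \<Rightarrow> gauge \<Rightarrow> 'a bpoint list set" where
  "morse_tuples p n N = {v. length v = n \<and> distinct v \<and> set v \<subseteq> morse_boundary p \<and>
     (\<forall>a\<in>set v. \<forall>b\<in>set v. a \<noteq> b \<longrightarrow>
        (\<forall>\<gamma>. geodesic_from_to a b \<gamma> \<longrightarrow> morse_geodesic N UNIV \<gamma>))}"

text \<open>The gauge in the notation \<open>m\<^bsup>N,K\<^esup>\<close> only specifies the domain \<open>\<partial>X\<^bsup>(3,N)\<^esup>\<close>, so it is
  not an argument here.\<close>

definition centers :: "real \<Rightarrow> 'a::metric_space bpoint \<Rightarrow> 'a bpoint \<Rightarrow> 'a bpoint \<Rightarrow> 'a set" where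
  "centers K a b c = {x. \<exists>\<gamma>1 \<gamma>2 \<gamma>3.
     geodesic_from_to a b \<gamma>1 \<and> geodesic_from_to b c \<gamma>2 \<and> geodesic_from_to c a \<gamma>3 \<and>
     x \<in> nbhd K (range \<gamma>1) \<and> x \<in> nbhd K (range \<gamma>2) \<and> x \<in> nbhd K (range \<gamma>3)}"

text \<open>Geodesics between generalized vertices: \<open>Inl\<close> is a point of the space, \<open>Inr\<close> a point of the
  boundary.\<close>

fun side :: "'a::metric_space + 'a bpoint \<Rightarrow> 'a + 'a bpoint \<Rightarrow> real set \<Rightarrow> (real \<Rightarrow> 'a) \<Rightarrow> bool" where
  "side (Inl x) (Inl y) I \<gamma> \<longleftrightarrow>
     geodesic I \<gamma> \<and> I = {0..dist x y} \<and> \<gamma> 0 = x \<and> \<gamma> (dist x y) = y"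
| "side (Inl x) (Inr b) I \<gamma> \<longleftrightarrow>
     geodesic I \<gamma> \<and> I = {0..} \<and> \<gamma> 0 = x \<and> (\<exists>\<beta>\<in>b. finite_hausdorff (\<gamma> ` {0..}) (\<beta> ` {0..}))"
| "side (Inr a) (Inl y) I \<gamma> \<longleftrightarrow>
     geodesic I \<gamma> \<and> I = {0..} \<and> \<gamma> 0 = y \<and> (\<exists>\<alpha>\<in>a. finite_hausdorff (\<gamma> ` {0..}) (\<alpha> ` {0..}))"
| "side (Inr a) (Inr b) I \<gamma> \<longleftrightarrow> I = UNIV \<and> geodesic_from_to a b \<gamma>"

text \<open>The property required of the constant \<open>K\<^sub>N\<close>.\<close>

definition triangle_constant :: "'a::metric_space \<Rightarrow> gauge \<Rightarrow> real \<Rightarrow> bool" where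
  "triangle_constant p N K \<longleftrightarrow>
     (\<forall>u v w I1 I2 I3 \<gamma>1 \<gamma>2 \<gamma>3.
        {u, v, w} \<subseteq> range Inl \<union> Inr ` morse_boundary p \<longrightarrow>
        side u v I1 \<gamma>1 \<longrightarrow> side v w I2 \<gamma>2 \<longrightarrow> side w u I3 \<gamma>3 \<longrightarrow>
        morse_geodesic N I1 \<gamma>1 \<longrightarrow> morse_geodesic N I2 \<gamma>2 \<longrightarrow> morse_geodesic N I3 \<gamma>3 \<longrightarrow>
        (\<exists>q1\<in>\<gamma>1 ` I1. \<exists>q2\<in>\<gamma>2 ` I2. \<exists>q3\<in>\<gamma>3 ` I3.
           dist q1 q2 \<le> K \<and> dist q2 q3 \<le> K \<and> dist q3 q1 \<le> K))"

text \<open>In the following, \<open>\<kappa> N\<close> is the constant \<open>K\<^sub>N\<close>. The sets of centers of a tuple in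
  \<open>\<partial>X\<^bsup>(3,N)\<^esup>\<close> are bounded, so the real-valued \<^const>\<open>diameter\<close> is the right notion.\<close>

definition cross_ratio ::
  "(gauge \<Rightarrow> real) \<Rightarrow> gauge \<Rightarrow> 'a::metric_space bpoint \<Rightarrow> 'a bpoint \<Rightarrow> 'a bpoint \<Rightarrow> 'a bpoint \<Rightarrow> real"
  where
  "cross_ratio \<kappa> N a b c d = diameter (centers (\<kappa> N) a b c \<union> centers (\<kappa> N) a d c)"

definition two_stable ::
  "'a::metric_space \<Rightarrow> 'b::metric_space \<Rightarrow> ('a bpoint \<Rightarrow> 'b bpoint) \<Rightarrow> bool" where
  "two_stable p r h \<longleftrightarrow>
     (\<forall>N\<in>morse_gauges. \<exists>N'\<in>morse_gauges. map h ` morse_tuples p 2 N \<subseteq> morse_tuples r 2 N')"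

definition quasi_moebius ::
  "(gauge \<Rightarrow> real) \<Rightarrow> 'a::metric_space \<Rightarrow> 'b::metric_space \<Rightarrow> ('a bpoint \<Rightarrow> 'b bpoint) \<Rightarrow> bool" where
  "quasi_moebius \<kappa> p r h \<longleftrightarrow>
     (\<forall>N\<in>morse_gauges. \<forall>N'\<in>morse_gauges. map h ` morse_tuples p 2 N \<subseteq> morse_tuples r 2 N' \<longrightarrow>
        (\<exists>\<psi>::real \<Rightarrow> real. \<psi> \<in> {0..} \<rightarrow> {0..} \<and> continuous_on {0..} \<psi> \<and> mono_on {0..} \<psi> \<and>
           (\<forall>a b c d. [a, b, c, d] \<in> morse_tuples p 4 N \<longrightarrow>
              cross_ratio \<kappa> N' (h a) (h b) (h c) (h d) \<le> \<psi> (cross_ratio \<kappa> N a b c d))))"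

definition small_cross_ratio_property ::
  "(gauge \<Rightarrow> real) \<Rightarrow> 'a::metric_space \<Rightarrow> bool" where
  "small_cross_ratio_property \<kappa> p \<longleftrightarrow>
     (\<forall>N\<in>morse_gauges. \<exists>C>0. \<forall>a b c d. [a, b, c, d] \<in> morse_tuples p 4 N \<longrightarrow>
        cross_ratio \<kappa> N a b c d < C \<or> cross_ratio \<kappa> N a c b d < C \<or> cross_ratio \<kappa> N b a c d < C)"

definition centers_cover :: "'a::metric_space \<Rightarrow> gauge \<Rightarrow> real \<Rightarrow> bool" where
  "centers_cover p N K \<longleftrightarrow>
     (UNIV :: 'a set) = \<Union>{centers K a b c | a b c. [a, b, c] \<in> morse_tuples p 3 N}"

definition morse_center_space :: "'a::metric_space \<Rightarrow> bool" where
  "morse_center_space p \<longleftrightarrow> (\<exists>N\<in>morse_gauges. \<exists>K>0. centers_cover p N K)"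

text \<open>\<open>f\<close> is one of the maps \<open>f\<^sub>K\<close>, i.e. arises from some choice, for each \<open>x \<noteq> p\<close>, of an ideal
  triangle with \<open>K\<close>-center \<open>x\<close> and of a \<open>K\<close>-center of the image tuple.\<close>

definition center_map ::
  "'a::metric_space \<Rightarrow> 'b::metric_space \<Rightarrow> gauge \<Rightarrow> ('a bpoint \<Rightarrow> 'b bpoint) \<Rightarrow> real \<Rightarrow> ('a \<Rightarrow> 'b) \<Rightarrow> bool"
  where
  "center_map p r N h K f \<longleftrightarrow> f p = r \<and>
     (\<forall>x. x \<noteq> p \<longrightarrow> (\<exists>a b c. [a, b, c] \<in> morse_tuples p 3 N \<and>
        x \<in> centers K a b c \<and> f x \<in> centers K (h a) (h b) (h c)))"

end

theory Submission
  imports Defs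
begin

text \<open>Whether a line between two boundary points passes near a given point \<open>x\<close> obeys a thin triangle
  alternative: if the line from \<open>a\<close> to \<open>b\<close> does, then for every third \<open>c\<close> so does the line from \<open>a\<close>
  to \<open>c\<close> or the one from \<open>b\<close> to \<open>c\<close>. Hence, for two triples with centers near \<open>x\<close>, the vertices of
  one can be exchanged one at a time for those of the other such that \<open>x\<close> stays a center. All these
  points are joined to the vicinity of \<open>x\<close> by uniformly Morse rays, so all lines between them are
  uniformly Morse and every exchange has bounded cross-ratio. As \<open>h\<close> is quasi-moebius, the
  centers of the image triples move by a bounded amount. So the center maps of \<open>h\<close> and \<open>h'\<close>
  are coarsely Lipschitz and coarsely inverse to each other.\<close>

section \<open>Geodesics that are Morse on every subsegment\<close>

text \<open>The obstacle is uniformity. Asymptotic rays, and lines with common ends, are a priori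
  only at finite distance, with a constant that depends on the pair. The cure is always the same
  surgery: a quasi-geodesic is cut at an approximate nearest point to some target and continued by a
  geodesic to that target. This multiplies \<open>l\<close> by 3 however far away the target is, and
  the Morse property then gives a bound in terms of the gauge alone. The arguments of
  \<open>M (3, ...)\<close> and \<open>M (9, ...)\<close> count how often this was done. The
  exchange of vertices has to be made in a suitable order, since an arbitrary mixed triple need not
  have a center near \<open>x\<close>. The alternative, applied to each side of the new triangle,
  relates an old vertex to at least two of the three new ones. Two such pairs in a set of three
  meet, and this overlap determines which new vertex enters first.\<close>

definition seg_morse :: "gauge \<Rightarrow> real set \<Rightarrow> (real \<Rightarrow> 'a::metric_space) \<Rightarrow> bool" where
  "seg_morse M I \<gamma> \<longleftrightarrow> geodesic I \<gamma> \<and> (\<forall>u\<in>I. \<forall>v\<in>I. u \<le> v \<longrightarrow>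
     (\<forall>l e (s::real) t \<sigma>. s \<le> t \<longrightarrow> qi_embedding_on {s..t} l e \<sigma> \<longrightarrow> \<sigma> s = \<gamma> u \<longrightarrow> \<sigma> t = \<gamma> v \<longrightarrow>
        (\<forall>\<tau>\<in>{s..t}. \<exists>w\<in>{u..v}. dist (\<sigma> \<tau>) (\<gamma> w) \<le> M (l, e))))"

lemma closed_interval_Icc: "s \<le> t \<Longrightarrow> closed_interval {s..t}" for s t :: real
  by (auto simp: closed_interval_def is_interval_cc)

lemma closed_interval_Ici: "closed_interval {s..}" for s :: real
  by (auto simp: closed_interval_def is_interval_ci)

lemma closed_interval_UNIV: "closed_interval UNIV"
  by (auto simp: closed_interval_def is_interval_univ)

lemma closed_interval_Icc_subset:
  "closed_interval I \<Longrightarrow> u \<in> I \<Longrightarrow> v \<in> I \<Longrightarrow> {u..v} \<subseteq> I" for u v :: real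
  unfolding closed_interval_def is_interval_1 by (meson atLeastAtMost_iff subsetI)

lemma qi_embedding_geodesic:
  assumes "\<And>s t. s \<in> I \<Longrightarrow> t \<in> I \<Longrightarrow> dist (\<gamma> s) (\<gamma> t) = \<bar>s - t\<bar>"
  shows "qi_embedding_on I 1 0 \<gamma>"
  using assms by (auto simp: qi_embedding_on_def dist_real_def)

lemma qi_embedding_on_subset:
  "qi_embedding_on T l e \<sigma> \<Longrightarrow> S \<subseteq> T \<Longrightarrow> qi_embedding_on S l e \<sigma>"
  unfolding qi_embedding_on_def by blast

lemma qi_embedding_on_mono:
  assumes "qi_embedding_on S l e \<sigma>" "l \<le> l'" "e \<le> e'"
  shows "qi_embedding_on S l' e' \<sigma>"
  unfolding qi_embedding_on_def
proof (intro conjI ballI)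
  have l: "1 \<le> l" and e: "0 \<le> e" using assms(1) by (auto simp: qi_embedding_on_def)
  then show "1 \<le> l'" "0 \<le> e'" using assms by auto
  fix x y assume xy: "x \<in> S" "y \<in> S"
  have "1 / l' * dist x y \<le> 1 / l * dist x y"
    using l assms(2) by (intro mult_right_mono) (auto simp: frac_le)
  moreover have "l * dist x y \<le> l' * dist x y" using assms(2) by (intro mult_right_mono) auto
  moreover have "1 / l * dist x y - e \<le> dist (\<sigma> x) (\<sigma> y)" "dist (\<sigma> x) (\<sigma> y) \<le> l * dist x y + e"
    using assms(1) xy by (auto simp: qi_embedding_on_def)
  ultimately show "1 / l' * dist x y - e' \<le> dist (\<sigma> x) (\<sigma> y)"
      "dist (\<sigma> x) (\<sigma> y) \<le> l' * dist x y + e'" using assms(3) by linarith+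
qed

lemma qi_embedding_on_reparam:
  assumes "qi_embedding_on S l e \<sigma>" "\<And>x. x \<in> T \<Longrightarrow> \<phi> x \<in> S"
    "\<And>x y. x \<in> T \<Longrightarrow> y \<in> T \<Longrightarrow> dist (\<phi> x) (\<phi> y) = dist x y"
  shows "qi_embedding_on T l e (\<lambda>x. \<sigma> (\<phi> x))"
  using assms unfolding qi_embedding_on_def by metis

lemma qi_embedding_on_cong:
  "(\<And>x. x \<in> S \<Longrightarrow> \<sigma> x = \<tau> x) \<Longrightarrow> qi_embedding_on S l e \<sigma> = qi_embedding_on S l e \<tau>"
  unfolding qi_embedding_on_def by auto

lemma seg_morseD:
  assumes "seg_morse M I \<gamma>" "u \<in> I" "v \<in> I" "u \<le> v" "(s::real) \<le> t" "qi_embedding_on {s..t} l e \<sigma>"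
    "\<sigma> s = \<gamma> u" "\<sigma> t = \<gamma> v" "\<tau> \<in> {s..t}"
  shows "\<exists>w\<in>{u..v}. dist (\<sigma> \<tau>) (\<gamma> w) \<le> M (l, e)"
  using assms unfolding seg_morse_def by blast

lemma seg_morse_geodesic: "seg_morse M I \<gamma> \<Longrightarrow> geodesic I \<gamma>"
  by (simp add: seg_morse_def)

lemma seg_morseD_rev:
  assumes "seg_morse M I \<gamma>" "u \<in> I" "v \<in> I" "u \<le> v" "(s::real) \<le> t" "qi_embedding_on {s..t} l e \<sigma>"
    "\<sigma> s = \<gamma> v" "\<sigma> t = \<gamma> u" "\<tau> \<in> {s..t}"
  shows "\<exists>w\<in>{u..v}. dist (\<sigma> \<tau>) (\<gamma> w) \<le> M (l, e)"
proof -
  have "qi_embedding_on {s..t} l e (\<lambda>x. \<sigma> (s + t - x))"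
    using assms(6) by (rule qi_embedding_on_reparam) (auto simp: dist_real_def)
  then show ?thesis
    using seg_morseD[OF assms(1-5), of l e "\<lambda>x. \<sigma> (s + t - x)" "s + t - \<tau>"] assms(7-9) by auto
qed

text \<open>The convention on subgeodesics, applied to the segment between two parameters, places
  the nearby point between them, which is what lets halves of a line be glued later. Conversely, a
  closed \<open>J\<close> contains the segment between any two of its points, and endpoints met in
  reverse order are handled by running the quasi-geodesic backwards.\<close>

lemma morse_geodesic_iff_seg_morse: "morse_geodesic M I \<gamma> \<longleftrightarrow> seg_morse M I \<gamma>"
proof
  assume m: "morse_geodesic M I \<gamma>"
  then have g: "geodesic I \<gamma>" and I: "closed_interval I"
    by (auto simp: morse_geodesic_def geodesic_def)
  show "seg_morse M I \<gamma>"
    unfolding seg_morse_def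
  proof (intro conjI g ballI allI impI)
    fix u v l e s t \<sigma> \<tau>
    assume uv: "u \<in> I" "v \<in> I" "u \<le> v" and st: "(s::real) \<le> t" and q: "qi_embedding_on {s..t} l e \<sigma>"
      and ends: "\<sigma> s = \<gamma> u" "\<sigma> t = \<gamma> v" and \<tau>: "\<tau> \<in> {s..t}"
    have "morse M {u..v} \<gamma>"
      using m uv closed_interval_Icc_subset[OF I] closed_interval_Icc by (simp add: morse_geodesic_def)
    then have "\<sigma> ` {s..t} \<subseteq> nbhd (M (l, e)) (\<gamma> ` {u..v})"
      using st q ends uv(3) closed_interval_Icc[OF st] unfolding morse_def quasi_geodesic_def
      by (metis atLeastAtMost_iff imageI order_refl)
    then show "\<exists>w\<in>{u..v}. dist (\<sigma> \<tau>) (\<gamma> w) \<le> M (l, e)"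
      using \<tau> by (fastforce simp: nbhd_def dist_commute)
  qed
next
  assume m: "seg_morse M I \<gamma>"
  then have g: "geodesic I \<gamma>" by (rule seg_morse_geodesic)
  show "morse_geodesic M I \<gamma>"
    unfolding morse_geodesic_def
  proof (intro conjI g allI impI)
    fix J assume J: "J \<subseteq> I" "closed_interval J"
    show "morse M J \<gamma>"
      unfolding morse_def
    proof (intro conjI allI impI)
      have "quasi_geodesic 1 0 J \<gamma>"
        unfolding quasi_geodesic_def using J g
        by (auto intro!: qi_embedding_geodesic simp: geodesic_def subset_iff)
      then show "\<exists>l e. quasi_geodesic l e J \<gamma>" by blast
      fix l e s t \<sigma>
      assume st: "s \<le> t" and q: "quasi_geodesic l e {s..t} \<sigma>"
        and "\<sigma> s \<in> \<gamma> ` J" "\<sigma> t \<in> \<gamma> ` J"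
      then obtain u v where uv: "u \<in> J" "v \<in> J" "\<sigma> s = \<gamma> u" "\<sigma> t = \<gamma> v" by auto
      have q': "qi_embedding_on {s..t} l e \<sigma>" using q by (simp add: quasi_geodesic_def)
      have "\<exists>w\<in>J. dist (\<sigma> \<tau>) (\<gamma> w) \<le> M (l, e)" if \<tau>: "\<tau> \<in> {s..t}" for \<tau>
      proof (cases "u \<le> v")
        case True
        then show ?thesis
          using seg_morseD[OF m _ _ True st q' uv(3,4) \<tau>] uv J
            closed_interval_Icc_subset[OF J(2) uv(1,2)] by blast
      next
        case False
        then have "v \<le> u" by simp
        then show ?thesis
          using seg_morseD_rev[OF m _ _ _ st q' uv(3,4) \<tau>] uv J
            closed_interval_Icc_subset[OF J(2) uv(2,1)] by blast
      qed
      then show "\<sigma> ` {s..t} \<subseteq> nbhd (M (l, e)) (\<gamma> ` J)"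
        by (fastforce simp: nbhd_def dist_commute)
    qed
  qed
qed

lemma geodesic_reparam:
  assumes "geodesic I \<gamma>" "closed_interval J" "\<And>x. x \<in> J \<Longrightarrow> \<phi> x \<in> I"
    "\<And>x y. \<bar>\<phi> x - \<phi> y\<bar> = \<bar>x - y\<bar>"
  shows "geodesic J (\<lambda>x. \<gamma> (\<phi> x))"
  using assms by (simp add: geodesic_def)

lemma seg_morse_shift:
  assumes m: "seg_morse M I \<gamma>" and J: "closed_interval J" "\<And>x. x \<in> J \<Longrightarrow> c + x \<in> I"
  shows "seg_morse M J (\<lambda>x. \<gamma> (c + x))"
  unfolding seg_morse_def
proof (intro conjI ballI allI impI)
  show "geodesic J (\<lambda>x. \<gamma> (c + x))"
    using geodesic_reparam[OF seg_morse_geodesic[OF m] J(1), of "\<lambda>x. c + x"] J(2) by simp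
  fix u v l e s t \<sigma> \<tau>
  assume "u \<in> J" "v \<in> J" "u \<le> v" "(s::real) \<le> t" "qi_embedding_on {s..t} l e \<sigma>"
      "\<sigma> s = \<gamma> (c + u)" "\<sigma> t = \<gamma> (c + v)" "\<tau> \<in> {s..t}"
  then obtain w where "w \<in> {c + u..c + v}" "dist (\<sigma> \<tau>) (\<gamma> w) \<le> M (l, e)"
    using seg_morseD[OF m, of "c + u" "c + v"] J(2) by (metis add_le_cancel_left)
  then show "\<exists>w\<in>{u..v}. dist (\<sigma> \<tau>) (\<gamma> (c + w)) \<le> M (l, e)"
    by (intro bexI[of _ "w - c"]) auto
qed

lemma seg_morse_reflect:
  assumes m: "seg_morse M I \<gamma>" and J: "closed_interval J" "\<And>x. x \<in> J \<Longrightarrow> c - x \<in> I"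
  shows "seg_morse M J (\<lambda>x. \<gamma> (c - x))"
  unfolding seg_morse_def
proof (intro conjI ballI allI impI)
  show "geodesic J (\<lambda>x. \<gamma> (c - x))"
    using geodesic_reparam[OF seg_morse_geodesic[OF m] J(1), of "\<lambda>x. c - x"] J(2)
    by (simp add: abs_minus_commute)
  fix u v l e s t \<sigma> \<tau>
  assume "u \<in> J" "v \<in> J" "u \<le> v" "(s::real) \<le> t" "qi_embedding_on {s..t} l e \<sigma>"
      "\<sigma> s = \<gamma> (c - u)" "\<sigma> t = \<gamma> (c - v)" "\<tau> \<in> {s..t}"
  then obtain w where "w \<in> {c - v..c - u}" "dist (\<sigma> \<tau>) (\<gamma> w) \<le> M (l, e)"
    using seg_morseD_rev[OF m, of "c - v" "c - u"] J(2) by (metis diff_left_mono)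
  then show "\<exists>w\<in>{u..v}. dist (\<sigma> \<tau>) (\<gamma> (c - w)) \<le> M (l, e)"
    by (intro bexI[of _ "c - w"]) auto
qed

lemma morse_gauge_nonneg: "M \<in> morse_gauges \<Longrightarrow> 1 \<le> l \<Longrightarrow> 0 \<le> e \<Longrightarrow> 0 \<le> M (l, e)"
  by (auto simp: morse_gauges_def PiE_def Pi_def)

lemma seg_morse_mono:
  assumes "seg_morse M I \<gamma>" "\<And>l e. 1 \<le> l \<Longrightarrow> 0 \<le> e \<Longrightarrow> M (l, e) \<le> M' (l, e)"
  shows "seg_morse M' I \<gamma>"
  unfolding seg_morse_def
proof (intro conjI ballI allI impI)
  show "geodesic I \<gamma>" by (rule seg_morse_geodesic[OF assms(1)])
  fix u v l e s t \<sigma> \<tau>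
  assume *: "u \<in> I" "v \<in> I" "u \<le> v" "(s::real) \<le> t" "qi_embedding_on {s..t} l e \<sigma>"
      "\<sigma> s = \<gamma> u" "\<sigma> t = \<gamma> v" "\<tau> \<in> {s..t}"
  have "M (l, e) \<le> M' (l, e)" using *(5) assms(2) by (simp add: qi_embedding_on_def)
  then show "\<exists>w\<in>{u..v}. dist (\<sigma> \<tau>) (\<gamma> w) \<le> M' (l, e)"
    using seg_morseD[OF assms(1) *] by force
qed

text \<open>Gauges are extensional, so one given by a formula belongs to \<open>morse_gauges\<close>
  only after restriction. The constants of a quasi-geodesic always lie in the domain, hence nothing
  is lost.\<close>

lemma seg_morse_restrict:
  assumes "seg_morse F I \<gamma>"
  shows "seg_morse (restrict F ({1..} \<times> {0..})) I \<gamma>"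
  using assms by (rule seg_morse_mono) simp

lemma restrict_morse_gauge:
  "(\<And>l e. 1 \<le> l \<Longrightarrow> 0 \<le> e \<Longrightarrow> 0 \<le> F (l, e)) \<Longrightarrow> restrict F ({1..} \<times> {0..}) \<in> morse_gauges"
  by (auto simp: morse_gauges_def)

lemma morse_gauge_bound:
  assumes "M \<in> morse_gauges" "M' \<in> morse_gauges"
  shows "\<exists>M''\<in>morse_gauges. M \<le> M'' \<and> M' \<le> M''"
proof -
  define F where "F = restrict (\<lambda>x. max (M x) (M' x)) ({1..} \<times> {0..})"
  have "F \<in> morse_gauges"
    unfolding F_def using morse_gauge_nonneg[OF assms(1)]
    by (intro restrict_morse_gauge) (auto simp: max_def intro: order_trans)
  \<comment> \<open>Outside the domain \<open>M\<close>, \<open>M'\<close> and \<open>F\<close> all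
    take the value \<open>undefined\<close>, so the order of functions holds there as well.\<close>
  moreover have "M x = undefined" "M' x = undefined" if "x \<notin> {1..} \<times> {0..}" for x
    using assms that PiE_arb unfolding morse_gauges_def by metis+
  then have "M \<le> F" "M' \<le> F" by (auto simp: F_def le_fun_def restrict_def)
  ultimately show ?thesis by blast
qed

section \<open>Modifying quasi-geodesics\<close>

text \<open>Quasi-geodesics may jump, so the infimum of the distances need not be attained. The
  error 1 is the origin of the summand in \<open>2 * e + 1\<close>.\<close>

lemma approx_nearest:
  fixes f :: "'a \<Rightarrow> 'b::metric_space"
  assumes "S \<noteq> {}"
  shows "\<exists>t\<in>S. \<forall>s\<in>S. dist x (f t) \<le> dist x (f s) + 1"
proof -
  define D where "D = (\<lambda>s. dist x (f s)) ` S"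
  have "D \<noteq> {}" "bdd_below D" using assms by (auto simp: D_def bdd_below_def intro: exI[of _ 0])
  then obtain d where d: "d \<in> D" "d < Inf D + 1"
    by (metis cInf_lessD less_add_one)
  then obtain t where t: "t \<in> S" "d = dist x (f t)" by (auto simp: D_def)
  have "dist x (f t) \<le> dist x (f s) + 1" if "s \<in> S" for s
    using cInf_lower[OF _ \<open>bdd_below D\<close>, of "dist x (f s)"] that d t by (auto simp: D_def)
  with t show ?thesis by blast
qed

text \<open>Write \<open>d\<close> for \<open>dist (\<rho> x) (\<rho> y)\<close>. As
  \<open>\<rho> T\<close> is approximately nearest seen from one side, one of the distances to
  \<open>\<rho> T\<close> is at most \<open>d + \<delta>\<close>, hence the other is at most
  \<open>2 * d + \<delta>\<close>. Their sum controls \<open>y - x\<close>, which explains the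
  factor 3.\<close>

lemma qi_embedding_concat:
  fixes \<rho> :: "real \<Rightarrow> 'a::metric_space"
  assumes q1: "qi_embedding_on {x\<in>I. x \<le> T} l e \<rho>" and q2: "qi_embedding_on {x\<in>I. T \<le> x} l e \<rho>"
    and T: "T \<in> I" and \<delta>: "0 \<le> \<delta>"
    and near: "(\<forall>x\<in>I. \<forall>y\<in>I. x \<le> T \<longrightarrow> T \<le> y \<longrightarrow> dist (\<rho> x) (\<rho> T) \<le> dist (\<rho> x) (\<rho> y) + \<delta>) \<or>
       (\<forall>x\<in>I. \<forall>y\<in>I. x \<le> T \<longrightarrow> T \<le> y \<longrightarrow> dist (\<rho> y) (\<rho> T) \<le> dist (\<rho> x) (\<rho> y) + \<delta>)"
  shows "qi_embedding_on I (3 * l) (2 * e + \<delta>) \<rho>"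
proof -
  have l: "1 \<le> l" and e: "0 \<le> e" using q1 by (auto simp: qi_embedding_on_def)
  have side: "1 / (3 * l) * dist x y - (2 * e + \<delta>) \<le> dist (\<rho> x) (\<rho> y) \<and>
      dist (\<rho> x) (\<rho> y) \<le> 3 * l * dist x y + (2 * e + \<delta>)"
    if "qi_embedding_on S l e \<rho>" "x \<in> S" "y \<in> S" for x y S
  proof -
    have "qi_embedding_on S (3 * l) (2 * e + \<delta>) \<rho>"
      using that(1) by (rule qi_embedding_on_mono) (use l e \<delta> in auto)
    with that(2,3) show ?thesis unfolding qi_embedding_on_def by blast
  qed
  have across: "1 / (3 * l) * dist x y - (2 * e + \<delta>) \<le> dist (\<rho> x) (\<rho> y) \<and>
      dist (\<rho> x) (\<rho> y) \<le> 3 * l * dist x y + (2 * e + \<delta>)"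
    if x: "x \<in> I" "x \<le> T" and y: "y \<in> I" "T \<le> y" for x y
  proof
    let ?d = "dist (\<rho> x) (\<rho> y)" and ?a = "dist (\<rho> x) (\<rho> T)" and ?b = "dist (\<rho> y) (\<rho> T)"
    have A: "1 / l * (T - x) - e \<le> ?a" "?a \<le> l * (T - x) + e"
    proof -
      have "1 / l * dist x T - e \<le> ?a \<and> ?a \<le> l * dist x T + e"
        using q1 x T unfolding qi_embedding_on_def by simp
      then show "1 / l * (T - x) - e \<le> ?a" "?a \<le> l * (T - x) + e"
        using x by (auto simp: dist_real_def)
    qed
    have "1 / l * dist y T - e \<le> ?b \<and> ?b \<le> l * dist y T + e"
      using q2 y T unfolding qi_embedding_on_def by simp
    then have B: "1 / l * (y - T) - e \<le> ?b" "?b \<le> l * (y - T) + e"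
      using y by (auto simp: dist_real_def)
    have "?a \<le> ?d + \<delta> \<or> ?b \<le> ?d + \<delta>" using near x y by blast
    moreover have "?a \<le> ?d + ?b" "?b \<le> ?d + ?a"
      using dist_triangle[of "\<rho> x" "\<rho> T" "\<rho> y"] dist_triangle[of "\<rho> y" "\<rho> T" "\<rho> x"]
      by (simp_all add: dist_commute)
    ultimately have ab: "?a + ?b \<le> 3 * ?d + 2 * \<delta>" using \<delta> by auto
    define z where "z = (y - x) / l"
    have "z = 1 / l * (T - x) + 1 / l * (y - T)" by (simp add: z_def diff_divide_distrib)
    then have "z / 3 \<le> ?d + (2 * e + \<delta>)" using ab A B \<delta> e by linarith
    moreover have "1 / (3 * l) * dist x y = z / 3"
      using x y by (simp add: z_def dist_real_def mult.commute)
    ultimately show "1 / (3 * l) * dist x y - (2 * e + \<delta>) \<le> ?d" by linarith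
    have "?d \<le> ?a + ?b" by (metis dist_triangle2)
    also have "\<dots> \<le> l * (y - x) + 2 * e" using A B by (simp add: algebra_simps)
    also have "\<dots> \<le> 3 * l * (y - x) + (2 * e + \<delta>)"
    proof -
      have "l * (y - x) \<le> 3 * l * (y - x)" using l x y by (intro mult_right_mono) auto
      then show ?thesis using \<delta> by linarith
    qed
    finally show "?d \<le> 3 * l * dist x y + (2 * e + \<delta>)" using x y by (simp add: dist_real_def)
  qed
  show ?thesis
    unfolding qi_embedding_on_def
  proof (intro conjI)
    show "1 \<le> 3 * l" "0 \<le> 2 * e + \<delta>" using l e \<delta> by auto
    show "\<forall>x\<in>I. \<forall>y\<in>I. 1 / (3 * l) * dist x y - (2 * e + \<delta>) \<le> dist (\<rho> x) (\<rho> y) \<and>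
      dist (\<rho> x) (\<rho> y) \<le> 3 * l * dist x y + (2 * e + \<delta>)"
    proof (intro ballI)
      fix x y assume xy: "x \<in> I" "y \<in> I"
      consider "x \<le> T" "y \<le> T" | "T \<le> x" "T \<le> y" | "x \<le> T" "T \<le> y" | "y \<le> T" "T \<le> x"
        by linarith
      then show "1 / (3 * l) * dist x y - (2 * e + \<delta>) \<le> dist (\<rho> x) (\<rho> y) \<and>
          dist (\<rho> x) (\<rho> y) \<le> 3 * l * dist x y + (2 * e + \<delta>)"
      proof cases
        case 1 then show ?thesis using side[OF q1] xy by simp
      next
        case 2 then show ?thesis using side[OF q2] xy by simp
      next
        case 3 then show ?thesis using across xy by blast
      next
        case 4 then show ?thesis using across[of y x] xy by (simp add: dist_commute)
      qed
    qed
  qed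
qed

text \<open>Since \<sigma> need not be continuous, just its two end values can be moved onto
  \<gamma>, at the price of \<open>2 * D\<close> in the additive constant. Interior values are
  unchanged; the summand \<open>D\<close> takes care of the ends.\<close>

lemma seg_morse_near_ends:
  assumes m: "seg_morse M I \<gamma>" and M: "M \<in> morse_gauges" and uv: "u \<in> I" "v \<in> I" "u \<le> v"
    and st: "(s::real) \<le> t" and q: "qi_embedding_on {s..t} l e \<sigma>"
    and D: "dist (\<sigma> s) (\<gamma> u) \<le> D" "dist (\<sigma> t) (\<gamma> v) \<le> D" and \<tau>: "\<tau> \<in> {s..t}"
  shows "\<exists>w\<in>{u..v}. dist (\<sigma> \<tau>) (\<gamma> w) \<le> M (l, e + 2 * D) + D"
proof -
  have l: "1 \<le> l" and e: "0 \<le> e" using q by (auto simp: qi_embedding_on_def)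
  have D0: "0 \<le> D" using D by (meson dist_not_less_zero le_less_trans not_le)
  have M0: "0 \<le> M (l, e + 2 * D)" using morse_gauge_nonneg[OF M l] e D0 by simp
  consider "\<tau> = s" | "\<tau> = t" | "s < \<tau>" "\<tau> < t" using \<tau> by fastforce
  then show ?thesis
  proof cases
    case 1 then show ?thesis using D M0 uv by (intro bexI[of _ u]) auto
  next
    case 2 then show ?thesis using D M0 uv by (intro bexI[of _ v]) auto
  next
    case 3
    define \<rho> where "\<rho> = \<sigma>(s := \<gamma> u, t := \<gamma> v)"
    have near: "dist (\<rho> x) (\<sigma> x) \<le> D" for x
      using D D0 by (auto simp: \<rho>_def dist_commute)
    have "qi_embedding_on {s..t} l (e + 2 * D) \<rho>"
      unfolding qi_embedding_on_def
    proof (intro conjI ballI)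
      show "1 \<le> l" "0 \<le> e + 2 * D" using l e D0 by auto
      fix x y assume "x \<in> {s..t}" "y \<in> {s..t}"
      then have "1 / l * dist x y - e \<le> dist (\<sigma> x) (\<sigma> y)" "dist (\<sigma> x) (\<sigma> y) \<le> l * dist x y + e"
        using q by (auto simp: qi_embedding_on_def)
      moreover have "dist (\<rho> x) (\<rho> y) \<le> dist (\<sigma> x) (\<sigma> y) + 2 * D"
          "dist (\<sigma> x) (\<sigma> y) \<le> dist (\<rho> x) (\<rho> y) + 2 * D"
        using near[of x] near[of y] dist_triangle[of "\<rho> x" "\<rho> y" "\<sigma> x"] dist_triangle[of "\<sigma> x" "\<rho> y" "\<sigma> y"]
          dist_triangle[of "\<sigma> x" "\<sigma> y" "\<rho> x"] dist_triangle[of "\<rho> x" "\<sigma> y" "\<rho> y"]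
        by (auto simp: dist_commute)
      ultimately show "1 / l * dist x y - (e + 2 * D) \<le> dist (\<rho> x) (\<rho> y)"
          "dist (\<rho> x) (\<rho> y) \<le> l * dist x y + (e + 2 * D)" by linarith+
    qed
    from seg_morseD[OF m uv st this, of \<tau>] 3 \<tau> D0 show ?thesis
      by (force simp: \<rho>_def)
  qed
qed

lemma geodesic_segment_exists:
  assumes "proper_geodesic TYPE('a::metric_space)"
  shows "\<exists>\<eta>::real \<Rightarrow> 'a. \<eta> 0 = x \<and> \<eta> (dist x y) = y \<and>
        (\<forall>s\<in>{0..dist x y}. \<forall>t\<in>{0..dist x y}. dist (\<eta> s) (\<eta> t) = \<bar>s - t\<bar>)"
  using assms by (simp add: proper_geodesic_def)

text \<open>An approximate nearest point to \<open>y\<close> is also one to every point of the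
  geodesic that leads from it to \<open>y\<close>, so \<open>qi_embedding_concat\<close> applies
  with \<open>\<delta> = 1\<close>. The domain is any set with maximum \<open>T\<close>, in order to
  serve segments and half-lines alike.\<close>

lemma qi_embedding_append_geodesic:
  fixes q :: "real \<Rightarrow> 'a::metric_space"
  assumes PG: "proper_geodesic TYPE('a)" and q: "qi_embedding_on I l e q"
    and T: "T \<in> I" "\<And>x. x \<in> I \<Longrightarrow> x \<le> T"
    and near: "\<And>x. x \<in> I \<Longrightarrow> dist y (q T) \<le> dist y (q x) + 1" and L_def: "L = dist y (q T)"
  shows "\<exists>\<rho>. (\<forall>x\<in>I. \<rho> x = q x) \<and> \<rho> (T + L) = y \<and>
     qi_embedding_on (I \<union> {T..T + L}) (3 * l) (2 * e + 1) \<rho>"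
proof -
  obtain \<eta> :: "real \<Rightarrow> 'a" where \<eta>: "\<eta> 0 = q T" "\<eta> L = y"
      "\<And>s t. s \<in> {0..L} \<Longrightarrow> t \<in> {0..L} \<Longrightarrow> dist (\<eta> s) (\<eta> t) = \<bar>s - t\<bar>"
    using geodesic_segment_exists[OF PG, of "q T" y] by (auto simp: L_def dist_commute)
  have l: "1 \<le> l" and e: "0 \<le> e" using q by (auto simp: qi_embedding_on_def)
  have L0: "0 \<le> L" by (simp add: L_def)
  define \<rho> where "\<rho> = (\<lambda>\<tau>. if \<tau> \<le> T then q \<tau> else \<eta> (\<tau> - T))"
  have \<rho>1: "\<rho> x = q x" if "x \<in> I" for x using T(2)[OF that] by (simp add: \<rho>_def)
  have \<rho>2: "\<rho> x = \<eta> (x - T)" if "T \<le> x" for x using that \<eta>(1) by (auto simp: \<rho>_def)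
  let ?J = "I \<union> {T..T + L}"
  have "qi_embedding_on {x \<in> ?J. x \<le> T} l e \<rho>"
  proof -
    have "{x \<in> ?J. x \<le> T} = I" using T L0 by auto
    then show ?thesis using q qi_embedding_on_cong[of I \<rho> q] \<rho>1 by simp
  qed
  moreover have "qi_embedding_on {x \<in> ?J. T \<le> x} l e \<rho>"
  proof -
    have "qi_embedding_on {x \<in> ?J. T \<le> x} 1 0 \<rho>"
    proof (rule qi_embedding_geodesic)
      fix s t assume "s \<in> {x \<in> ?J. T \<le> x}" "t \<in> {x \<in> ?J. T \<le> x}"
      then have "T \<le> s" "s \<le> T + L" "T \<le> t" "t \<le> T + L" using T L0 by fastforce+
      then show "dist (\<rho> s) (\<rho> t) = \<bar>s - t\<bar>" using \<eta>(3)[of "s - T" "t - T"] by (simp add: \<rho>2)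
    qed
    then show ?thesis by (rule qi_embedding_on_mono) (use l e in auto)
  qed
  moreover have "dist (\<rho> z) (\<rho> T) \<le> dist (\<rho> x) (\<rho> z) + 1"
    if "x \<in> ?J" "x \<le> T" "z \<in> ?J" "T \<le> z" for x z
  proof -
    have z: "z \<le> T + L" using that T L0 by fastforce
    have x: "x \<in> I" using that T by auto
    have "dist (\<rho> z) (\<rho> T) = z - T" using \<eta>(3)[of "z - T" 0] z that(4) L0 by (simp add: \<rho>2)
    moreover have "dist (\<rho> z) y = L - (z - T)"
      using \<eta>(3)[of "z - T" L] \<eta>(2) z that(4) L0 by (simp add: \<rho>2)
    moreover have "L \<le> dist y (\<rho> x) + 1" using near[OF x] \<rho>1[OF x] by (simp add: L_def)
    moreover have "dist y (\<rho> x) \<le> dist (\<rho> x) (\<rho> z) + dist (\<rho> z) y"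
      by (metis dist_commute dist_triangle)
    ultimately show ?thesis by linarith
  qed
  ultimately have "qi_embedding_on ?J (3 * l) (2 * e + 1) \<rho>"
    using T(1) by (intro qi_embedding_concat[where T = T]) auto
  moreover have "\<rho> (T + L) = y" using \<rho>2[of "T + L"] L0 \<eta>(2) by simp
  ultimately show ?thesis using \<rho>1 by blast
qed

section \<open>Rays asymptotic to Morse rays\<close>

definition fellow_travel :: "(real \<Rightarrow> 'a::metric_space) \<Rightarrow> (real \<Rightarrow> 'a) \<Rightarrow> bool" where
  "fellow_travel \<alpha> \<beta> \<longleftrightarrow> (\<exists>C. \<forall>t\<ge>0. dist (\<alpha> t) (\<beta> t) \<le> C)"

lemma fellow_travel_sym: "fellow_travel \<alpha> \<beta> \<Longrightarrow> fellow_travel \<beta> \<alpha>"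
  by (simp add: fellow_travel_def dist_commute)

lemma fellow_travel_trans: "fellow_travel \<alpha> \<beta> \<Longrightarrow> fellow_travel \<beta> \<gamma> \<Longrightarrow> fellow_travel \<alpha> \<gamma>"
  unfolding fellow_travel_def by (meson add_mono dist_triangle order_trans)

lemma fellow_travel_shift:
  assumes "fellow_travel \<alpha> \<beta>" "\<And>t. 0 \<le> t \<Longrightarrow> dist (\<alpha>' t) (\<alpha> t) \<le> c"
  shows "fellow_travel \<alpha>' \<beta>"
  using assms fellow_travel_trans[of \<alpha>' \<alpha> \<beta>] by (auto simp: fellow_travel_def)

text \<open>One-sided closeness suffices: \<open>t\<close> and \<open>s\<close> are the distances to
  the two starting points, so they differ by at most
  \<open>C + dist (\<alpha> 0) (\<beta> 0)\<close>. For geodesic rays, finite Hausdorff distance is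
  thus a pointwise bound.\<close>

lemma fellow_travel_if_near:
  assumes g: "geodesic {0..} \<alpha>" "geodesic {0..} \<beta>"
    and near: "\<And>t. 0 \<le> t \<Longrightarrow> \<exists>s\<ge>0. dist (\<alpha> t) (\<beta> s) \<le> C"
  shows "fellow_travel \<alpha> \<beta>"
  unfolding fellow_travel_def
proof (intro exI allI impI)
  fix t :: real assume t: "0 \<le> t"
  obtain s where s: "0 \<le> s" "dist (\<alpha> t) (\<beta> s) \<le> C" using near[OF t] by blast
  have "dist (\<alpha> t) (\<alpha> 0) = t" "dist (\<beta> s) (\<beta> 0) = s" "dist (\<beta> s) (\<beta> t) = \<bar>s - t\<bar>"
    using g s t by (auto simp: geodesic_def)
  moreover have "dist (\<alpha> t) (\<alpha> 0) \<le> dist (\<alpha> t) (\<beta> s) + dist (\<beta> s) (\<beta> 0) + dist (\<alpha> 0) (\<beta> 0)"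
    "dist (\<beta> s) (\<beta> 0) \<le> dist (\<alpha> t) (\<beta> s) + dist (\<alpha> t) (\<alpha> 0) + dist (\<alpha> 0) (\<beta> 0)"
    "dist (\<alpha> t) (\<beta> t) \<le> dist (\<alpha> t) (\<beta> s) + dist (\<beta> s) (\<beta> t)"
    by (smt (verit) dist_triangle dist_commute)+
  ultimately show "dist (\<alpha> t) (\<beta> t) \<le> 2 * C + dist (\<alpha> 0) (\<beta> 0)" using s by linarith
qed

lemma finite_hausdorff_rays:
  assumes g: "geodesic {0..} \<alpha>" "geodesic {0..} \<beta>"
  shows "finite_hausdorff (\<alpha> ` {0..}) (\<beta> ` {0..}) \<longleftrightarrow> fellow_travel \<alpha> \<beta>"
proof
  assume "finite_hausdorff (\<alpha> ` {0..}) (\<beta> ` {0..})"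
  then obtain C where "\<alpha> ` {0..} \<subseteq> nbhd C (\<beta> ` {0..})" by (auto simp: finite_hausdorff_def)
  then have "\<exists>s\<ge>0. dist (\<alpha> t) (\<beta> s) \<le> C" if "0 \<le> t" for t
    using that by (fastforce simp: nbhd_def dist_commute)
  then show "fellow_travel \<alpha> \<beta>" by (rule fellow_travel_if_near[OF g])
next
  assume "fellow_travel \<alpha> \<beta>"
  then obtain C where "\<And>t. 0 \<le> t \<Longrightarrow> dist (\<alpha> t) (\<beta> t) \<le> C" by (auto simp: fellow_travel_def)
  then show "finite_hausdorff (\<alpha> ` {0..}) (\<beta> ` {0..})"
    unfolding finite_hausdorff_def nbhd_def by (intro exI[of _ C]) (force simp: dist_commute)
qed

text \<open>A far point of the Morse ray is joined to an approximate nearest point of the quasi-ray; the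
  resulting quasi-geodesic has uniform constants and contains any given initial part of the
  quasi-ray. The (non-uniform) constant \<open>C\<close> disappears from the conclusion.\<close>

lemma quasi_ray_near_morse_ray:
  fixes q :: "real \<Rightarrow> 'a::metric_space"
  assumes PG: "proper_geodesic TYPE('a)" and m: "seg_morse M {0..} \<beta>" and M: "M \<in> morse_gauges"
    and q: "qi_embedding_on {0..} l e q" and D: "dist (q 0) (\<beta> 0) \<le> D"
    and C: "\<And>s. 0 \<le> s \<Longrightarrow> \<exists>\<tau>\<ge>0. dist (q \<tau>) (\<beta> s) \<le> C" and t: "0 \<le> t"
  shows "\<exists>s\<ge>0. dist (q t) (\<beta> s) \<le> M (3 * l, 2 * e + 1 + 2 * D) + D"
proof -
  have l: "1 \<le> l" and e: "0 \<le> e" using q by (auto simp: qi_embedding_on_def)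
  have D0: "0 \<le> D" using D by (meson dist_not_less_zero le_less_trans not_le)
  have C0: "0 \<le> C" using C[of 0] by (meson dist_not_less_zero le_less_trans not_le order_refl)
  \<comment> \<open>So large that the cut point \<open>T\<close> comes after \<open>t\<close>: the
    distance \<open>s\<close> from \<open>\<beta> 0\<close> to \<open>\<beta> s\<close> is at most
    \<open>(C + 1) + (l * T + e) + D\<close>.\<close>
  define s where "s = D + l * t + e + C + 2"
  have s0: "0 \<le> s" using D0 C0 e l t by (simp add: s_def)
  obtain T where T: "0 \<le> T" "\<And>x. 0 \<le> x \<Longrightarrow> dist (\<beta> s) (q T) \<le> dist (\<beta> s) (q x) + 1"
    using approx_nearest[of "{0..}" "\<beta> s" q] by auto
  have "dist (\<beta> s) (q T) \<le> C + 1"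
    using C[OF s0] T(2) by (metis add_right_mono dist_commute order_trans)
  moreover have "dist (\<beta> s) (\<beta> 0) = s" using seg_morse_geodesic[OF m] s0 by (simp add: geodesic_def)
  moreover have "dist (q 0) (q T) \<le> l * T + e"
  proof -
    have "0 \<in> {0::real..}" "T \<in> {0..}" using T(1) by auto
    then have "dist (q 0) (q T) \<le> l * dist 0 T + e" using q unfolding qi_embedding_on_def by blast
    then show ?thesis using T(1) by (simp add: dist_real_def)
  qed
  moreover have "dist (\<beta> s) (\<beta> 0) \<le> dist (\<beta> s) (q T) + dist (q 0) (q T) + dist (q 0) (\<beta> 0)"
    by (smt (verit) dist_triangle dist_commute)
  ultimately have "l * t \<le> l * T" using D by (simp add: s_def)
  then have tT: "t \<le> T" using l by simp
  define L where "L = dist (\<beta> s) (q T)"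
  have L0: "0 \<le> L" by (simp add: L_def)
  have "qi_embedding_on {0..T} l e q" using q by (rule qi_embedding_on_subset) auto
  then have "\<exists>\<rho>. (\<forall>x\<in>{0..T}. \<rho> x = q x) \<and> \<rho> (T + L) = \<beta> s \<and>
      qi_embedding_on ({0..T} \<union> {T..T + L}) (3 * l) (2 * e + 1) \<rho>"
    using T L_def by (intro qi_embedding_append_geodesic[OF PG]) auto
  then obtain \<rho> where \<rho>: "\<And>x. x \<in> {0..T} \<Longrightarrow> \<rho> x = q x" "\<rho> (T + L) = \<beta> s"
      "qi_embedding_on ({0..T} \<union> {T..T + L}) (3 * l) (2 * e + 1) \<rho>"
    by blast
  have "{0..T + L} = {0..T} \<union> {T..T + L}" using T L0 by auto
  with \<rho>(3) have "qi_embedding_on {0..T + L} (3 * l) (2 * e + 1) \<rho>" by simp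
  moreover have "dist (\<rho> 0) (\<beta> 0) \<le> D" "dist (\<rho> (T + L)) (\<beta> s) \<le> D"
    using \<rho> T D D0 by auto
  ultimately obtain w where "w \<in> {0..s}" "dist (\<rho> t) (\<beta> w) \<le> M (3 * l, 2 * e + 1 + 2 * D) + D"
    using seg_morse_near_ends[OF m M, of 0 s 0 "T + L" "3 * l" "2 * e + 1" \<rho> D t]
      s0 T t tT L0 by auto
  then show ?thesis using \<rho>(1)[of t] t tT by auto
qed

lemma ray_near_morse_ray:
  fixes \<alpha> :: "real \<Rightarrow> 'a::metric_space"
  assumes PG: "proper_geodesic TYPE('a)" and m: "seg_morse M {0..} \<beta>" and M: "M \<in> morse_gauges"
    and g: "geodesic {0..} \<alpha>" and f: "fellow_travel \<alpha> \<beta>" and D: "dist (\<alpha> 0) (\<beta> 0) \<le> D"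
    and t: "0 \<le> t"
  shows "\<exists>s\<ge>0. dist (\<alpha> t) (\<beta> s) \<le> M (3, 1 + 2 * D) + D"
proof -
  obtain C where "\<And>t. 0 \<le> t \<Longrightarrow> dist (\<alpha> t) (\<beta> t) \<le> C" using f by (auto simp: fellow_travel_def)
  then have "\<exists>\<tau>\<ge>0. dist (\<alpha> \<tau>) (\<beta> s) \<le> C" if "0 \<le> s" for s using that by blast
  moreover have "qi_embedding_on {0..} 1 0 \<alpha>"
    using g by (intro qi_embedding_geodesic) (simp add: geodesic_def)
  ultimately show ?thesis
    using quasi_ray_near_morse_ray[OF PG m M, of 1 0 \<alpha> D C t] D t by simp
qed

text \<open>The bound does not involve the distance from \<open>x\<close> to \<gamma>. A geodesic
  from \<open>x\<close> to its approximate nearest point \<open>\<gamma> 0\<close> turns \<gamma>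
  into a quasi-ray with constants 3 and 1 that starts near \<open>\<alpha> 0\<close>; the surgery in
  \<open>quasi_ray_near_morse_ray\<close> raises these to 9 and 3. What remains is to match the
  parameters.\<close>

lemma ray_follows_morse_ray:
  fixes \<gamma> :: "real \<Rightarrow> 'a::metric_space"
  assumes PG: "proper_geodesic TYPE('a)" and m: "seg_morse M {0..} \<alpha>" and M: "M \<in> morse_gauges"
    and g: "geodesic {0..} \<gamma>" and f: "fellow_travel \<gamma> \<alpha>" and D: "dist x (\<alpha> 0) \<le> D"
    and near: "\<And>t. 0 \<le> t \<Longrightarrow> dist x (\<gamma> 0) \<le> dist x (\<gamma> t) + 1"
  shows "\<exists>c\<ge>0. \<forall>t\<ge>0. dist (\<gamma> t) (\<alpha> (c + t)) \<le> 5 * (M (9, 3 + 2 * D) + D)"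
proof -
  define E where "E = M (9, 3 + 2 * D) + D"
  define L where "L = dist x (\<gamma> 0)"
  have g': "dist (\<gamma> s) (\<gamma> t) = \<bar>s - t\<bar>" if "0 \<le> s" "0 \<le> t" for s t
    using g that by (simp add: geodesic_def)
  have a': "dist (\<alpha> s) (\<alpha> t) = \<bar>s - t\<bar>" if "0 \<le> s" "0 \<le> t" for s t
    using seg_morse_geodesic[OF m] that by (simp add: geodesic_def)
  obtain C where C: "\<And>t. 0 \<le> t \<Longrightarrow> dist (\<gamma> t) (\<alpha> t) \<le> C" using f by (auto simp: fellow_travel_def)
  have L0: "0 \<le> L" by (simp add: L_def)
  \<comment> \<open>A geodesic can be appended only at the upper end of a domain, so \<gamma> is run
    backwards and the result is reversed again.\<close>
  have "qi_embedding_on {..0} 1 0 (\<lambda>t. \<gamma> (- t))" by (rule qi_embedding_geodesic) (auto simp: g')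
  then have "\<exists>\<rho>. (\<forall>t\<in>{..0}. \<rho> t = \<gamma> (- t)) \<and> \<rho> (0 + L) = x \<and>
      qi_embedding_on ({..0} \<union> {0..0 + L}) (3 * 1) (2 * 0 + 1) \<rho>"
    using near L_def by (intro qi_embedding_append_geodesic[OF PG]) auto
  then obtain \<rho> where \<rho>: "\<And>t. t \<le> 0 \<Longrightarrow> \<rho> t = \<gamma> (- t)" "\<rho> L = x"
      "qi_embedding_on ({..0} \<union> {0..L}) 3 1 \<rho>"
    by auto
  have q: "qi_embedding_on {0..} 3 1 (\<lambda>t. \<rho> (L - t))"
    using \<rho>(3) by (rule qi_embedding_on_reparam) (auto simp: dist_real_def)
  have q\<gamma>: "\<rho> (L - (L + t)) = \<gamma> t" if "0 \<le> t" for t using \<rho>(1)[of "- t"] that by simp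
  have cover: "\<exists>\<tau>\<ge>0. dist (\<rho> (L - \<tau>)) (\<alpha> s) \<le> C" if "0 \<le> s" for s
    using C[OF that] q\<gamma>[OF that] that L0 by (intro exI[of _ "L + s"]) simp
  have "\<exists>s\<ge>0. dist (\<gamma> t) (\<alpha> s) \<le> E" if "0 \<le> t" for t
    using quasi_ray_near_morse_ray[OF PG m M q _ cover, of D "L + t"] D \<rho>(2) q\<gamma>[OF that] that L0
    by (auto simp: E_def)
  then obtain \<sigma> where \<sigma>: "\<And>t. 0 \<le> t \<Longrightarrow> 0 \<le> \<sigma> t" "\<And>t. 0 \<le> t \<Longrightarrow> dist (\<gamma> t) (\<alpha> (\<sigma> t)) \<le> E"
    by metis
  have "dist (\<gamma> t) (\<alpha> (\<sigma> 0 + t)) \<le> 5 * E" if t: "0 \<le> t" for t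
  proof -
    have C0: "0 \<le> C" using C[of 0] by (meson dist_not_less_zero le_less_trans not_le order_refl)
    have E0: "0 \<le> E" using \<sigma>(2)[of 0] by (meson dist_not_less_zero le_less_trans not_le order_refl)
    \<comment> \<open>A far reference point, with \<open>\<sigma> T\<close> beyond both
      \<open>\<sigma> 0\<close> and \<open>\<sigma> t\<close>. Measuring 0 and \<open>t\<close>
      against it fixes the direction of travel: it excludes that \<open>\<sigma> t\<close> lies near
      \<open>\<sigma> 0 - t\<close>. Two comparisons with error \<open>2 * E\<close> each, and one
      more \<open>E\<close>, make up \<open>5 * E\<close>.\<close>
    define T where "T = \<sigma> 0 + \<sigma> t + C + E + t"
    have T: "0 \<le> T" using \<sigma>(1)[of 0] \<sigma>(1)[OF t] C0 E0 t by (simp add: T_def)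
    have "\<bar>\<sigma> T - T\<bar> \<le> C + E"
      using C[OF T] \<sigma>(2)[OF T] a'[OF \<sigma>(1)[OF T] T] dist_triangle[of "\<alpha> (\<sigma> T)" "\<alpha> T" "\<gamma> T"]
      by (simp add: dist_commute)
    then have big: "\<sigma> 0 \<le> \<sigma> T" "\<sigma> t \<le> \<sigma> T"
      using \<sigma>(1)[of 0] \<sigma>(1)[OF t] t by (auto simp: T_def)
    have *: "\<bar>(T - u) - (\<sigma> T - \<sigma> u)\<bar> \<le> 2 * E" if u: "0 \<le> u" "u \<le> T" "\<sigma> u \<le> \<sigma> T" for u
    proof -
      have "dist (\<gamma> T) (\<gamma> u) = T - u" "dist (\<alpha> (\<sigma> T)) (\<alpha> (\<sigma> u)) = \<sigma> T - \<sigma> u"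
        using g'[OF T u(1)] a'[OF \<sigma>(1)[OF T] \<sigma>(1)[OF u(1)]] u by auto
      moreover have "dist (\<gamma> T) (\<gamma> u) \<le> dist (\<gamma> T) (\<alpha> (\<sigma> T)) + dist (\<alpha> (\<sigma> T)) (\<alpha> (\<sigma> u)) + dist (\<gamma> u) (\<alpha> (\<sigma> u))"
        "dist (\<alpha> (\<sigma> T)) (\<alpha> (\<sigma> u)) \<le> dist (\<gamma> T) (\<alpha> (\<sigma> T)) + dist (\<gamma> T) (\<gamma> u) + dist (\<gamma> u) (\<alpha> (\<sigma> u))"
        by (smt (verit) dist_triangle dist_commute)+
      ultimately show ?thesis using \<sigma>(2)[OF T] \<sigma>(2)[OF u(1)] by linarith
    qed
    have "t \<le> T" using C0 E0 \<sigma>(1)[of 0] \<sigma>(1)[OF t] by (simp add: T_def)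
    then have "\<bar>\<sigma> t - (\<sigma> 0 + t)\<bar> \<le> 4 * E"
      using *[of 0] *[of t] t T big by linarith
    moreover have "dist (\<alpha> (\<sigma> t)) (\<alpha> (\<sigma> 0 + t)) = \<bar>\<sigma> t - (\<sigma> 0 + t)\<bar>"
      using a' \<sigma>(1)[of 0] \<sigma>(1)[OF t] t by simp
    ultimately show ?thesis
      using \<sigma>(2)[OF t] dist_triangle[of "\<gamma> t" "\<alpha> (\<sigma> 0 + t)" "\<alpha> (\<sigma> t)"] by linarith
  qed
  then show ?thesis using \<sigma>(1)[of 0] unfolding E_def by (intro exI[of _ "\<sigma> 0"]) auto
qed

lemma seg_morse_close:
  assumes m: "seg_morse M I \<alpha>" and M: "M \<in> morse_gauges" and g: "geodesic I \<gamma>"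
    and D: "\<And>t. t \<in> I \<Longrightarrow> dist (\<gamma> t) (\<alpha> t) \<le> D"
  shows "seg_morse (\<lambda>(l, e). M (l, e + 2 * D) + 2 * D) I \<gamma>"
  unfolding seg_morse_def
proof (intro conjI g ballI allI impI)
  fix u v l e and s t :: real and \<sigma> \<tau>
  assume uv: "u \<in> I" "v \<in> I" "u \<le> v" and st: "s \<le> t" and q: "qi_embedding_on {s..t} l e \<sigma>"
      and ends: "\<sigma> s = \<gamma> u" "\<sigma> t = \<gamma> v" and \<tau>: "\<tau> \<in> {s..t}"
  have "dist (\<sigma> s) (\<alpha> u) \<le> D" "dist (\<sigma> t) (\<alpha> v) \<le> D" using ends D uv by auto
  then obtain w where w: "w \<in> {u..v}" "dist (\<sigma> \<tau>) (\<alpha> w) \<le> M (l, e + 2 * D) + D"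
    using seg_morse_near_ends[OF m M uv st q _ _ \<tau>] by blast
  have "closed_interval I" using g by (simp add: geodesic_def)
  then have "w \<in> I" using closed_interval_Icc_subset uv w(1) by blast
  then have "dist (\<sigma> \<tau>) (\<gamma> w) \<le> M (l, e + 2 * D) + 2 * D"
    using w(2) D[of w] dist_triangle2[of "\<sigma> \<tau>" "\<gamma> w" "\<alpha> w"] by linarith
  then show "\<exists>w\<in>{u..v}. dist (\<sigma> \<tau>) (\<gamma> w) \<le> (case (l, e) of (l, e) \<Rightarrow> M (l, e + 2 * D) + 2 * D)"
    using w(1) by auto
qed

text \<open>A quasi-geodesic whose endpoints lie on different sides of \<open>\<gamma> c\<close> is cut at an approximate
  nearest point to \<open>\<gamma> c\<close>, and each piece is closed up by a geodesic to \<open>\<gamma> c\<close>.\<close>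

lemma seg_morse_join:
  fixes \<gamma> :: "real \<Rightarrow> 'a::metric_space"
  assumes PG: "proper_geodesic TYPE('a)" and g: "geodesic UNIV \<gamma>" and M: "M \<in> morse_gauges"
    and m1: "seg_morse M {..c} \<gamma>" and m2: "seg_morse M {c..} \<gamma>"
  shows "seg_morse (\<lambda>(l, e). M (l, e) + M (3 * l, 2 * e + 1)) UNIV \<gamma>"
  unfolding seg_morse_def
proof (intro conjI g ballI allI impI)
  fix u v l e and s t :: real and \<sigma> \<tau>
  assume uv: "u \<le> v" and st: "s \<le> t" and q: "qi_embedding_on {s..t} l e \<sigma>"
      and ends: "\<sigma> s = \<gamma> u" "\<sigma> t = \<gamma> v" and \<tau>: "\<tau> \<in> {s..t}"
  have l: "1 \<le> l" and e: "0 \<le> e" using q by (auto simp: qi_embedding_on_def)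
  have pos: "0 \<le> M (l, e)" "0 \<le> M (3 * l, 2 * e + 1)"
    using l e by (auto intro!: morse_gauge_nonneg[OF M])
  consider "v \<le> c" | "c \<le> u" | "u \<le> c" "c \<le> v" by linarith
  then have "\<exists>w\<in>{u..v}. dist (\<sigma> \<tau>) (\<gamma> w) \<le> M (l, e) \<or> dist (\<sigma> \<tau>) (\<gamma> w) \<le> M (3 * l, 2 * e + 1)"
  proof cases
    case 1
    then show ?thesis using seg_morseD[OF m1 _ _ uv st q ends \<tau>] uv by auto
  next
    case 2
    then show ?thesis using seg_morseD[OF m2 _ _ uv st q ends \<tau>] uv by auto
  next
    case 3
    obtain T where T: "T \<in> {s..t}" "\<And>x. x \<in> {s..t} \<Longrightarrow> dist (\<gamma> c) (\<sigma> T) \<le> dist (\<gamma> c) (\<sigma> x) + 1"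
      using approx_nearest[of "{s..t}" "\<gamma> c" \<sigma>] st by auto
    define L where "L = dist (\<gamma> c) (\<sigma> T)"
    have L0: "0 \<le> L" by (simp add: L_def)
    show ?thesis
    proof (cases "\<tau> \<le> T")
      case True
      have "qi_embedding_on {s..T} l e \<sigma>" using q T(1) by (auto intro: qi_embedding_on_subset)
      then have "\<exists>\<rho>. (\<forall>x\<in>{s..T}. \<rho> x = \<sigma> x) \<and> \<rho> (T + L) = \<gamma> c \<and>
          qi_embedding_on ({s..T} \<union> {T..T + L}) (3 * l) (2 * e + 1) \<rho>"
        using T L_def by (intro qi_embedding_append_geodesic[OF PG]) auto
      then obtain \<rho> where \<rho>: "\<And>x. x \<in> {s..T} \<Longrightarrow> \<rho> x = \<sigma> x" "\<rho> (T + L) = \<gamma> c"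
          "qi_embedding_on ({s..T} \<union> {T..T + L}) (3 * l) (2 * e + 1) \<rho>"
        by blast
      have "{s..T} \<union> {T..T + L} = {s..T + L}" using T(1) L0 by auto
      then show ?thesis
        using seg_morseD[OF m1, of u c s "T + L" "3 * l" "2 * e + 1" \<rho> \<tau>] \<rho> T(1) L0 3 ends True \<tau>
        by fastforce
    next
      case False
      \<comment> \<open>The later piece is run backwards, so that the geodesic to
        \<open>\<gamma> c\<close> is again appended at its upper end.\<close>
      have "qi_embedding_on {- t..- T} l e (\<lambda>x. \<sigma> (- x))"
        using q by (rule qi_embedding_on_reparam) (use T(1) in \<open>auto simp: dist_real_def\<close>)
      then have "\<exists>\<rho>. (\<forall>x\<in>{- t..- T}. \<rho> x = \<sigma> (- x)) \<and> \<rho> (- T + L) = \<gamma> c \<and>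
          qi_embedding_on ({- t..- T} \<union> {- T..- T + L}) (3 * l) (2 * e + 1) \<rho>"
        using T L_def by (intro qi_embedding_append_geodesic[OF PG]) auto
      then obtain \<rho> where \<rho>: "\<And>x. x \<in> {- t..- T} \<Longrightarrow> \<rho> x = \<sigma> (- x)" "\<rho> (- T + L) = \<gamma> c"
          "qi_embedding_on ({- t..- T} \<union> {- T..- T + L}) (3 * l) (2 * e + 1) \<rho>"
        by blast
      have "{- t..- T} \<union> {- T..- T + L} = {- t..- T + L}" using T(1) L0 by auto
      then show ?thesis
        using seg_morseD_rev[OF m2, of c v "- t" "- T + L" "3 * l" "2 * e + 1" \<rho> "- \<tau>"] \<rho> T(1) L0 3 ends False \<tau>
        by fastforce
    qed
  qed
  then obtain w where "w \<in> {u..v}" "dist (\<sigma> \<tau>) (\<gamma> w) \<le> M (l, e) + M (3 * l, 2 * e + 1)"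
    using pos by force
  then show "\<exists>w\<in>{u..v}. dist (\<sigma> \<tau>) (\<gamma> w) \<le> (case (l, e) of (l, e) \<Rightarrow> M (l, e) + M (3 * l, 2 * e + 1))"
    by auto
qed

section \<open>Lines asymptotic to Morse rays at both ends\<close>

text \<open>Cut at an approximate nearest point to one fixed \<open>x\<close>, both halves of the
  line satisfy the hypotheses of \<open>ray_follows_morse_ray\<close>, whose bound is insensitive to
  the distance between \<open>x\<close> and the line.\<close>

lemma line_follows_morse_rays:
  fixes \<gamma> :: "real \<Rightarrow> 'a::metric_space"
  assumes PG: "proper_geodesic TYPE('a)" and M: "M \<in> morse_gauges"
    and m1: "seg_morse M {0..} \<alpha>" and m2: "seg_morse M {0..} \<beta>"
    and D: "dist (\<alpha> 0) (\<beta> 0) \<le> D" and g: "geodesic UNIV \<gamma>"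
    and f1: "fellow_travel (\<lambda>t. \<gamma> (- t)) \<alpha>" and f2: "fellow_travel \<gamma> \<beta>"
  shows "\<exists>c. \<exists>a\<ge>0. \<exists>b\<ge>0. \<forall>t\<ge>0.
     dist (\<gamma> (c - t)) (\<alpha> (a + t)) \<le> 5 * (M (9, 3 + 2 * D) + D) \<and>
     dist (\<gamma> (c + t)) (\<beta> (b + t)) \<le> 5 * (M (9, 3 + 2 * D) + D)"
proof -
  have g': "dist (\<gamma> s) (\<gamma> t) = \<bar>s - t\<bar>" for s t using g by (simp add: geodesic_def)
  have D0: "0 \<le> D" using D by (meson dist_not_less_zero le_less_trans not_le)
  \<comment> \<open>The point \<open>\<alpha> 0\<close> itself will do.\<close>
  obtain x where x1: "dist x (\<alpha> 0) \<le> D" and x2: "dist x (\<beta> 0) \<le> D" using D D0 by (metis dist_self)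
  obtain c where c: "\<And>t. dist x (\<gamma> c) \<le> dist x (\<gamma> t) + 1"
    using approx_nearest[of UNIV x \<gamma>] by auto
  have g1: "geodesic {0..} (\<lambda>t. \<gamma> (c - t))" and g2: "geodesic {0..} (\<lambda>t. \<gamma> (c + t))"
    using g' by (auto simp: geodesic_def closed_interval_Ici)
  have "fellow_travel (\<lambda>t. \<gamma> (c - t)) \<alpha>"
    using f1 by (rule fellow_travel_shift[where c = "\<bar>c\<bar>"]) (simp add: g')
  from ray_follows_morse_ray[OF PG m1 M g1 this x1] c
  obtain a where "a \<ge> 0" "\<And>t. 0 \<le> t \<Longrightarrow> dist (\<gamma> (c - t)) (\<alpha> (a + t)) \<le> 5 * (M (9, 3 + 2 * D) + D)"
    by auto
  moreover have "fellow_travel (\<lambda>t. \<gamma> (c + t)) \<beta>"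
    using f2 by (rule fellow_travel_shift[where c = "\<bar>c\<bar>"]) (simp add: g')
  from ray_follows_morse_ray[OF PG m2 M g2 this x2] c
  obtain b where "b \<ge> 0" "\<And>t. 0 \<le> t \<Longrightarrow> dist (\<gamma> (c + t)) (\<beta> (b + t)) \<le> 5 * (M (9, 3 + 2 * D) + D)"
    by auto
  ultimately show ?thesis by blast
qed

text \<open>The order of quantifiers is the point: \<open>M'\<close> depends on \<open>M\<close> and
  \<open>D\<close> only. The halves of the line run along tails of the two Morse rays and so acquire
  the gauge \<open>F\<close>; gluing them gives \<open>G\<close>.\<close>

lemma line_between_morse_rays:
  assumes PG: "proper_geodesic TYPE('a::metric_space)" and M: "M \<in> morse_gauges" and D0: "0 \<le> D"
  shows "\<exists>M'\<in>morse_gauges. \<forall>\<alpha> \<beta> (\<gamma>::real \<Rightarrow> 'a). seg_morse M {0..} \<alpha> \<longrightarrow> seg_morse M {0..} \<beta> \<longrightarrow>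
    dist (\<alpha> 0) (\<beta> 0) \<le> D \<longrightarrow> geodesic UNIV \<gamma> \<longrightarrow> fellow_travel (\<lambda>t. \<gamma> (- t)) \<alpha> \<longrightarrow>
    fellow_travel \<gamma> \<beta> \<longrightarrow> seg_morse M' UNIV \<gamma>"
proof -
  define E where "E = 5 * (M (9, 3 + 2 * D) + D)"
  have E0: "0 \<le> E" using D0 morse_gauge_nonneg[OF M, of 9 "3 + 2 * D"] by (simp add: E_def)
  define F where "F = restrict (\<lambda>(l, e). M (l, e + 2 * E) + 2 * E) ({1..} \<times> {0..})"
  have F: "F \<in> morse_gauges"
    unfolding F_def using E0 by (intro restrict_morse_gauge) (auto intro!: add_nonneg_nonneg morse_gauge_nonneg[OF M])
  define G where "G = restrict (\<lambda>(l, e). F (l, e) + F (3 * l, 2 * e + 1)) ({1..} \<times> {0..})"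
  have "G \<in> morse_gauges"
    unfolding G_def by (intro restrict_morse_gauge) (auto intro!: add_nonneg_nonneg morse_gauge_nonneg[OF F])
  moreover have "seg_morse G UNIV \<gamma>"
    if m: "seg_morse M {0..} \<alpha>" "seg_morse M {0..} \<beta>" and d: "dist (\<alpha> 0) (\<beta> 0) \<le> D"
      and g: "geodesic UNIV \<gamma>" and f: "fellow_travel (\<lambda>t. \<gamma> (- t)) \<alpha>" "fellow_travel \<gamma> \<beta>"
    for \<alpha> \<beta> and \<gamma> :: "real \<Rightarrow> 'a"
  proof -
    obtain c a b where ab: "0 \<le> a" "0 \<le> b"
      and near: "\<And>t. 0 \<le> t \<Longrightarrow> dist (\<gamma> (c - t)) (\<alpha> (a + t)) \<le> E"
        "\<And>t. 0 \<le> t \<Longrightarrow> dist (\<gamma> (c + t)) (\<beta> (b + t)) \<le> E"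
      using line_follows_morse_rays[OF PG M m d g f] unfolding E_def by blast
    have g': "dist (\<gamma> s) (\<gamma> t) = \<bar>s - t\<bar>" for s t using g by (simp add: geodesic_def)
    have g12: "geodesic {0..} (\<lambda>t. \<gamma> (c - t))" "geodesic {0..} (\<lambda>t. \<gamma> (c + t))"
      using g' by (auto simp: geodesic_def closed_interval_Ici)
    have "seg_morse M {0..} (\<lambda>t. \<alpha> (a + t))" "seg_morse M {0..} (\<lambda>t. \<beta> (b + t))"
      using ab by (auto intro!: seg_morse_shift[OF m(1)] seg_morse_shift[OF m(2)] closed_interval_Ici)
    from seg_morse_close[OF this(1) M g12(1), of E] seg_morse_close[OF this(2) M g12(2), of E]
    have "seg_morse F {0..} (\<lambda>t. \<gamma> (c - t))" "seg_morse F {0..} (\<lambda>t. \<gamma> (c + t))"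
      unfolding F_def using near by (auto intro!: seg_morse_restrict)
    then have "seg_morse F {..c} \<gamma>" "seg_morse F {c..} \<gamma>"
      using seg_morse_reflect[of F "{0..}" "\<lambda>t. \<gamma> (c - t)" "{..c}" c]
        seg_morse_shift[of F "{0..}" "\<lambda>t. \<gamma> (c + t)" "{c..}" "- c"]
      by (auto simp: closed_interval_Ici closed_interval_def is_interval_ic)
    then show ?thesis unfolding G_def by (intro seg_morse_restrict seg_morse_join[OF PG g F])
  qed
  ultimately show ?thesis by blast
qed

section \<open>Lines between points of the Morse boundary\<close>

text \<open>A class contains only rays from the base point, whereas halves of lines start anywhere;
  hence closeness to a member instead of membership.\<close>

definition ray_to :: "'a::metric_space bpoint \<Rightarrow> (real \<Rightarrow> 'a) \<Rightarrow> bool" where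
  "ray_to b \<gamma> \<longleftrightarrow> (\<exists>\<beta>\<in>b. fellow_travel \<gamma> \<beta>)"

lemma asymptotic_iff:
  "(\<alpha>, \<beta>) \<in> asymptotic p \<longleftrightarrow> \<alpha> \<in> rays p \<and> \<beta> \<in> rays p \<and> fellow_travel \<alpha> \<beta>"
  using finite_hausdorff_rays by (auto simp: asymptotic_def rays_def)

lemma equiv_asymptotic: "equiv (rays p) (asymptotic p)"
proof (rule equivI)
  show "refl_on (rays p) (asymptotic p)"
    by (auto simp: refl_on_def asymptotic_iff fellow_travel_def intro: exI[of _ 0])
  show "sym (asymptotic p)" by (auto simp: sym_def asymptotic_iff fellow_travel_sym)
  show "trans (asymptotic p)" by (auto simp: trans_def asymptotic_iff intro: fellow_travel_trans)
  show "asymptotic p \<subseteq> rays p \<times> rays p" by (auto simp: asymptotic_iff)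
qed

lemma morse_boundary_visual: "b \<in> morse_boundary p \<Longrightarrow> b \<in> visual_boundary p"
  by (auto simp: morse_boundary_def boundary_stratum_def)

lemma bpoint_ray:
  assumes "b \<in> visual_boundary p" "\<beta> \<in> b"
  shows "geodesic {0..} \<beta>" "\<beta> 0 = p"
  using in_quotient_imp_subset[OF equiv_asymptotic] assms unfolding visual_boundary_def rays_def
  by blast+

lemma bpoint_eq_iff:
  assumes "a \<in> visual_boundary p" "b \<in> visual_boundary p" "\<alpha> \<in> a" "\<beta> \<in> b"
  shows "a = b \<longleftrightarrow> fellow_travel \<alpha> \<beta>"
  using quotient_eq_iff[OF equiv_asymptotic assms(1,2)[unfolded visual_boundary_def] assms(3,4)]
    bpoint_ray[OF assms(1,3)] bpoint_ray[OF assms(2,4)] by (simp add: asymptotic_iff rays_def)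

lemma ray_to_fellow_travel:
  assumes "b \<in> visual_boundary p" "ray_to b \<gamma>" "ray_to b \<delta>"
  shows "fellow_travel \<gamma> \<delta>"
  using assms bpoint_eq_iff[OF assms(1,1)] unfolding ray_to_def
  by (meson fellow_travel_sym fellow_travel_trans)

lemma morse_boundary_ray:
  assumes "b \<in> morse_boundary p"
  obtains M \<beta> where "M \<in> morse_gauges" "seg_morse M {0..} \<beta>" "\<beta> \<in> b"
  using assms by (auto simp: morse_boundary_def boundary_stratum_def morse_geodesic_iff_seg_morse)

lemma geodesic_UNIV_iff: "geodesic UNIV \<gamma> \<longleftrightarrow> (\<forall>s t. dist (\<gamma> s) (\<gamma> t) = \<bar>s - t\<bar>)"
  by (simp add: geodesic_def closed_interval_UNIV)

lemma geodesic_UNIV_rays: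
  assumes "geodesic UNIV \<gamma>"
  shows "geodesic {0..} (\<lambda>t. \<gamma> (c + t))" "geodesic {0..} (\<lambda>t. \<gamma> (c - t))"
  using assms by (auto simp: geodesic_UNIV_iff geodesic_def closed_interval_Ici)

lemma seg_morse_UNIV_rays:
  assumes "seg_morse M UNIV \<gamma>"
  shows "seg_morse M {0..} (\<lambda>t. \<gamma> (c + t))" "seg_morse M {0..} (\<lambda>t. \<gamma> (c - t))"
  by (auto intro!: seg_morse_shift[OF assms] seg_morse_reflect[OF assms] closed_interval_Ici)

lemma ray_to_shift:
  assumes "geodesic UNIV \<gamma>" "ray_to b \<gamma>"
  shows "ray_to b (\<lambda>t. \<gamma> (c + t))"
  using assms fellow_travel_shift[of \<gamma> _ "\<lambda>t. \<gamma> (c + t)" "\<bar>c\<bar>"]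
  by (fastforce simp: ray_to_def geodesic_UNIV_iff)

lemma ray_to_reflect:
  assumes "geodesic UNIV \<gamma>" "ray_to b (\<lambda>t. \<gamma> (- t))"
  shows "ray_to b (\<lambda>t. \<gamma> (c - t))"
  using assms fellow_travel_shift[of "\<lambda>t. \<gamma> (- t)" _ "\<lambda>t. \<gamma> (c - t)" "\<bar>c\<bar>"]
  by (fastforce simp: ray_to_def geodesic_UNIV_iff)

lemma geodesic_from_to_iff:
  assumes ab: "a \<in> visual_boundary p" "b \<in> visual_boundary p"
  shows "geodesic_from_to a b \<gamma> \<longleftrightarrow> geodesic UNIV \<gamma> \<and> ray_to a (\<lambda>t. \<gamma> (- t)) \<and> ray_to b \<gamma>"
proof (cases "geodesic UNIV \<gamma>")
  case True
  have "\<gamma> ` {..0} = (\<lambda>t. \<gamma> (- t)) ` {0..}"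
    by (metis (no_types) atMost_iff image_image image_uminus_atLeast neg_0_equal_iff_equal)
  moreover have "geodesic {0..} (\<lambda>t. \<gamma> (- t))" "geodesic {0..} \<gamma>"
    using geodesic_UNIV_rays[OF True, of 0] by simp_all
  ultimately show ?thesis
    using True finite_hausdorff_rays bpoint_ray(1)[OF ab(1)] bpoint_ray(1)[OF ab(2)]
    unfolding geodesic_from_to_def ray_to_def by metis
qed (simp add: geodesic_from_to_def)

lemma geodesic_from_to_reverse:
  assumes ab: "a \<in> visual_boundary p" "b \<in> visual_boundary p" and g: "geodesic_from_to a b \<gamma>"
  shows "geodesic_from_to b a (\<lambda>t. \<gamma> (- t))"
  using g by (simp add: geodesic_from_to_iff[OF ab] geodesic_from_to_iff[OF ab(2,1)] geodesic_UNIV_iff)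
    (simp add: abs_minus_commute)

section \<open>Existence of lines between two boundary points\<close>

text \<open>Tychonoff's theorem yields a cluster point in the product of the \<open>K t\<close>; an
  uncountable product need not provide convergent subsequences. Two coordinates are controlled at
  the same index because being geodesic is a condition on pairs of parameters.\<close>

lemma pointwise_cluster_function:
  fixes f :: "nat \<Rightarrow> 'b \<Rightarrow> 'a::metric_space"
  assumes K: "\<And>t. compact (K t)" and f: "\<And>n t. f n t \<in> K t"
  shows "\<exists>g. \<forall>s t e N. 0 < e \<longrightarrow> (\<exists>n\<ge>N. dist (f n s) (g s) < e \<and> dist (f n t) (g t) < e)"
proof -
  have "compactin (product_topology (\<lambda>_. euclidean) UNIV) (PiE UNIV K)"
    using K by (simp add: compactin_PiE)
  then have "compact (PiE UNIV K)" by (simp add: euclidean_product_topology)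
  moreover have "filtermap f sequentially \<noteq> bot" by (simp add: filtermap_bot_iff)
  moreover have "eventually (\<lambda>h. h \<in> PiE UNIV K) (filtermap f sequentially)"
    using f by (simp add: eventually_filtermap PiE_UNIV_domain)
  ultimately obtain g where g: "inf (nhds g) (filtermap f sequentially) \<noteq> bot"
    by (auto simp: compact_filter)
  have "\<exists>n\<ge>N. dist (f n s) (g s) < e \<and> dist (f n t) (g t) < e" if e: "0 < e" for s t e N
  proof (rule ccontr)
    assume no: "\<not> ?thesis"
    define U where "U = {h. dist (h s) (g s) < e \<and> dist (h t) (g t) < e}"
    have "open U"
      unfolding U_def by (intro open_Collect_conj open_Collect_less continuous_intros) simp_all
    moreover have "g \<in> U" using e by (simp add: U_def)
    ultimately have "eventually (\<lambda>h. h \<in> U) (nhds g)" by (rule eventually_nhds_in_open)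
    moreover have "eventually (\<lambda>h. h \<notin> U) (filtermap f sequentially)"
      using no by (auto simp: eventually_filtermap eventually_sequentially U_def)
    ultimately have "eventually (\<lambda>h. False) (inf (nhds g) (filtermap f sequentially))"
      unfolding eventually_inf by blast
    with g show False by (simp add: trivial_limit_def)
  qed
  then show ?thesis by blast
qed

text \<open>The segment leaves the ray at \<open>\<alpha> n\<close> and stops at an approximate
  nearest point to \<open>\<alpha> 0\<close>. A geodesic from there to \<open>\<alpha> 0\<close>
  closes it up to a quasi-geodesic with constants 3 and 1 and both ends on \<alpha>.\<close>

lemma segment_near_morse_ray:
  fixes \<eta> :: "real \<Rightarrow> 'a::metric_space"
  assumes PG: "proper_geodesic TYPE('a)" and m: "seg_morse M {0..} \<alpha>"
    and g: "\<And>s t. s \<in> {0..T} \<Longrightarrow> t \<in> {0..T} \<Longrightarrow> dist (\<eta> s) (\<eta> t) = \<bar>s - t\<bar>"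
    and T: "0 \<le> T" and n: "0 \<le> n" "\<eta> 0 = \<alpha> n"
    and near: "\<And>x. x \<in> {0..T} \<Longrightarrow> dist (\<alpha> 0) (\<eta> T) \<le> dist (\<alpha> 0) (\<eta> x) + 1"
    and t: "t \<in> {0..T}"
  shows "\<exists>s\<ge>0. dist (\<eta> t) (\<alpha> s) \<le> M (3, 1)"
proof -
  define L where "L = dist (\<alpha> 0) (\<eta> T)"
  have L0: "0 \<le> L" by (simp add: L_def)
  have "qi_embedding_on {0..T} 1 0 \<eta>" using g by (rule qi_embedding_geodesic)
  then have "\<exists>\<rho>. (\<forall>x\<in>{0..T}. \<rho> x = \<eta> x) \<and> \<rho> (T + L) = \<alpha> 0 \<and>
      qi_embedding_on ({0..T} \<union> {T..T + L}) (3 * 1) (2 * 0 + 1) \<rho>"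
    using T near L_def by (intro qi_embedding_append_geodesic[OF PG]) auto
  then obtain \<rho> where \<rho>: "\<And>x. x \<in> {0..T} \<Longrightarrow> \<rho> x = \<eta> x" "\<rho> (T + L) = \<alpha> 0"
      "qi_embedding_on ({0..T} \<union> {T..T + L}) (3 * 1) (2 * 0 + 1) \<rho>"
    by blast
  have "{0..T + L} = {0..T} \<union> {T..T + L}" using T L0 by auto
  with \<rho>(3) have "qi_embedding_on {0..T + L} 3 1 \<rho>" by simp
  then obtain w where "w \<in> {0..n}" "dist (\<rho> t) (\<alpha> w) \<le> M (3, 1)"
    using seg_morseD_rev[OF m, of 0 n 0 "T + L" 3 1 \<rho> t] \<rho>(1)[of 0] \<rho>(2) n T L0 t by auto
  then show ?thesis using \<rho>(1)[OF t] by auto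
qed

text \<open>The geodesics from \<open>\<alpha> n\<close> to \<open>\<beta> n\<close> pass within a bounded distance of the base point, since
  otherwise \<open>\<alpha>\<close> and \<open>\<beta>\<close> would be asymptotic; any pointwise cluster point of them is a line as
  required.\<close>

lemma line_exists:
  fixes p :: "'a::metric_space"
  assumes PG: "proper_geodesic TYPE('a)" and ab: "a \<in> morse_boundary p" "b \<in> morse_boundary p" "a \<noteq> b"
  shows "\<exists>\<gamma>. geodesic_from_to a b \<gamma>"
proof -
  have vab: "a \<in> visual_boundary p" "b \<in> visual_boundary p" using ab by (auto intro: morse_boundary_visual)
  obtain M1 \<alpha> where M1: "M1 \<in> morse_gauges" "seg_morse M1 {0..} \<alpha>" "\<alpha> \<in> a" using ab(1) by (rule morse_boundary_ray)
  obtain M2 \<beta> where M2: "M2 \<in> morse_gauges" "seg_morse M2 {0..} \<beta>" "\<beta> \<in> b" using ab(2) by (rule morse_boundary_ray)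
  obtain M where M: "M \<in> morse_gauges" "M1 \<le> M" "M2 \<le> M" using morse_gauge_bound M1(1) M2(1) by blast
  have m\<alpha>: "seg_morse M {0..} \<alpha>" and m\<beta>: "seg_morse M {0..} \<beta>"
    using M1(2) M2(2) M(2,3) by (auto intro: seg_morse_mono simp: le_fun_def)
  have p: "\<alpha> 0 = p" "\<beta> 0 = p" using bpoint_ray(2)[OF vab(1) M1(3)] bpoint_ray(2)[OF vab(2) M2(3)] .
  have g\<alpha>: "geodesic {0..} \<alpha>" and g\<beta>: "geodesic {0..} \<beta>" using m\<alpha> m\<beta> by (auto intro: seg_morse_geodesic)
  have d\<alpha>: "dist (\<alpha> s) (\<alpha> t) = \<bar>s - t\<bar>" and d\<beta>: "dist (\<beta> s) (\<beta> t) = \<bar>s - t\<bar>" if "0 \<le> s" "0 \<le> t" for s t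
    using g\<alpha> g\<beta> that by (auto simp: geodesic_def)
  define D where "D = M (3, 1)"
  have D0: "0 \<le> D" unfolding D_def by (rule morse_gauge_nonneg[OF M(1)]) auto
  define L where "L n = dist (\<alpha> (real n)) (\<beta> (real n))" for n
  have "\<exists>\<eta>::real \<Rightarrow> 'a. \<eta> 0 = \<alpha> (real n) \<and> \<eta> (L n) = \<beta> (real n) \<and>
      (\<forall>s\<in>{0..L n}. \<forall>t\<in>{0..L n}. dist (\<eta> s) (\<eta> t) = \<bar>s - t\<bar>)" for n
    unfolding L_def by (rule geodesic_segment_exists[OF PG])
  then obtain \<eta> :: "nat \<Rightarrow> real \<Rightarrow> 'a" where \<eta>: "\<And>n. \<eta> n 0 = \<alpha> (real n)" "\<And>n. \<eta> n (L n) = \<beta> (real n)"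
      "\<And>n s t. s \<in> {0..L n} \<Longrightarrow> t \<in> {0..L n} \<Longrightarrow> dist (\<eta> n s) (\<eta> n t) = \<bar>s - t\<bar>"
    by metis
  have L0: "0 \<le> L n" for n by (simp add: L_def)
  \<comment> \<open>The approximate nearest point to \<open>p\<close> splits
    \<open>\<eta> n\<close>: the part before it stays near \<alpha> and the part after it near
    \<beta>, with a bound \<open>D\<close> that does not depend on \<open>n\<close>.\<close>
  have "\<exists>t\<in>{0..L n}. \<forall>s\<in>{0..L n}. dist p (\<eta> n t) \<le> dist p (\<eta> n s) + 1" for n
    using approx_nearest[of "{0..L n}" p "\<eta> n"] L0[of n] by auto
  then obtain T where T: "\<And>n. T n \<in> {0..L n}"
      "\<And>n s. s \<in> {0..L n} \<Longrightarrow> dist p (\<eta> n (T n)) \<le> dist p (\<eta> n s) + 1"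
    by metis
  have near\<alpha>: "\<exists>s\<ge>0. dist (\<eta> n t) (\<alpha> s) \<le> D" if "t \<in> {0..T n}" for n t
    unfolding D_def
    by (rule segment_near_morse_ray[OF PG m\<alpha>, of "T n" "\<eta> n" "real n"])
      (use \<eta>[where n = n] T(1)[of n] T(2)[where n = n] that p in auto)
  have near\<beta>: "\<exists>s\<ge>0. dist (\<eta> n t) (\<beta> s) \<le> D" if "t \<in> {T n..L n}" for n t
  proof -
    have "\<exists>s\<ge>0. dist (\<eta> n (L n - (L n - t))) (\<beta> s) \<le> D"
      unfolding D_def
      by (rule segment_near_morse_ray[OF PG m\<beta>, of "L n - T n" "\<lambda>t. \<eta> n (L n - t)" "real n"])
        (use \<eta>[where n = n] T(1)[of n] T(2)[where n = n] that p in auto)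
    then show ?thesis by simp
  qed
  have "\<exists>R. \<forall>n. dist p (\<eta> n (T n)) \<le> R"
  proof (rule ccontr)
    assume unbounded: "\<not> ?thesis"
    \<comment> \<open>If \<open>\<eta> n (T n)\<close> is far from \<open>p\<close>, it is near some
      \<open>\<alpha> s1\<close> with \<open>s \<le> s1\<close> and also near \<beta>. Then \<alpha>
      restricted to \<open>{0..s1}\<close> is a geodesic with both ends near \<beta>.\<close>
    have "\<exists>s'\<ge>0. dist (\<alpha> s) (\<beta> s') \<le> M (1, 0 + 2 * (2 * D)) + 2 * D" if s: "0 \<le> s" for s
    proof -
      obtain n where n: "D + s < dist p (\<eta> n (T n))" using unbounded by (meson not_le)
      obtain s1 where s1: "0 \<le> s1" "dist (\<eta> n (T n)) (\<alpha> s1) \<le> D" using near\<alpha>[of "T n" n] T(1)[of n] by auto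
      obtain s2 where s2: "0 \<le> s2" "dist (\<eta> n (T n)) (\<beta> s2) \<le> D" using near\<beta>[of "T n" n] T(1)[of n] by auto
      have "dist p (\<eta> n (T n)) \<le> dist p (\<alpha> s1) + dist (\<eta> n (T n)) (\<alpha> s1)" by (rule dist_triangle2)
      moreover have "dist p (\<alpha> s1) = s1" using d\<alpha>[of 0 s1] s1(1) p by simp
      ultimately have "s \<le> s1" using n s1 by linarith
      have "dist (\<alpha> s1) (\<beta> s2) \<le> 2 * D"
        using dist_triangle3[of "\<alpha> s1" "\<beta> s2" "\<eta> n (T n)"] s1 s2 by linarith
      moreover have "qi_embedding_on {0..s1} 1 0 \<alpha>" by (rule qi_embedding_geodesic) (auto intro: d\<alpha>)
      ultimately show ?thesis
        using seg_morse_near_ends[OF m\<beta> M(1), of 0 s2 0 s1 1 0 \<alpha> "2 * D" s] s1(1) s2(1) s \<open>s \<le> s1\<close> p D0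
        by auto
    qed
    then have "fellow_travel \<alpha> \<beta>" by (rule fellow_travel_if_near[OF g\<alpha> g\<beta>])
    then show False using bpoint_eq_iff[OF vab M1(3) M2(3)] ab(3) by simp
  qed
  then obtain R where R: "\<And>n. dist p (\<eta> n (T n)) \<le> R" by blast
  \<comment> \<open>Centering at \<open>T n\<close> keeps the values at a fixed \<open>t\<close> in
    a fixed ball. Clamping makes the functions total; at a fixed \<open>t\<close> it has no effect
    once \<open>n\<close> is large.\<close>
  define f where "f n t = \<eta> n (max 0 (min (L n) (T n + t)))" for n t
  have clamp: "max 0 (min (L n) x) \<in> {0..L n}" for n x using L0[of n] by auto
  have "f n t \<in> cball p (R + \<bar>t\<bar>)" for n t
  proof -
    have "dist (\<eta> n (T n)) (f n t) = \<bar>T n - max 0 (min (L n) (T n + t))\<bar>"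
      unfolding f_def using \<eta>(3) T(1) clamp by blast
    also have "\<dots> \<le> \<bar>t\<bar>" using T(1)[of n] by auto
    finally show ?thesis using R[of n] dist_triangle[of p "f n t" "\<eta> n (T n)"] by simp
  qed
  moreover have "compact (cball p (R + \<bar>t\<bar>))" for t :: real using PG by (simp add: proper_geodesic_def)
  ultimately obtain g where g: "\<And>s t e N. 0 < e \<Longrightarrow> \<exists>n\<ge>N. dist (f n s) (g s) < e \<and> dist (f n t) (g t) < e"
    using pointwise_cluster_function[of "\<lambda>t. cball p (R + \<bar>t\<bar>)" f] by blast
  have wide: "T n \<ge> real n - R" "L n - T n \<ge> real n - R" for n
  proof -
    have "dist p (\<alpha> (real n)) = real n" "dist p (\<beta> (real n)) = real n"
      using d\<alpha>[of 0 "real n"] d\<beta>[of 0 "real n"] p by auto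
    moreover have "dist (\<eta> n (T n)) (\<eta> n 0) = T n" "dist (\<eta> n (T n)) (\<eta> n (L n)) = L n - T n"
      using \<eta>(3)[of "T n" n 0] \<eta>(3)[of "T n" n "L n"] T(1)[of n] L0[of n] by auto
    moreover have "dist p (\<eta> n 0) \<le> dist p (\<eta> n (T n)) + dist (\<eta> n (T n)) (\<eta> n 0)"
      "dist p (\<eta> n (L n)) \<le> dist p (\<eta> n (T n)) + dist (\<eta> n (T n)) (\<eta> n (L n))"
      by (rule dist_triangle)+
    ultimately show "T n \<ge> real n - R" "L n - T n \<ge> real n - R" using R[of n] \<eta>(1,2)[of n] by auto
  qed
  have f_eq: "f n t = \<eta> n (T n + t)" "T n + t \<in> {0..L n}" if "R + \<bar>t\<bar> \<le> real n" for n t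
    using wide[of n] that by (auto simp: f_def)
  have "dist (g s) (g t) = \<bar>s - t\<bar>" for s t
  proof (rule ccontr)
    assume "dist (g s) (g t) \<noteq> \<bar>s - t\<bar>"
    define e where "e = \<bar>dist (g s) (g t) - \<bar>s - t\<bar>\<bar> / 2"
    have e: "0 < e" using \<open>dist (g s) (g t) \<noteq> \<bar>s - t\<bar>\<close> by (simp add: e_def)
    obtain N where N: "R + \<bar>s\<bar> + \<bar>t\<bar> \<le> real N" using real_arch_simple by blast
    obtain n where n: "N \<le> n" "dist (f n s) (g s) < e" "dist (f n t) (g t) < e" using g[OF e] by blast
    have "R + \<bar>s\<bar> \<le> real n" "R + \<bar>t\<bar> \<le> real n" using N n(1) by linarith+
    then have "dist (f n s) (f n t) = \<bar>s - t\<bar>" using f_eq[of s n] f_eq[of t n] \<eta>(3) by simp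
    moreover have "dist (f n s) (f n t) \<le> dist (f n s) (g s) + dist (g s) (g t) + dist (f n t) (g t)"
      "dist (g s) (g t) \<le> dist (f n s) (g s) + dist (f n s) (f n t) + dist (f n t) (g t)"
      by (smt (verit) dist_triangle dist_commute)+
    ultimately have "\<bar>dist (g s) (g t) - \<bar>s - t\<bar>\<bar> < 2 * e" using n by linarith
    then show False by (simp add: e_def)
  qed
  then have gg: "geodesic UNIV g" by (simp add: geodesic_UNIV_iff)
  have approx: "\<exists>n. R + \<bar>t\<bar> \<le> real n \<and> dist (f n t) (g t) < 1" for t
  proof -
    obtain N where N: "R + \<bar>t\<bar> \<le> real N" using real_arch_simple by blast
    obtain n where "N \<le> n" "dist (f n t) (g t) < 1" using g[of 1 N t t] by auto
    with N show ?thesis by (intro exI[of _ n]) linarith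
  qed
  \<comment> \<open>The index \<open>n\<close> that approximates \<open>g\<close> within 1 varies
    with \<open>t\<close>; this is harmless because \<open>D\<close> is independent of
    \<open>n\<close>.\<close>
  have near: "\<exists>s\<ge>0. dist (g t) (\<delta> s) \<le> D + 1"
    if ev: "\<And>n. R + \<bar>t\<bar> \<le> real n \<Longrightarrow> \<exists>s\<ge>0. dist (\<eta> n (T n + t)) (\<delta> s) \<le> D" for t and \<delta> :: "real \<Rightarrow> 'a"
  proof -
    obtain n where n: "R + \<bar>t\<bar> \<le> real n" "dist (f n t) (g t) < 1" using approx by blast
    obtain s where "0 \<le> s" "dist (f n t) (\<delta> s) \<le> D" using ev[OF n(1)] f_eq(1)[OF n(1)] by auto
    then show ?thesis using n(2) dist_triangle3[of "g t" "\<delta> s" "f n t"] by (intro exI[of _ s]) auto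
  qed
  have "\<exists>s\<ge>0. dist (g t) (\<beta> s) \<le> D + 1" if "0 \<le> t" for t
    by (rule near, rule near\<beta>) (use that f_eq(2) in auto)
  then have "fellow_travel g \<beta>"
    using geodesic_UNIV_rays(1)[OF gg, of 0] g\<beta> by (intro fellow_travel_if_near) auto
  moreover have "\<exists>s\<ge>0. dist (g (- t)) (\<alpha> s) \<le> D + 1" if "0 \<le> t" for t
    by (rule near, rule near\<alpha>) (use that f_eq(2)[of "- t"] in auto)
  then have "fellow_travel (\<lambda>t. g (- t)) \<alpha>"
    using geodesic_UNIV_rays(2)[OF gg, of 0] g\<alpha> by (intro fellow_travel_if_near) auto
  ultimately show ?thesis
    using gg M1(3) M2(3) by (auto simp: geodesic_from_to_iff[OF vab] ray_to_def)
qed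

section \<open>Centers of ideal triangles\<close>

lemma centers_rotate: "centers K a b c = centers K b c a"
  unfolding centers_def by blast

lemma centers_swap:
  assumes v: "a \<in> visual_boundary p" "b \<in> visual_boundary p" "c \<in> visual_boundary p"
  shows "centers K a b c = centers K b a c"
proof -
  have range: "range (\<lambda>t::real. \<gamma> (- t)) = range \<gamma>" for \<gamma> :: "real \<Rightarrow> 'a"
    by (metis (no_types) image_image surj_uminus)
  have sub: "centers K a b c \<subseteq> centers K b a c"
    if v: "a \<in> visual_boundary p" "b \<in> visual_boundary p" "c \<in> visual_boundary p" for a b c
  proof
    fix x assume "x \<in> centers K a b c"
    then obtain \<gamma>1 \<gamma>2 \<gamma>3 where g: "geodesic_from_to a b \<gamma>1" "geodesic_from_to b c \<gamma>2" "geodesic_from_to c a \<gamma>3"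
       and x: "x \<in> nbhd K (range \<gamma>1)" "x \<in> nbhd K (range \<gamma>2)" "x \<in> nbhd K (range \<gamma>3)"
      unfolding centers_def by blast
    have "geodesic_from_to b a (\<lambda>t. \<gamma>1 (- t))" "geodesic_from_to a c (\<lambda>t. \<gamma>3 (- t))" "geodesic_from_to c b (\<lambda>t. \<gamma>2 (- t))"
      using g v by (auto intro: geodesic_from_to_reverse[of _ p])
    moreover have "x \<in> nbhd K (range (\<lambda>t. \<gamma>1 (- t)))" "x \<in> nbhd K (range (\<lambda>t. \<gamma>3 (- t)))"
        "x \<in> nbhd K (range (\<lambda>t. \<gamma>2 (- t)))"
      using x by (simp_all add: range)
    ultimately show "x \<in> centers K b a c" unfolding centers_def by blast
  qed
  show ?thesis using sub[OF v] sub[OF v(2,1,3)] by blast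
qed

lemma nbhd_range: "x \<in> nbhd K (range \<gamma>) \<longleftrightarrow> (\<exists>t. dist x (\<gamma> t) \<le> K)"
  by (auto simp: nbhd_def dist_commute)

lemma nbhd_mono: "K \<le> K' \<Longrightarrow> nbhd K S \<subseteq> nbhd K' S"
  by (force simp: nbhd_def)

lemma centers_mono: "K \<le> K' \<Longrightarrow> centers K a b c \<subseteq> centers K' a b c"
  unfolding centers_def using nbhd_mono[of K K'] by blast

lemma morse_triple_iff:
  "[a, b, c] \<in> morse_tuples p 3 N \<longleftrightarrow> a \<noteq> b \<and> b \<noteq> c \<and> a \<noteq> c \<and>
     [a, b] \<in> morse_tuples p 2 N \<and> [b, c] \<in> morse_tuples p 2 N \<and> [c, a] \<in> morse_tuples p 2 N"
  unfolding morse_tuples_def by auto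

lemma morse_quadruple_iff:
  "[a, b, c, d] \<in> morse_tuples p 4 N \<longleftrightarrow>
     [a, b] \<in> morse_tuples p 2 N \<and> [b, c] \<in> morse_tuples p 2 N \<and> [c, a] \<in> morse_tuples p 2 N \<and>
     [a, d] \<in> morse_tuples p 2 N \<and> [b, d] \<in> morse_tuples p 2 N \<and> [c, d] \<in> morse_tuples p 2 N"
  unfolding morse_tuples_def by auto

lemma morse_pair_iff:
  "[a, b] \<in> morse_tuples p 2 N \<longleftrightarrow> a \<noteq> b \<and> a \<in> morse_boundary p \<and> b \<in> morse_boundary p \<and>
     (\<forall>\<gamma>. geodesic_from_to a b \<gamma> \<longrightarrow> seg_morse N UNIV \<gamma>)"
proof -
  have "seg_morse N UNIV \<gamma>"
    if "\<And>\<gamma>. geodesic_from_to a b \<gamma> \<Longrightarrow> seg_morse N UNIV \<gamma>" "geodesic_from_to b a \<gamma>"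
      "a \<in> morse_boundary p" "b \<in> morse_boundary p" for \<gamma>
  proof -
    have "seg_morse N UNIV (\<lambda>t. \<gamma> (- t))"
      using geodesic_from_to_reverse[OF _ _ that(2)] that(1,3,4) morse_boundary_visual by blast
    from seg_morse_reflect[OF this closed_interval_UNIV, of 0] show ?thesis by simp
  qed
  then show ?thesis unfolding morse_tuples_def morse_geodesic_iff_seg_morse by auto
qed

section \<open>Existence of centers, thin ideal triangles, boundedness of centers\<close>

lemma ideal_triangle_points:
  assumes t: "triangle_constant p N \<kappa>" and abc: "[a, b, c] \<in> morse_tuples p 3 N"
    and g: "geodesic_from_to a b \<gamma>1" "geodesic_from_to b c \<gamma>2" "geodesic_from_to c a \<gamma>3"
  shows "\<exists>t1 t2 t3. dist (\<gamma>1 t1) (\<gamma>2 t2) \<le> \<kappa> \<and> dist (\<gamma>1 t1) (\<gamma>3 t3) \<le> \<kappa>"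
proof -
  have b: "{Inr a, Inr b, Inr c} \<subseteq> range Inl \<union> Inr ` morse_boundary p"
    using abc by (auto simp: morse_tuples_def)
  have "morse_geodesic N UNIV \<gamma>1" "morse_geodesic N UNIV \<gamma>2" "morse_geodesic N UNIV \<gamma>3"
    using abc g unfolding morse_triple_iff morse_pair_iff morse_geodesic_iff_seg_morse by blast+
  then have "\<exists>q1\<in>range \<gamma>1. \<exists>q2\<in>range \<gamma>2. \<exists>q3\<in>range \<gamma>3. dist q1 q2 \<le> \<kappa> \<and> dist q2 q3 \<le> \<kappa> \<and> dist q3 q1 \<le> \<kappa>"
    using t[unfolded triangle_constant_def, rule_format, OF b, of UNIV \<gamma>1 UNIV \<gamma>2 UNIV \<gamma>3] g by simp
  then show ?thesis by (auto simp: dist_commute)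
qed

text \<open>\<open>triangle_constant\<close> speaks about given triangles only, so the sides are
  supplied by \<open>line_exists\<close>. The point chosen on the first side is then a
  center.\<close>

lemma centers_nonempty:
  fixes p :: "'a::metric_space"
  assumes PG: "proper_geodesic TYPE('a)" and abc: "[a, b, c] \<in> morse_tuples p 3 N"
    and t: "triangle_constant p N \<kappa>" and K: "\<kappa> \<le> K"
  shows "centers K a b c \<noteq> {}"
proof -
  obtain \<gamma>1 \<gamma>2 \<gamma>3 where g: "geodesic_from_to a b \<gamma>1" "geodesic_from_to b c \<gamma>2" "geodesic_from_to c a \<gamma>3"
    using abc line_exists[OF PG] unfolding morse_triple_iff morse_pair_iff by meson
  obtain t1 t2 t3 where q: "dist (\<gamma>1 t1) (\<gamma>2 t2) \<le> \<kappa>" "dist (\<gamma>1 t1) (\<gamma>3 t3) \<le> \<kappa>"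
    using ideal_triangle_points[OF t abc g] by blast
  have "dist (\<gamma>1 t1) (\<gamma>1 t1) \<le> K" using q(1) K zero_le_dist[of "\<gamma>1 t1" "\<gamma>2 t2"] by (simp del: zero_le_dist)
  then have "\<gamma>1 t1 \<in> nbhd K (range \<gamma>1)" "\<gamma>1 t1 \<in> nbhd K (range \<gamma>2)" "\<gamma>1 t1 \<in> nbhd K (range \<gamma>3)"
    using q K unfolding nbhd_range by (blast intro: order_trans)+
  then show ?thesis using g unfolding centers_def by blast
qed

text \<open>The points supplied by \<open>triangle_constant\<close> divide the first side into two
  halves. Each half is asymptotic to a half of another side that starts within \<kappa> of it, so
  \<open>ray_near_morse_ray\<close> applies with \<open>D = \<kappa>\<close>.\<close>

lemma thin_ideal_triangle:
  fixes p :: "'a::metric_space"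
  assumes PG: "proper_geodesic TYPE('a)" and M: "M \<in> morse_gauges"
    and \<kappa>: "triangle_constant p M \<kappa>" and abc: "[a, b, c] \<in> morse_tuples p 3 M"
    and g: "geodesic_from_to a b \<gamma>1" "geodesic_from_to b c \<gamma>2" "geodesic_from_to c a \<gamma>3"
  shows "\<exists>s. dist (\<gamma>1 t) (\<gamma>2 s) \<le> M (3, 1 + 2 * \<kappa>) + \<kappa> \<or> dist (\<gamma>1 t) (\<gamma>3 s) \<le> M (3, 1 + 2 * \<kappa>) + \<kappa>"
proof -
  have v: "a \<in> visual_boundary p" "b \<in> visual_boundary p" "c \<in> visual_boundary p"
    using abc by (auto simp: morse_tuples_def intro: morse_boundary_visual)
  have m: "seg_morse M UNIV \<gamma>1" "seg_morse M UNIV \<gamma>2" "seg_morse M UNIV \<gamma>3"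
    using abc g unfolding morse_triple_iff morse_pair_iff by blast+
  then have u: "geodesic UNIV \<gamma>1" "geodesic UNIV \<gamma>2" "geodesic UNIV \<gamma>3" by (auto intro: seg_morse_geodesic)
  obtain t1 t2 t3 where q: "dist (\<gamma>1 t1) (\<gamma>2 t2) \<le> \<kappa>" "dist (\<gamma>1 t1) (\<gamma>3 t3) \<le> \<kappa>"
    using ideal_triangle_points[OF \<kappa> abc g] by blast
  note to1 = g(1)[unfolded geodesic_from_to_iff[OF v(1,2)]]
    and to2 = g(2)[unfolded geodesic_from_to_iff[OF v(2,3)]]
    and to3 = g(3)[unfolded geodesic_from_to_iff[OF v(3,1)]]
  show ?thesis
  proof (cases "t1 \<le> t")
    case True
    have "fellow_travel (\<lambda>s. \<gamma>1 (t1 + s)) (\<lambda>s. \<gamma>2 (t2 - s))"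
      using to1 to2 u by (intro ray_to_fellow_travel[OF v(2)] ray_to_shift ray_to_reflect) auto
    then obtain s where "dist (\<gamma>1 (t1 + (t - t1))) (\<gamma>2 (t2 - s)) \<le> M (3, 1 + 2 * \<kappa>) + \<kappa>"
      using ray_near_morse_ray[OF PG seg_morse_UNIV_rays(2)[OF m(2)] M geodesic_UNIV_rays(1)[OF u(1)], of t1 t2 \<kappa> "t - t1"]
        q(1) True by auto
    then show ?thesis by auto
  next
    case False
    have "fellow_travel (\<lambda>s. \<gamma>1 (t1 - s)) (\<lambda>s. \<gamma>3 (t3 + s))"
      using to1 to3 u by (intro ray_to_fellow_travel[OF v(1)] ray_to_shift ray_to_reflect) auto
    then obtain s where "dist (\<gamma>1 (t1 - (t1 - t))) (\<gamma>3 (t3 + s)) \<le> M (3, 1 + 2 * \<kappa>) + \<kappa>"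
      using ray_near_morse_ray[OF PG seg_morse_UNIV_rays(1)[OF m(3)] M geodesic_UNIV_rays(2)[OF u(1)], of t1 t3 \<kappa> "t1 - t"]
        q(2) False by auto
    then show ?thesis by auto
  qed
qed

text \<open>Seen from a center \<open>x\<close>, each side of the triangle consists of two of three directions, and
  every other center is near one direction on each side. So it is near two different directions,
  that is, near both halves of one side, hence near \<open>x\<close>.\<close>

lemma centers_bounded:
  assumes PG: "proper_geodesic TYPE('a::metric_space)" and M: "M \<in> morse_gauges" and K: "0 \<le> K"
  shows "\<exists>B. \<forall>(p::'a) a b c. [a, b, c] \<in> morse_tuples p 3 M \<longrightarrow>
     (\<forall>x\<in>centers K a b c. \<forall>y\<in>centers K a b c. dist x y \<le> B)"
proof -
  \<comment> \<open>The triangle chosen for \<open>y\<close> may differ from the one chosen for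
    \<open>x\<close>: \<open>E\<close> bounds the passage from \<open>y\<close> to a half of a side
    of the latter. \<open>F\<close> bounds the passage between asymptotic halves of two adjacent
    sides, whose starting points are both within \<open>K\<close> of \<open>x\<close>.\<close>
  define E where "E = K + 5 * M (9, 3)"
  define F where "F = M (3, 1 + 2 * (2 * K)) + 2 * K"
  have F0: "0 \<le> F" using K morse_gauge_nonneg[OF M, of 3 "1 + 2 * (2 * K)"] by (simp add: F_def)
  define B where "B = E + F"
  have "dist x y \<le> 3 * B + K"
    if abc: "[a, b, c] \<in> morse_tuples p 3 M" and x: "x \<in> centers K a b c" and y: "y \<in> centers K a b c"
    for p :: 'a and a b c x y
  proof -
    have v: "a \<in> visual_boundary p" "b \<in> visual_boundary p" "c \<in> visual_boundary p"
      using abc by (auto simp: morse_tuples_def intro: morse_boundary_visual)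
    obtain \<gamma>1 \<gamma>2 \<gamma>3 x1 x2 x3 where g: "geodesic_from_to a b \<gamma>1" "geodesic_from_to b c \<gamma>2" "geodesic_from_to c a \<gamma>3"
      and x: "dist x (\<gamma>1 x1) \<le> K" "dist x (\<gamma>2 x2) \<le> K" "dist x (\<gamma>3 x3) \<le> K"
      using x unfolding centers_def nbhd_range by blast
    obtain \<delta>1 \<delta>2 \<delta>3 z1 z2 z3 where d: "geodesic_from_to a b \<delta>1" "geodesic_from_to b c \<delta>2" "geodesic_from_to c a \<delta>3"
      and z: "dist y (\<delta>1 z1) \<le> K" "dist y (\<delta>2 z2) \<le> K" "dist y (\<delta>3 z3) \<le> K"
      using y unfolding centers_def nbhd_range by blast
    have m: "seg_morse M UNIV \<gamma>1" "seg_morse M UNIV \<gamma>2" "seg_morse M UNIV \<gamma>3"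
      using abc g unfolding morse_triple_iff morse_pair_iff by blast+
    then have u: "geodesic UNIV \<gamma>1" "geodesic UNIV \<gamma>2" "geodesic UNIV \<gamma>3" by (auto intro: seg_morse_geodesic)
    have side: "(\<exists>s\<ge>0. dist y (\<gamma> (w + s)) \<le> E) \<or> (\<exists>s\<ge>0. dist y (\<gamma> (w - s)) \<le> E)"
      if v: "a \<in> visual_boundary p" "b \<in> visual_boundary p" and m: "seg_morse M UNIV \<gamma>"
        and g: "geodesic_from_to a b \<gamma>" and d: "geodesic_from_to a b \<delta>" and z: "dist y (\<delta> z) \<le> K"
      for a b \<gamma> \<delta> z w
    proof -
      note gto = g[unfolded geodesic_from_to_iff[OF v]] and dto = d[unfolded geodesic_from_to_iff[OF v]]
      have ray: "fellow_travel (\<lambda>t. \<delta> (- t)) (\<lambda>t. \<gamma> (w - t))"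
        by (rule ray_to_fellow_travel[OF v(1)]) (use gto dto in \<open>auto intro: ray_to_reflect\<close>)
      have ray': "fellow_travel \<delta> (\<lambda>t. \<gamma> (w + t))"
        by (rule ray_to_fellow_travel[OF v(2)]) (use gto dto in \<open>auto intro: ray_to_shift\<close>)
      obtain c a b where ab: "0 \<le> a" "0 \<le> b"
        and near: "\<And>t. 0 \<le> t \<Longrightarrow> dist (\<delta> (c - t)) (\<gamma> (w - (a + t))) \<le> 5 * M (9, 3)"
          "\<And>t. 0 \<le> t \<Longrightarrow> dist (\<delta> (c + t)) (\<gamma> (w + (b + t))) \<le> 5 * M (9, 3)"
        using line_follows_morse_rays[OF PG M seg_morse_UNIV_rays(2)[OF m] seg_morse_UNIV_rays(1)[OF m] _ _ ray ray', of 0] dto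
        by auto
      show ?thesis
      proof (cases "c \<le> z")
        case True
        then have "dist y (\<gamma> (w + (b + (z - c)))) \<le> E"
          using near(2)[of "z - c"] z dist_triangle[of y "\<gamma> (w + (b + (z - c)))" "\<delta> z"] by (simp add: E_def)
        then show ?thesis using True ab by (intro disjI1 exI[of _ "b + (z - c)"]) auto
      next
        case False
        then have "dist y (\<gamma> (w - (a + (c - z)))) \<le> E"
          using near(1)[of "c - z"] z dist_triangle[of y "\<gamma> (w - (a + (c - z)))" "\<delta> z"] by (simp add: E_def)
        then show ?thesis using False ab by (intro disjI2 exI[of _ "a + (c - z)"]) auto
      qed
    qed
    have transfer: "\<exists>s\<ge>0. dist y (\<beta> s) \<le> B"
      if to: "b \<in> visual_boundary p" "ray_to b \<alpha>" "ray_to b \<beta>"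
        and \<alpha>: "geodesic {0..} \<alpha>" and \<beta>: "seg_morse M {0..} \<beta>"
        and d: "dist x (\<alpha> 0) \<le> K" "dist x (\<beta> 0) \<le> K" and ex: "\<exists>s\<ge>0. dist y (\<alpha> s) \<le> E" for b \<alpha> \<beta>
    proof -
      obtain s where s: "0 \<le> s" "dist y (\<alpha> s) \<le> E" using ex by blast
      have "dist (\<alpha> 0) (\<beta> 0) \<le> 2 * K" using d dist_triangle3[of "\<alpha> 0" "\<beta> 0" x] by linarith
      then obtain s' where "0 \<le> s'" "dist (\<alpha> s) (\<beta> s') \<le> F"
        using ray_near_morse_ray[OF PG \<beta> M \<alpha> ray_to_fellow_travel[OF to] _ s(1), of "2 * K"]
        unfolding F_def by blast
      then show ?thesis using s(2) dist_triangle[of y "\<beta> s'" "\<alpha> s"] by (intro exI[of _ s']) (auto simp: B_def)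
    qed
    \<comment> \<open>Points on opposite halves are \<open>s + s'\<close> apart, so
      \<open>s \<le> 2 * B\<close>; the way from \<open>x\<close> over \<open>\<gamma> w\<close> to
      \<open>y\<close> then costs \<open>K + 2 * B + B\<close>.\<close>
    have both: "dist x y \<le> 3 * B + K"
      if "geodesic UNIV \<gamma>" "dist x (\<gamma> w) \<le> K"
        and ex: "\<exists>s\<ge>0. dist y (\<gamma> (w + s)) \<le> B" "\<exists>s\<ge>0. dist y (\<gamma> (w - s)) \<le> B"
      for \<gamma> w
    proof -
      obtain s s' where s: "0 \<le> s" "dist y (\<gamma> (w + s)) \<le> B" "0 \<le> s'" "dist y (\<gamma> (w - s')) \<le> B"
        using ex by blast
      have "dist (\<gamma> (w + s)) (\<gamma> (w - s')) = s + s'" "dist (\<gamma> (w + s)) (\<gamma> w) = s"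
        using that(1) s by (auto simp: geodesic_UNIV_iff)
      moreover have "dist (\<gamma> (w + s)) (\<gamma> (w - s')) \<le> dist y (\<gamma> (w + s)) + dist y (\<gamma> (w - s'))"
        "dist x y \<le> dist x (\<gamma> w) + dist (\<gamma> (w + s)) (\<gamma> w) + dist y (\<gamma> (w + s))"
        by (smt (verit) dist_triangle dist_commute)+
      ultimately show ?thesis using that(2) s by linarith
    qed
    note to1 = g(1)[unfolded geodesic_from_to_iff[OF v(1,2)]]
      and to2 = g(2)[unfolded geodesic_from_to_iff[OF v(2,3)]]
      and to3 = g(3)[unfolded geodesic_from_to_iff[OF v(3,1)]]
    define P where "P \<gamma> w e \<longleftrightarrow> (\<exists>s\<ge>0. dist y (\<gamma> (w + s)) \<le> e)" for \<gamma> :: "real \<Rightarrow> 'a" and w e :: real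
    define Q where "Q \<gamma> w e \<longleftrightarrow> (\<exists>s\<ge>0. dist y (\<gamma> (w - s)) \<le> e)" for \<gamma> :: "real \<Rightarrow> 'a" and w e :: real
    have sides: "P \<gamma>1 x1 E \<or> Q \<gamma>1 x1 E" "P \<gamma>2 x2 E \<or> Q \<gamma>2 x2 E" "P \<gamma>3 x3 E \<or> Q \<gamma>3 x3 E"
      unfolding P_def Q_def
      using side[OF v(1,2) m(1) g(1) d(1) z(1)] side[OF v(2,3) m(2) g(2) d(2) z(2)] side[OF v(3,1) m(3) g(3) d(3) z(3)]
      by blast+
    have weaken: "P \<gamma> w E \<Longrightarrow> P \<gamma> w B" "Q \<gamma> w E \<Longrightarrow> Q \<gamma> w B" for \<gamma> w
      using F0 unfolding P_def Q_def B_def by (meson le_add_same_cancel1 order_trans)+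
    note shift = ray_to_shift[OF u(1)] ray_to_shift[OF u(2)] ray_to_shift[OF u(3)]
      and refl = ray_to_reflect[OF u(1)] ray_to_reflect[OF u(2)] ray_to_reflect[OF u(3)]
      and mr = seg_morse_UNIV_rays[OF m(1)] seg_morse_UNIV_rays[OF m(2)] seg_morse_UNIV_rays[OF m(3)]
      and gr = geodesic_UNIV_rays[OF u(1)] geodesic_UNIV_rays[OF u(2)] geodesic_UNIV_rays[OF u(3)]
    have "P \<gamma>1 x1 E \<Longrightarrow> Q \<gamma>2 x2 B" "Q \<gamma>2 x2 E \<Longrightarrow> P \<gamma>1 x1 B"
      unfolding P_def Q_def
      using transfer[OF v(2), of "\<lambda>s. \<gamma>1 (x1 + s)" "\<lambda>s. \<gamma>2 (x2 - s)"]
        transfer[OF v(2), of "\<lambda>s. \<gamma>2 (x2 - s)" "\<lambda>s. \<gamma>1 (x1 + s)"] to1 to2 shift refl mr gr x by simp_all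
    moreover have "P \<gamma>2 x2 E \<Longrightarrow> Q \<gamma>3 x3 B" "Q \<gamma>3 x3 E \<Longrightarrow> P \<gamma>2 x2 B"
      unfolding P_def Q_def
      using transfer[OF v(3), of "\<lambda>s. \<gamma>2 (x2 + s)" "\<lambda>s. \<gamma>3 (x3 - s)"]
        transfer[OF v(3), of "\<lambda>s. \<gamma>3 (x3 - s)" "\<lambda>s. \<gamma>2 (x2 + s)"] to2 to3 shift refl mr gr x by simp_all
    moreover have "P \<gamma>3 x3 E \<Longrightarrow> Q \<gamma>1 x1 B" "Q \<gamma>1 x1 E \<Longrightarrow> P \<gamma>3 x3 B"
      unfolding P_def Q_def
      using transfer[OF v(1), of "\<lambda>s. \<gamma>3 (x3 + s)" "\<lambda>s. \<gamma>1 (x1 - s)"]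
        transfer[OF v(1), of "\<lambda>s. \<gamma>1 (x1 - s)" "\<lambda>s. \<gamma>3 (x3 + s)"] to3 to1 shift refl mr gr x by simp_all
    \<comment> \<open>Each side selects one of its two vertices as a direction. No vertex lies on
      all three sides, so two different vertices are selected, and the side between them is met in
      both halves.\<close>
    ultimately have "P \<gamma>1 x1 B \<and> Q \<gamma>1 x1 B \<or> P \<gamma>2 x2 B \<and> Q \<gamma>2 x2 B \<or> P \<gamma>3 x3 B \<and> Q \<gamma>3 x3 B"
      using sides weaken by meson
    then show ?thesis
      unfolding P_def Q_def using both u x by blast
  qed
  then show ?thesis by blast
qed

section \<open>Triples with nearby centers\<close>

lemma morse_triple_boundary:
  assumes "[a, b, c] \<in> morse_tuples p 3 N"
  shows "a \<in> morse_boundary p" "b \<in> morse_boundary p" "c \<in> morse_boundary p"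
    and "a \<in> visual_boundary p" "b \<in> visual_boundary p" "c \<in> visual_boundary p"
  using assms morse_boundary_visual unfolding morse_triple_iff morse_pair_iff by blast+

definition passes_near :: "real \<Rightarrow> 'a::metric_space \<Rightarrow> 'a bpoint \<Rightarrow> 'a bpoint \<Rightarrow> bool" where
  "passes_near R x a b \<longleftrightarrow> (\<exists>\<gamma>. geodesic_from_to a b \<gamma> \<and> x \<in> nbhd R (range \<gamma>))"

text \<open>The part of \<open>passes_near\<close> that concerns one end only. It can therefore be
  combined for vertices of different triangles, between which no Morse line is known in
  advance.\<close>

definition morse_ray_near :: "gauge \<Rightarrow> real \<Rightarrow> 'a::metric_space \<Rightarrow> 'a bpoint \<Rightarrow> bool" where
  "morse_ray_near M R x a \<longleftrightarrow> (\<exists>\<beta>. seg_morse M {0..} \<beta> \<and> ray_to a \<beta> \<and> dist x (\<beta> 0) \<le> R)"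

lemma centers_iff_passes_near:
  "x \<in> centers K a b c \<longleftrightarrow> passes_near K x a b \<and> passes_near K x b c \<and> passes_near K x c a"
  unfolding centers_def passes_near_def by blast

lemma passes_near_mono:
  assumes "passes_near R x a b" "dist x y \<le> D" "R + D \<le> R'"
  shows "passes_near R' y a b"
proof -
  obtain \<gamma> t where g: "geodesic_from_to a b \<gamma>" "dist x (\<gamma> t) \<le> R"
    using assms(1) by (auto simp: passes_near_def nbhd_range)
  have "dist y (\<gamma> t) \<le> R'" using g(2) assms(2,3) dist_triangle3[of y "\<gamma> t" x] by linarith
  then show ?thesis using g(1) by (auto simp: passes_near_def nbhd_range)
qed

lemma passes_near_sym:
  assumes v: "a \<in> visual_boundary p" "b \<in> visual_boundary p" and n: "passes_near R x a b"
  shows "passes_near R x b a"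
proof -
  obtain \<gamma> t where g: "geodesic_from_to a b \<gamma>" "dist x (\<gamma> t) \<le> R"
    using n by (auto simp: passes_near_def nbhd_range)
  have "dist x ((\<lambda>t. \<gamma> (- t)) (- t)) \<le> R" using g(2) by simp
  then show ?thesis
    using geodesic_from_to_reverse[OF v g(1)] unfolding passes_near_def nbhd_range by blast
qed

text \<open>The halves of a line separate at speed 2 and cannot be asymptotic. In this way the
  distinctness of the vertices of mixed triples follows from \<open>passes_near\<close>.\<close>

lemma geodesic_from_to_neq:
  assumes v: "a \<in> visual_boundary p" and g: "geodesic_from_to a b \<gamma>"
  shows "a \<noteq> b"
proof
  assume "a = b"
  note to = g[unfolded \<open>a = b\<close>[symmetric] geodesic_from_to_iff[OF v v]]
  then have "fellow_travel (\<lambda>t. \<gamma> (- t)) \<gamma>" using ray_to_fellow_travel[OF v] by blast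
  then obtain C where C: "\<And>t. 0 \<le> t \<Longrightarrow> dist (\<gamma> (- t)) (\<gamma> t) \<le> C" by (auto simp: fellow_travel_def)
  define s where "s = \<bar>C\<bar> + 1"
  have s: "0 \<le> s" "C < 2 * s" by (auto simp: s_def)
  have "dist (\<gamma> (- s)) (\<gamma> s) = 2 * s" using to s(1) by (simp add: geodesic_UNIV_iff)
  then show False using C[OF s(1)] s(2) by linarith
qed

lemma passes_near_neq: "a \<in> visual_boundary p \<Longrightarrow> passes_near R x a b \<Longrightarrow> a \<noteq> b"
  unfolding passes_near_def using geodesic_from_to_neq by blast

lemma passes_near_morse_rays:
  assumes ab: "[a, b] \<in> morse_tuples p 2 M" and n: "passes_near R x a b"
  shows "morse_ray_near M R x a \<and> morse_ray_near M R x b"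
proof -
  have v: "a \<in> visual_boundary p" "b \<in> visual_boundary p"
    using ab by (auto simp: morse_pair_iff intro: morse_boundary_visual)
  obtain \<gamma> t where g: "geodesic_from_to a b \<gamma>" "dist x (\<gamma> t) \<le> R"
    using n by (auto simp: passes_near_def nbhd_range)
  have m: "seg_morse M UNIV \<gamma>" using ab g by (simp add: morse_pair_iff)
  note to = g(1)[unfolded geodesic_from_to_iff[OF v]]
  have "ray_to a (\<lambda>s. \<gamma> (t - s))" "ray_to b (\<lambda>s. \<gamma> (t + s))"
    using to by (auto intro: ray_to_reflect ray_to_shift)
  then show ?thesis
    unfolding morse_ray_near_def using seg_morse_UNIV_rays[OF m, of t] g(2) by force
qed

lemma morse_ray_near_mono:
  assumes "morse_ray_near M R x a" "dist x y \<le> D" "R + D \<le> R'"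
  shows "morse_ray_near M R' y a"
  using assms dist_triangle3[of y _ x] unfolding morse_ray_near_def by (smt (verit))

text \<open>Both rays start within \<open>R\<close> of \<open>x\<close>, hence within
  \<open>2 * R\<close> of each other, and \<open>line_between_morse_rays\<close> provides one gauge
  for all lines between all such pairs.\<close>

lemma morse_pair_if_rays_near:
  assumes PG: "proper_geodesic TYPE('a::metric_space)" and M: "M \<in> morse_gauges" and R: "0 \<le> R"
  shows "\<exists>M'\<in>morse_gauges. \<forall>(p::'a) x a b. a \<in> morse_boundary p \<longrightarrow> b \<in> morse_boundary p \<longrightarrow> a \<noteq> b \<longrightarrow>
     morse_ray_near M R x a \<longrightarrow> morse_ray_near M R x b \<longrightarrow> [a, b] \<in> morse_tuples p 2 M'"
proof -
  obtain M' where M': "M' \<in> morse_gauges"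
    and *: "\<And>\<alpha> \<beta> (\<gamma>::real \<Rightarrow> 'a). seg_morse M {0..} \<alpha> \<Longrightarrow> seg_morse M {0..} \<beta> \<Longrightarrow>
      dist (\<alpha> 0) (\<beta> 0) \<le> 2 * R \<Longrightarrow> geodesic UNIV \<gamma> \<Longrightarrow> fellow_travel (\<lambda>t. \<gamma> (- t)) \<alpha> \<Longrightarrow>
      fellow_travel \<gamma> \<beta> \<Longrightarrow> seg_morse M' UNIV \<gamma>"
    using line_between_morse_rays[OF PG M, of "2 * R"] R by auto
  have "seg_morse M' UNIV \<gamma>"
    if ab: "a \<in> morse_boundary p" "b \<in> morse_boundary p" and near: "morse_ray_near M R x a" "morse_ray_near M R x b"
      and g: "geodesic_from_to a b \<gamma>" for p :: 'a and x a b \<gamma>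
  proof -
    have v: "a \<in> visual_boundary p" "b \<in> visual_boundary p" using ab by (auto intro: morse_boundary_visual)
    obtain \<alpha> where \<alpha>: "seg_morse M {0..} \<alpha>" "ray_to a \<alpha>" "dist x (\<alpha> 0) \<le> R"
      using near(1) unfolding morse_ray_near_def by blast
    obtain \<beta> where \<beta>: "seg_morse M {0..} \<beta>" "ray_to b \<beta>" "dist x (\<beta> 0) \<le> R"
      using near(2) unfolding morse_ray_near_def by blast
    have "dist (\<alpha> 0) (\<beta> 0) \<le> 2 * R" using \<alpha>(3) \<beta>(3) dist_triangle3[of "\<alpha> 0" "\<beta> 0" x] by linarith
    moreover note g[unfolded geodesic_from_to_iff[OF v]]
    ultimately show ?thesis
      using *[OF \<alpha>(1) \<beta>(1)] ray_to_fellow_travel[OF v(1) _ \<alpha>(2)] ray_to_fellow_travel[OF v(2) _ \<beta>(2)] by blast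
  qed
  then have "\<forall>(p::'a) x a b. a \<in> morse_boundary p \<longrightarrow> b \<in> morse_boundary p \<longrightarrow> a \<noteq> b \<longrightarrow>
     morse_ray_near M R x a \<longrightarrow> morse_ray_near M R x b \<longrightarrow> [a, b] \<in> morse_tuples p 2 M'"
    unfolding morse_pair_iff by blast
  with M' show ?thesis by blast
qed

lemma morse_pair_sym: "[a, b] \<in> morse_tuples p 2 M \<Longrightarrow> [b, a] \<in> morse_tuples p 2 M"
  unfolding morse_tuples_def by auto

lemma passes_near_alternative:
  fixes p :: "'a::metric_space"
  assumes PG: "proper_geodesic TYPE('a)" and M: "M \<in> morse_gauges"
    and \<kappa>: "triangle_constant p M \<kappa>" "0 \<le> \<kappa>"
    and abc: "a \<in> morse_boundary p" "b \<in> morse_boundary p" "c \<in> morse_boundary p"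
    and pair: "\<And>u v. u \<in> {a, b, c} \<Longrightarrow> v \<in> {a, b, c} \<Longrightarrow> u \<noteq> v \<Longrightarrow> [u, v] \<in> morse_tuples p 2 M"
    and n: "passes_near R x a b" and R': "R + (M (3, 1 + 2 * \<kappa>) + \<kappa>) \<le> R'"
  shows "passes_near R' x a c \<or> passes_near R' x b c"
proof -
  have v: "a \<in> visual_boundary p" "b \<in> visual_boundary p" "c \<in> visual_boundary p"
    using abc by (auto intro: morse_boundary_visual)
  define \<delta> where "\<delta> = M (3, 1 + 2 * \<kappa>) + \<kappa>"
  have "0 \<le> \<delta>" unfolding \<delta>_def using \<kappa>(2) by (intro add_nonneg_nonneg morse_gauge_nonneg[OF M]) auto
  then have n': "passes_near R' x a b" using passes_near_mono[OF n, of x 0] R' by (simp add: \<delta>_def)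
  have ab: "a \<noteq> b" using passes_near_neq[OF v(1) n] .
  consider "c = a" | "c = b" | "c \<noteq> a" "c \<noteq> b" by blast
  then show ?thesis
  proof cases
    case 1 then show ?thesis using passes_near_sym[OF v(1,2) n'] by simp
  next
    case 2 then show ?thesis using n' by simp
  next
    case 3
    then have t: "[a, b, c] \<in> morse_tuples p 3 M" using ab pair by (auto simp: morse_triple_iff)
    obtain \<gamma>1 t where g1: "geodesic_from_to a b \<gamma>1" "dist x (\<gamma>1 t) \<le> R"
      using n by (auto simp: passes_near_def nbhd_range)
    obtain \<gamma>2 where g2: "geodesic_from_to b c \<gamma>2" using line_exists[OF PG abc(2,3)] 3 by blast
    obtain \<gamma>3 where g3: "geodesic_from_to c a \<gamma>3" using line_exists[OF PG abc(3,1)] 3 by blast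
    obtain s where s: "dist (\<gamma>1 t) (\<gamma>2 s) \<le> \<delta> \<or> dist (\<gamma>1 t) (\<gamma>3 s) \<le> \<delta>"
      using thin_ideal_triangle[OF PG M \<kappa>(1) t g1(1) g2 g3] unfolding \<delta>_def by blast
    then have "dist x (\<gamma>2 s) \<le> R' \<or> dist x (\<gamma>3 s) \<le> R'"
      using g1(2) R' dist_triangle[of x "\<gamma>2 s" "\<gamma>1 t"] dist_triangle[of x "\<gamma>3 s" "\<gamma>1 t"]
      by (auto simp: \<delta>_def)
    then have "passes_near R' x b c \<or> passes_near R' x c a"
      using g2 g3 unfolding passes_near_def nbhd_range by blast
    then show ?thesis using passes_near_sym[OF v(3,1)] by blast
  qed
qed

section \<open>Exchange of vertices and displacement of image centers\<close>

lemma diameter_le_dist: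
  fixes S :: "'a::metric_space set"
  assumes "S \<noteq> {}" "\<And>x y. x \<in> S \<Longrightarrow> y \<in> S \<Longrightarrow> dist x y \<le> d"
  shows "diameter S \<le> d"
  unfolding diameter_def using assms by (auto intro!: cSUP_least)

lemma image_morse_pair:
  assumes "map h ` morse_tuples p 2 N \<subseteq> morse_tuples r 2 N'" "[a, b] \<in> morse_tuples p 2 N"
  shows "[h a, h b] \<in> morse_tuples r 2 N'"
  using assms by (metis (no_types, lifting) image_subset_iff list.map(1) list.map(2))

lemma image_morse_triple:
  assumes h: "map h ` morse_tuples p 2 N \<subseteq> morse_tuples r 2 N'" and t: "[a, b, c] \<in> morse_tuples p 3 N"
  shows "[h a, h b, h c] \<in> morse_tuples r 3 N'"
  using t image_morse_pair[OF h] morse_pair_sym unfolding morse_triple_iff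
  by (metis (no_types) morse_pair_iff)

text \<open>Each of \<open>b\<close> and \<open>c\<close> is related to at least two of three
  vertices. Two such pairs share some \<open>u1\<close>, and \<open>c\<close> has a second partner
  \<open>u2\<close>. These relations make \<open>(u1, b, c)\<close> and \<open>(u2, c, u1)\<close>
  pairwise related; nothing is required of the vertex that leaves first.\<close>

lemma exchange_order:
  assumes b: "G b t1 \<or> G b t2" "G b t1 \<or> G b t3" "G b t2 \<or> G b t3"
    and c: "G c t1 \<or> G c t2" "G c t1 \<or> G c t3" "G c t2 \<or> G c t3"
  shows "\<exists>u1 u2 u3. (u1, u2, u3) \<in> {(t1, t2, t3), (t1, t3, t2), (t2, t1, t3), (t2, t3, t1), (t3, t1, t2), (t3, t2, t1)}
     \<and> G b u1 \<and> G c u1 \<and> G c u2"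
proof -
  consider "G c t1" "G c t2" | "G c t1" "G c t3" | "G c t2" "G c t3" using c by blast
  then show ?thesis
  proof cases
    case 1
    then show ?thesis using b(1) by (elim disjE) blast+
  next
    case 2
    then show ?thesis using b(2) by (elim disjE) blast+
  next
    case 3
    then show ?thesis using b(3) by (elim disjE) blast+
  qed
qed

text \<open>A relation instead of a function: it absorbs the choices in a center map, and its
  converse is a relation of the same kind for the inverse homeomorphism.\<close>

definition corresponding_centers ::
  "'a::metric_space \<Rightarrow> gauge \<Rightarrow> ('a bpoint \<Rightarrow> 'b::metric_space bpoint) \<Rightarrow> real \<Rightarrow> 'a \<Rightarrow> 'b \<Rightarrow> bool"
  where
  "corresponding_centers p N h K x y \<longleftrightarrow> (\<exists>a b c. [a, b, c] \<in> morse_tuples p 3 N \<and>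
     x \<in> centers K a b c \<and> y \<in> centers K (h a) (h b) (h c))"

text \<open>Replacing the three vertices one at a time, all intermediate triples keep a common center in
  \<open>X\<close>, so each step has a bounded cross-ratio.\<close>

lemma image_centers_close:
  fixes p :: "'a::metric_space" and r :: "'b::metric_space"
  assumes PG: "proper_geodesic TYPE('a)" "proper_geodesic TYPE('b)"
    and \<kappa>: "\<And>M. M \<in> morse_gauges \<Longrightarrow> 0 < \<kappa> M \<and> triangle_constant p M (\<kappa> M) \<and> triangle_constant r M (\<kappa> M)"
    and stable: "two_stable p r h" and moebius: "quasi_moebius \<kappa> p r h"
    and M: "M \<in> morse_gauges" and K: "0 \<le> K" and D: "0 \<le> D"
  shows "\<exists>C. \<forall>x x' y y'. corresponding_centers p M h K x y \<longrightarrow> corresponding_centers p M h K x' y' \<longrightarrow>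
    dist x x' \<le> D \<longrightarrow> dist y y' \<le> C"
proof -
  obtain M' where M': "M' \<in> morse_gauges"
    and pairs: "\<And>x a b. a \<in> morse_boundary p \<Longrightarrow> b \<in> morse_boundary p \<Longrightarrow> a \<noteq> b \<Longrightarrow>
      morse_ray_near M (K + D) x a \<Longrightarrow> morse_ray_near M (K + D) x b \<Longrightarrow> [a, b] \<in> morse_tuples p 2 M'"
    using morse_pair_if_rays_near[OF PG(1) M, of "K + D"] K D by auto
  \<comment> \<open>The alternative is applied only to lines that pass within \<open>K + D\<close>
    of \<open>x\<close>, never to its own output, so a single enlargement is enough.\<close>
  define R where "R = K + D + (M' (3, 1 + 2 * \<kappa> M') + \<kappa> M')"
  have \<kappa>M': "0 < \<kappa> M'" "triangle_constant p M' (\<kappa> M')" using \<kappa>[OF M'] by auto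
  have "0 \<le> M' (3, 1 + 2 * \<kappa> M')" using \<kappa>M'(1) by (intro morse_gauge_nonneg[OF M']) auto
  then have R: "K + D \<le> R" "0 \<le> R" using K D \<kappa>M'(1) by (auto simp: R_def)
  obtain N' where N': "N' \<in> morse_gauges" "map h ` morse_tuples p 2 M' \<subseteq> morse_tuples r 2 N'"
    using stable M' unfolding two_stable_def by blast
  obtain \<psi> where \<psi>: "mono_on {0..} \<psi>" "\<And>a b c d. [a, b, c, d] \<in> morse_tuples p 4 M' \<Longrightarrow>
      cross_ratio \<kappa> N' (h a) (h b) (h c) (h d) \<le> \<psi> (cross_ratio \<kappa> M' a b c d)"
    using moebius M' N' unfolding quasi_moebius_def by blast
  have \<kappa>N': "0 < \<kappa> N'" "triangle_constant r N' (\<kappa> N')" using \<kappa>[OF N'(1)] by auto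
  \<comment> \<open>Cross-ratios are formed from \<kappa>-centers, while \<open>x\<close> is an
    \<open>R\<close>-center and \<open>y\<close> a \<open>K\<close>-center; the maxima put both
    kinds into one bounded set.\<close>
  have "0 \<le> max R (\<kappa> M')" "0 \<le> max K (\<kappa> N')" using R K by auto
  from centers_bounded[OF PG(1) M' this(1)] centers_bounded[OF PG(2) N'(1) this(2)]
  obtain BX BY where BXY: "\<forall>(p::'a) a b c. [a, b, c] \<in> morse_tuples p 3 M' \<longrightarrow>
        (\<forall>x\<in>centers (max R (\<kappa> M')) a b c. \<forall>y\<in>centers (max R (\<kappa> M')) a b c. dist x y \<le> BX)"
      "\<forall>(r::'b) a b c. [a, b, c] \<in> morse_tuples r 3 N' \<longrightarrow>
        (\<forall>x\<in>centers (max K (\<kappa> N')) a b c. \<forall>y\<in>centers (max K (\<kappa> N')) a b c. dist x y \<le> BY)"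
    by blast
  have BX: "dist x y \<le> BX" if "[a, b, c] \<in> morse_tuples p 3 M'"
      "x \<in> centers (max R (\<kappa> M')) a b c" "y \<in> centers (max R (\<kappa> M')) a b c" for a b c x y
    using BXY(1) that by blast
  have BY: "dist x y \<le> BY" if "[a, b, c] \<in> morse_tuples r 3 N'"
      "x \<in> centers (max K (\<kappa> N')) a b c" "y \<in> centers (max K (\<kappa> N')) a b c" for a b c x y
    using BXY(2) that by blast
  note img = image_morse_triple[OF N'(2)]
  define C where "C = max BY (\<psi> (2 * BX))"
  have step: "dist z z' \<le> C"
    if t: "[u, v, w] \<in> morse_tuples p 3 M'" "[u', v, w] \<in> morse_tuples p 3 M'"
      and pair: "u \<noteq> u' \<Longrightarrow> [u, u'] \<in> morse_tuples p 2 M'"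
      and x: "x \<in> centers R u v w" "x \<in> centers R u' v w"
      and z: "z \<in> centers (\<kappa> N') (h u) (h v) (h w)" "z' \<in> centers (\<kappa> N') (h u') (h v) (h w)"
    for u u' v w x z z'
  proof (cases "u = u'")
    case True
    have "centers (\<kappa> N') (h u) (h v) (h w) \<subseteq> centers (max K (\<kappa> N')) (h u) (h v) (h w)"
      by (rule centers_mono) simp
    then have "dist z z' \<le> BY" using BY[OF img[OF t(1)]] z True by blast
    then show ?thesis by (simp add: C_def)
  next
    case False
    \<comment> \<open>A cross-ratio compares triples that differ in the middle entry, whence the
      order \<open>v\<close>, \<open>u\<close>, \<open>w\<close>, \<open>u'\<close>. All of
      \<open>S\<close> lies within \<open>BX\<close> of the common center \<open>x\<close>.\<close>
    define S where "S = centers (\<kappa> M') v u w \<union> centers (\<kappa> M') v u' w"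
    define S' where "S' = centers (\<kappa> N') (h v) (h u) (h w) \<union> centers (\<kappa> N') (h v) (h u') (h w)"
    have vX: "u \<in> visual_boundary p" "u' \<in> visual_boundary p" "v \<in> visual_boundary p" "w \<in> visual_boundary p"
      using morse_triple_boundary[OF t(1)] morse_triple_boundary[OF t(2)] by blast+
    have vY: "h u \<in> visual_boundary r" "h u' \<in> visual_boundary r" "h v \<in> visual_boundary r" "h w \<in> visual_boundary r"
      using morse_triple_boundary[OF img[OF t(1)]] morse_triple_boundary[OF img[OF t(2)]] by blast+
    have S: "S = centers (\<kappa> M') u v w \<union> centers (\<kappa> M') u' v w"
      unfolding S_def using centers_swap[OF vX(3,1,4)] centers_swap[OF vX(3,2,4)] by simp
    have S': "S' = centers (\<kappa> N') (h u) (h v) (h w) \<union> centers (\<kappa> N') (h u') (h v) (h w)"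
      unfolding S'_def using centers_swap[OF vY(3,1,4)] centers_swap[OF vY(3,2,4)] by simp
    have near: "dist x q \<le> BX" if "q \<in> S" for q
    proof -
      have "centers R a b c \<subseteq> centers (max R (\<kappa> M')) a b c"
        "centers (\<kappa> M') a b c \<subseteq> centers (max R (\<kappa> M')) a b c" for a b c :: "'a bpoint"
        by (rule centers_mono; simp)+
      then show ?thesis using that x BX[OF t(1)] BX[OF t(2)] unfolding S by blast
    qed
    have Sne: "S \<noteq> {}" using centers_nonempty[OF PG(1) t(1) \<kappa>M'(2)] by (auto simp: S)
    have SBX: "dist q q' \<le> 2 * BX" if "q \<in> S" "q' \<in> S" for q q'
      using near[OF that(1)] near[OF that(2)] dist_triangle3[of q q' x] by linarith
    have "diameter S \<le> 2 * BX" using Sne SBX by (rule diameter_le_dist)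
    moreover have "bounded S" unfolding bounded_def using near by blast
    then have "0 \<le> diameter S" by (rule diameter_ge_0)
    ultimately have "\<psi> (diameter S) \<le> \<psi> (2 * BX)" using \<psi>(1) by (intro mono_onD[OF \<psi>(1)]) auto
    moreover have "[v, u, w, u'] \<in> morse_tuples p 4 M'"
      using t pair[OF False] unfolding morse_quadruple_iff morse_triple_iff by (blast intro: morse_pair_sym)
    from \<psi>(2)[OF this] have "diameter S' \<le> \<psi> (diameter S)"
      unfolding cross_ratio_def S_def S'_def .
    \<comment> \<open>Only for a bounded set does the real-valued \<open>diameter\<close> bound the
      distances.\<close>
    moreover have "bounded S'"
    proof -
      have "bounded (centers (\<kappa> N') a b c)" if "[a, b, c] \<in> morse_tuples r 3 N'" for a b c
      proof (cases "centers (\<kappa> N') a b c = {}")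
        case False
        then obtain q where q: "q \<in> centers (\<kappa> N') a b c" by blast
        have "centers (\<kappa> N') a b c \<subseteq> centers (max K (\<kappa> N')) a b c" by (rule centers_mono) simp
        then have "\<forall>q'\<in>centers (\<kappa> N') a b c. dist q q' \<le> BY" using BY[OF that] q by blast
        then show ?thesis unfolding bounded_def by blast
      qed simp
      then show ?thesis unfolding S' using img t by simp
    qed
    then have "dist z z' \<le> diameter S'" using z unfolding S' by (intro diameter_bounded_bound) auto
    ultimately show ?thesis by (simp add: C_def)
  qed
  \<comment> \<open>Three exchanges, and at either end the passage between a \<open>K\<close>-center
    and a \<kappa>-center of the same triple.\<close>
  have "dist y y' \<le> 2 * BY + 3 * C"
    if t: "[a, b, c] \<in> morse_tuples p 3 M" and t': "[a', b', c'] \<in> morse_tuples p 3 M"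
      and x: "x \<in> centers K a b c" and x': "x' \<in> centers K a' b' c'" and d: "dist x x' \<le> D"
      and y: "y \<in> centers K (h a) (h b) (h c)" and y': "y' \<in> centers K (h a') (h b') (h c')"
    for a b c a' b' c' x x' y y'
  proof -
    define Z where "Z = {a, b, c, a', b', c'}"
    have Z: "u \<in> morse_boundary p" if "u \<in> Z" for u
      using that morse_triple_boundary[OF t] morse_triple_boundary[OF t'] unfolding Z_def by blast
    then have vZ: "u \<in> visual_boundary p" if "u \<in> Z" for u using that by (auto intro: morse_boundary_visual)
    have n: "passes_near K x a b" "passes_near K x b c" "passes_near K x c a"
      using x by (auto simp: centers_iff_passes_near)
    have n': "passes_near K x' a' b'" "passes_near K x' b' c'" "passes_near K x' c' a'"
      using x' by (auto simp: centers_iff_passes_near)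
    have "morse_ray_near M K x a" "morse_ray_near M K x b" "morse_ray_near M K x c"
      "morse_ray_near M K x' a'" "morse_ray_near M K x' b'" "morse_ray_near M K x' c'"
      using t t' n n' passes_near_morse_rays unfolding morse_triple_iff by blast+
    then have "morse_ray_near M (K + D) x u" if "u \<in> Z" for u
      using that d D morse_ray_near_mono[of M K x _ x 0 "K + D"] morse_ray_near_mono[of M K x' _ x D "K + D"]
      by (auto simp: Z_def dist_commute)
    then have pair: "[u, v] \<in> morse_tuples p 2 M'" if "u \<in> Z" "v \<in> Z" "u \<noteq> v" for u v
      using that pairs Z by blast
    define G where "G = passes_near R x"
    have Gsym: "G v u" if "G u v" "u \<in> Z" "v \<in> Z" for u v
      using that passes_near_sym[OF vZ vZ] unfolding G_def by blast
    have Gneq: "u \<noteq> v" if "G u v" "u \<in> Z" for u v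
      using that passes_near_neq[OF vZ] unfolding G_def by blast
    have near: "passes_near (K + D) x a b" "passes_near (K + D) x b c" "passes_near (K + D) x c a"
      "passes_near (K + D) x a' b'" "passes_near (K + D) x b' c'" "passes_near (K + D) x c' a'"
      using n n' D d passes_near_mono[of K x _ _ x 0 "K + D"] passes_near_mono[of K x' _ _ x D "K + D"]
      by (auto simp: dist_commute)
    have Gs: "G a b" "G b c" "G c a" "G a' b'" "G b' c'" "G c' a'"
      unfolding G_def using near passes_near_mono[of "K + D" x _ _ x 0 R] R by auto
    have alt: "G w u \<or> G w v" if "passes_near (K + D) x u v" "u \<in> Z" "v \<in> Z" "w \<in> Z" for u v w
    proof -
      have "passes_near R x u w \<or> passes_near R x v w"
        by (rule passes_near_alternative[OF PG(1) M' \<kappa>M'(2) _ Z Z Z _ that(1)])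
          (use that pair \<kappa>M'(1) R_def in auto)
      then show ?thesis using Gsym that(2-4) unfolding G_def by blast
    qed
    have mem: "a \<in> Z" "b \<in> Z" "c \<in> Z" "a' \<in> Z" "b' \<in> Z" "c' \<in> Z" by (auto simp: Z_def)
    note alt1 = alt[OF near(4) mem(4,5)] and alt2 = alt[OF near(5) mem(5,6)] and alt3 = alt[OF near(6) mem(6,4)]
    have "\<exists>u1 u2 u3. (u1, u2, u3) \<in> {(a', b', c'), (a', c', b'), (b', a', c'), (b', c', a'), (c', a', b'), (c', b', a')}
      \<and> G b u1 \<and> G c u1 \<and> G c u2"
      using alt1[OF mem(2)] alt2[OF mem(2)] alt3[OF mem(2)] alt1[OF mem(3)] alt2[OF mem(3)] alt3[OF mem(3)]
      by (intro exchange_order) (simp_all only: disj_commute)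
    then obtain u1 u2 u3 where u: "(u1, u2, u3) \<in> {(a', b', c'), (a', c', b'), (b', a', c'), (b', c', a'), (c', a', b'), (c', b', a')}"
      and G: "G b u1" "G c u1" "G c u2"
      by (elim exE conjE)
    have uZ: "u1 \<in> Z" "u2 \<in> Z" "u3 \<in> Z" using u by (auto simp: Z_def)
    have Gs': "G b' a'" "G c' b'" "G a' c'" using Gs(4-6) Gsym mem by blast+
    have Gu: "G u1 u2" "G u2 u3" "G u3 u1" using u Gs(4-6) Gs' by auto
    have G': "G u1 b" "G u1 c" "G u2 c" using G Gsym mem uZ by blast+
    have triple: "[u, v, w] \<in> morse_tuples p 3 M' \<and> x \<in> centers R u v w"
      if "G u v" "G v w" "G w u" "u \<in> Z" "v \<in> Z" "w \<in> Z" for u v w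
    proof -
      have "u \<noteq> v" "v \<noteq> w" "w \<noteq> u" using that Gneq by blast+
      then show ?thesis
        using that pair unfolding morse_triple_iff centers_iff_passes_near G_def by blast
    qed
    \<comment> \<open>\<open>step\<close> always replaces the first vertex, so the intermediate
      triples are also needed in rotated form: \<open>T1'\<close> and \<open>T2'\<close> are
      rotations of \<open>T1\<close> and \<open>T2\<close>.\<close>
    note T0 = triple[OF Gs(1-3) mem(1-3)]
    note T1 = triple[OF G'(1) Gs(2) G(2) uZ(1) mem(2,3)]
    note T1' = triple[OF Gs(2) G(2) G'(1) mem(2,3) uZ(1)]
    note T2 = triple[OF G'(3) G(2) Gu(1) uZ(2) mem(3) uZ(1)]
    note T2' = triple[OF G(2) Gu(1) G'(3) mem(3) uZ(1,2)]
    note T3 = triple[OF Gu(3,1,2) uZ(3,1,2)]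
    have T4: "[a', b', c'] \<in> morse_tuples p 3 M'" using triple[OF Gs(4-6) mem(4-6)] by blast
    have ne: "\<exists>z. z \<in> centers (\<kappa> N') (h u) (h v) (h w)" if "[u, v, w] \<in> morse_tuples p 3 M'" for u v w
      using centers_nonempty[OF PG(2) img[OF that] \<kappa>N'(2)] by blast
    have wide: "centers K a b c \<subseteq> centers (max K (\<kappa> N')) a b c"
        "centers (\<kappa> N') a b c \<subseteq> centers (max K (\<kappa> N')) a b c" for a b c :: "'b bpoint"
      by (rule centers_mono; simp)+
    obtain z0 where z0: "z0 \<in> centers (\<kappa> N') (h a) (h b) (h c)" using ne T0 by blast
    obtain z1 where z1: "z1 \<in> centers (\<kappa> N') (h u1) (h b) (h c)" using ne T1 by blast
    obtain z2 where z2: "z2 \<in> centers (\<kappa> N') (h u2) (h c) (h u1)" using ne T2 by blast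
    obtain z3 where z3: "z3 \<in> centers (\<kappa> N') (h u3) (h u1) (h u2)" using ne T3 by blast
    have "dist z0 z1 \<le> C"
      using step[of a b c u1 x z0 z1] T0 T1 pair[OF mem(1) uZ(1)] z0 z1 by blast
    moreover have "z1 \<in> centers (\<kappa> N') (h b) (h c) (h u1)" using z1 centers_rotate by blast
    then have "dist z1 z2 \<le> C"
      using step[of b c u1 u2 x z1 z2] T1' T2 pair[OF mem(2) uZ(2)] z2 by blast
    moreover have "z2 \<in> centers (\<kappa> N') (h c) (h u1) (h u2)" using z2 centers_rotate by blast
    then have "dist z2 z3 \<le> C"
      using step[of c u1 u2 u3 x z2 z3] T2' T3 pair[OF mem(3) uZ(3)] z3 by blast
    moreover have "dist y z0 \<le> BY"
      using BY[OF img, of a b c y z0] T0 y z0 wide by blast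
    moreover have "dist z3 y' \<le> BY"
    proof -
      have v: "h a' \<in> visual_boundary r" "h b' \<in> visual_boundary r" "h c' \<in> visual_boundary r"
        using morse_triple_boundary[OF img[OF T4]] by blast+
      have "centers k (h u3) (h u1) (h u2) = centers k (h a') (h b') (h c')" for k
        using u centers_rotate[of k "h a'" "h b'" "h c'"] centers_rotate[of k "h b'" "h c'" "h a'"]
          centers_swap[OF v, of k] centers_rotate[of k "h b'" "h a'" "h c'"] centers_rotate[of k "h a'" "h c'" "h b'"]
        by auto
      then have "z3 \<in> centers (\<kappa> N') (h a') (h b') (h c')" using z3 by simp
      then show ?thesis
        using BY[OF img[OF T4], of z3 y'] y' wide by blast
    qed
    moreover have "dist y y' \<le> dist y z0 + dist z0 z1 + dist z1 z2 + dist z2 z3 + dist z3 y'"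
      using dist_triangle[of y y' z0] dist_triangle[of z0 y' z1] dist_triangle[of z1 y' z2] dist_triangle[of z2 y' z3]
      by linarith
    ultimately show ?thesis by linarith
  qed
  then show ?thesis unfolding corresponding_centers_def by blast
qed

section \<open>The center map\<close>

text \<open>A geodesic is traversed in steps of length at most 1; the additive \<open>C\<close> pays
  for rounding the length up.\<close>

lemma coarsely_lipschitz:
  fixes f :: "'a::metric_space \<Rightarrow> 'b::metric_space"
  assumes PG: "proper_geodesic TYPE('a)" and C: "\<And>x y. dist x y \<le> 1 \<Longrightarrow> dist (f x) (f y) \<le> C"
  shows "dist (f x) (f y) \<le> C * dist x y + C"
proof -
  have C0: "0 \<le> C" using C[of x x] by simp
  have *: "dist (f x) (f y) \<le> C * real n" if "dist x y \<le> real n" for n x y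
    using that
  proof (induction n arbitrary: y)
    case (Suc n)
    define d where "d = min (dist x y) (real n)"
    obtain \<eta> :: "real \<Rightarrow> 'a" where \<eta>: "\<eta> 0 = x" "\<eta> (dist x y) = y"
        "\<forall>s\<in>{0..dist x y}. \<forall>t\<in>{0..dist x y}. dist (\<eta> s) (\<eta> t) = \<bar>s - t\<bar>"
      using geodesic_segment_exists[OF PG] by blast
    have d: "d \<in> {0..dist x y}" by (auto simp: d_def)
    have "dist (\<eta> 0) (\<eta> d) = \<bar>0 - d\<bar>" "dist (\<eta> d) (\<eta> (dist x y)) = \<bar>d - dist x y\<bar>"
      using \<eta>(3) d by (metis atLeastAtMost_iff order_refl zero_le_dist)+
    then have "dist x (\<eta> d) \<le> real n" "dist (\<eta> d) y \<le> 1"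
      using \<eta>(1,2) d Suc.prems by (auto simp: d_def)
    then have "dist (f x) (f (\<eta> d)) \<le> C * real n" "dist (f (\<eta> d)) (f y) \<le> C"
      using Suc.IH C by auto
    then show ?case using dist_triangle[of "f x" "f y" "f (\<eta> d)"] by (simp add: algebra_simps)
  qed simp
  have "dist (f x) (f y) \<le> C * real (nat \<lceil>dist x y\<rceil>)" by (rule *) linarith
  also have "real (nat \<lceil>dist x y\<rceil>) \<le> dist x y + 1" using zero_le_dist[of x y] by linarith
  then have "C * real (nat \<lceil>dist x y\<rceil>) \<le> C * (dist x y + 1)" using C0 by (rule mult_left_mono)
  finally show ?thesis by (simp add: algebra_simps)
qed

text \<open>The lower bound for \<open>f\<close> is the upper bound for \<open>g\<close> read
  backwards. Dividing it by \<open>l = C + 1\<close> leaves an additive error of at most 3, and the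
  \<open>l\<close> in \<open>l + 3\<close> absorbs the additive constant of the upper bound.\<close>

lemma quasi_isometry_if_coarse_inverse:
  fixes f :: "'a::metric_space \<Rightarrow> 'b::metric_space"
  assumes PG: "proper_geodesic TYPE('a)" "proper_geodesic TYPE('b)"
    and f: "\<And>x y. dist x y \<le> 1 \<Longrightarrow> dist (f x) (f y) \<le> C"
    and g: "\<And>x y. dist x y \<le> 1 \<Longrightarrow> dist (g x) (g y) \<le> C"
    and gf: "\<And>x. dist (g (f x)) x \<le> C" and fg: "\<And>y. dist (f (g y)) y \<le> C"
  shows "quasi_isometry f"
  unfolding quasi_isometry_def
proof (intro conjI)
  have C0: "0 \<le> C" using f[of undefined undefined] by simp
  define l where "l = C + 1"
  have l: "1 \<le> l" "C \<le> l" using C0 by (auto simp: l_def)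
  have "qi_embedding_on UNIV l (l + 3) f"
    unfolding qi_embedding_on_def
  proof (intro conjI ballI)
    show "1 \<le> l" "0 \<le> l + 3" using l by auto
    fix x y
    have "dist (f x) (f y) \<le> C * dist x y + C" using coarsely_lipschitz[OF PG(1) f] .
    also have "\<dots> \<le> l * dist x y + (l + 3)" using l by (intro add_mono mult_right_mono) auto
    finally show "dist (f x) (f y) \<le> l * dist x y + (l + 3)" .
    have "dist x y \<le> dist (g (f x)) x + dist (g (f x)) (g (f y)) + dist (g (f y)) y"
      by (smt (verit) dist_triangle dist_commute)
    also have "\<dots> \<le> C * dist (f x) (f y) + 3 * C"
      using gf[of x] gf[of y] coarsely_lipschitz[where f = g, OF PG(2) g, of "f x" "f y"] by linarith
    also have "\<dots> \<le> l * (dist (f x) (f y) + 3)"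
      using l mult_right_mono[OF l(2), of "dist (f x) (f y)"] by (simp add: algebra_simps)
    finally have "dist x y / l \<le> dist (f x) (f y) + 3" using l by (simp add: divide_le_eq mult.commute)
    then show "1 / l * dist x y - (l + 3) \<le> dist (f x) (f y)" using l by simp
  qed
  then show "\<exists>l e. qi_embedding_on UNIV l e f" by blast
  show "\<exists>g D. 0 \<le> D \<and> (\<forall>x. dist (g (f x)) x \<le> D) \<and> (\<forall>y. dist (f (g y)) y \<le> D)"
    using C0 gf fg by blast
qed

lemma quasi_isometry_close:
  fixes f f' :: "'a::metric_space \<Rightarrow> 'b::metric_space"
  assumes f: "quasi_isometry f" and E: "\<And>x. dist (f x) (f' x) \<le> E"
  shows "quasi_isometry f'"
proof -
  obtain l e where q: "qi_embedding_on UNIV l e f" using f unfolding quasi_isometry_def by blast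
  then have l: "1 \<le> l" and e: "0 \<le> e"
    and f_lo: "\<And>x y. 1 / l * dist x y - e \<le> dist (f x) (f y)"
    and f_up: "\<And>x y. dist (f x) (f y) \<le> l * dist x y + e"
    unfolding qi_embedding_on_def by blast+
  obtain g D where D: "0 \<le> D" "\<And>x. dist (g (f x)) x \<le> D" "\<And>y. dist (f (g y)) y \<le> D"
    using f unfolding quasi_isometry_def by blast
  have E0: "0 \<le> E" using order_trans[OF zero_le_dist E] .
  have near: "dist (f' x) (f' y) \<le> dist (f x) (f y) + 2 * E" "dist (f x) (f y) \<le> dist (f' x) (f' y) + 2 * E" for x y
    using E[of x] E[of y] by (smt (verit) dist_triangle dist_commute)+
  have "qi_embedding_on UNIV l (e + 2 * E) f'"
    unfolding qi_embedding_on_def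
  proof (intro conjI ballI)
    show "1 \<le> l" "0 \<le> e + 2 * E" using l e E0 by auto
    fix x y
    show "1 / l * dist x y - (e + 2 * E) \<le> dist (f' x) (f' y)" using f_lo[of x y] near[of x y] by linarith
    show "dist (f' x) (f' y) \<le> l * dist x y + (e + 2 * E)" using f_up[of x y] near[of x y] by linarith
  qed
  \<comment> \<open>Nothing is known about how \<open>g\<close> distorts distances, so
    \<open>g (f' x)\<close> and \<open>x\<close> are compared through their images under
    \<open>f\<close>, and the lower bound for \<open>f\<close> carries the estimate back.\<close>
  moreover have "dist (g (f' x)) x \<le> l * (D + E + e)" for x
  proof -
    have "dist (f (g (f' x))) (f x) \<le> D + E"
      using D(3)[of "f' x"] E[of x] dist_triangle2[of "f (g (f' x))" "f x" "f' x"] by linarith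
    then have "dist (g (f' x)) x / l \<le> D + E + e" using f_lo[of "g (f' x)" x] by simp
    then show ?thesis using l by (simp add: divide_le_eq mult.commute)
  qed
  moreover have "dist (f' (g y)) y \<le> D + E" for y
    using D(3)[of y] E[of "g y"] dist_triangle3[of "f' (g y)" y "f (g y)"] by linarith
  moreover have "0 \<le> l * (D + E + e)" "0 \<le> D + E" using l e E0 D(1) by auto
  ultimately show ?thesis
    unfolding quasi_isometry_def by (meson max.cobounded1 max.cobounded2 order_trans)
qed

section \<open>Correspondence of centers under the homeomorphism and its inverse\<close>

lemma two_stable_triples:
  assumes "two_stable p r h" "N \<in> morse_gauges"
  shows "\<exists>N'\<in>morse_gauges. map h ` morse_tuples p 3 N \<subseteq> morse_tuples r 3 N'"
proof -
  obtain N' where N': "N' \<in> morse_gauges" "map h ` morse_tuples p 2 N \<subseteq> morse_tuples r 2 N'"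
    using assms unfolding two_stable_def by blast
  have "map h v \<in> morse_tuples r 3 N'" if "v \<in> morse_tuples p 3 N" for v
  proof -
    have "length v = 3" using that by (simp add: morse_tuples_def)
    then obtain a b c where "v = [a, b, c]" by (auto simp: length_Suc_conv numeral_3_eq_3)
    then show ?thesis using image_morse_triple[OF N'(2)] that by simp
  qed
  with N'(1) show ?thesis by blast
qed

lemma morse_triple_mono:
  assumes "[a, b, c] \<in> morse_tuples p 3 M" "M \<le> M'"
  shows "[a, b, c] \<in> morse_tuples p 3 M'"
  using assms seg_morse_mono[of M UNIV _ M'] unfolding morse_triple_iff morse_pair_iff le_fun_def by blast

lemma corresponding_centers_mono:
  "corresponding_centers p N h K x y \<Longrightarrow> N \<le> M \<Longrightarrow> corresponding_centers p M h K x y"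
  unfolding corresponding_centers_def using morse_triple_mono by blast

text \<open>The same two triangles witness the converse relation; only the gauge changes, to one
  that serves the image triples.\<close>

lemma corresponding_centers_inverse:
  assumes "corresponding_centers p N h K x y" "map h ` morse_tuples p 3 N \<subseteq> morse_tuples r 3 M"
    and inv: "\<And>a. a \<in> morse_boundary p \<Longrightarrow> h' (h a) = a"
  shows "corresponding_centers r M h' K y x"
proof -
  obtain a b c where x: "[a, b, c] \<in> morse_tuples p 3 N" "x \<in> centers K a b c" "y \<in> centers K (h a) (h b) (h c)"
    using assms(1) unfolding corresponding_centers_def by blast
  have "[h a, h b, h c] \<in> morse_tuples r 3 M" using assms(2) imageI[OF x(1), of "map h"] by auto
  moreover have "x \<in> centers K (h' (h a)) (h' (h b)) (h' (h c))"
    using x(2) morse_triple_boundary(1-3)[OF x(1)] by (simp add: inv)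
  ultimately show ?thesis using x(3) unfolding corresponding_centers_def by blast
qed

lemma corresponding_centers_exist:
  fixes p :: "'a::metric_space" and r :: "'b::metric_space"
  assumes PG: "proper_geodesic TYPE('b)" and cover: "centers_cover p N K"
    and h: "map h ` morse_tuples p 3 N \<subseteq> morse_tuples r 3 N'"
    and \<kappa>: "triangle_constant r N' \<kappa>" "\<kappa> \<le> K"
  shows "\<exists>y. corresponding_centers p N h K x y"
proof -
  have "x \<in> \<Union>{centers K a b c | a b c. [a, b, c] \<in> morse_tuples p 3 N}"
    using cover unfolding centers_cover_def by blast
  then obtain a b c where abc: "[a, b, c] \<in> morse_tuples p 3 N" "x \<in> centers K a b c" by blast
  have "[h a, h b, h c] \<in> morse_tuples r 3 N'" using h imageI[OF abc(1), of "map h"] by auto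
  then show ?thesis
    using centers_nonempty[OF PG _ \<kappa>] abc unfolding corresponding_centers_def by blast
qed

lemma center_map_iff:
  "center_map p r N h K f \<longleftrightarrow> f p = r \<and> (\<forall>x. x \<noteq> p \<longrightarrow> corresponding_centers p N h K x (f x))"
  by (simp add: center_map_def corresponding_centers_def)

text \<open>The value at \<open>p\<close> is replaced by a corresponding center, so that the argument is uniform in all
  points; this changes the map by a bounded amount. A quasi-inverse is a center map of \<open>h'\<close>.\<close>

theorem theorem4p3:
  fixes p :: "'a::metric_space" and r :: "'b::metric_space"
    and \<kappa> :: "gauge \<Rightarrow> real"
    and h :: "'a bpoint \<Rightarrow> 'b bpoint" and h' :: "'b bpoint \<Rightarrow> 'a bpoint"
    and N N\<^sub>h :: gauge and K\<^sub>0 :: real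
  assumes "proper_geodesic TYPE('a)" and "proper_geodesic TYPE('b)"
    and "\<And>M. M \<in> morse_gauges \<Longrightarrow> 0 < \<kappa> M \<and> triangle_constant p M (\<kappa> M) \<and> triangle_constant r M (\<kappa> M)"
    and "morse_center_space p" and "morse_center_space r"
    and "small_cross_ratio_property \<kappa> p" and "small_cross_ratio_property \<kappa> r"
    and "homeomorphic_maps (morse_topology p) (morse_topology r) h h'"
    and "two_stable p r h" and "quasi_moebius \<kappa> p r h"
    and "two_stable r p h'" and "quasi_moebius \<kappa> r p h'"
    and "N \<in> morse_gauges" and "0 < K\<^sub>0"
    and "\<And>K. K\<^sub>0 \<le> K \<Longrightarrow> centers_cover p N K \<and> centers_cover r N K"
    and "N\<^sub>h \<in> morse_gauges" and "N \<le> N\<^sub>h"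
    and "map h ` morse_tuples p 3 N \<subseteq> morse_tuples r 3 N\<^sub>h"
  shows "\<exists>K\<^sub>1\<ge>max K\<^sub>0 (\<kappa> N\<^sub>h). \<forall>K\<ge>K\<^sub>1.
           (\<exists>f. center_map p r N h K f) \<and> (\<forall>f. center_map p r N h K f \<longrightarrow> quasi_isometry f)"
proof -
  note PG = assms(1,2) and \<kappa> = assms(3)
  obtain N' where N': "N' \<in> morse_gauges" "map h' ` morse_tuples r 3 N \<subseteq> morse_tuples p 3 N'"
    using two_stable_triples[OF assms(11,13)] by blast
  \<comment> \<open>A single gauge for both directions: the triples behind \<open>f1\<close> and
    \<open>g\<close> have gauge \<open>N\<close>, the converse relations have gauges
    \<open>N\<^sub>h\<close> and \<open>N'\<close>.\<close>
  obtain M where M: "M \<in> morse_gauges" "N\<^sub>h \<le> M" "N' \<le> M" using morse_gauge_bound assms(16) N'(1) by blast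
  have NM: "N \<le> M" using assms(17) M(2) by (rule order_trans)
  have inv: "h' (h a) = a" if "a \<in> morse_boundary p" for a
    using assms(8) that by (simp add: homeomorphic_maps_def topspace_morse_topology)
  have inv': "h (h' a) = a" if "a \<in> morse_boundary r" for a
    using assms(8) that by (simp add: homeomorphic_maps_def topspace_morse_topology)
  have \<kappa>': "0 < \<kappa> M \<and> triangle_constant r M (\<kappa> M) \<and> triangle_constant p M (\<kappa> M)" if "M \<in> morse_gauges" for M
    using \<kappa>[OF that] by blast
  have "(\<exists>f. center_map p r N h K f) \<and> (\<forall>f. center_map p r N h K f \<longrightarrow> quasi_isometry f)"
    if K: "max K\<^sub>0 (max (\<kappa> N\<^sub>h) (\<kappa> N')) \<le> K" for K
  proof -
    have K0: "0 \<le> K" using K assms(14) by simp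
    have cover: "centers_cover p N K" "centers_cover r N K" using assms(15) K by auto
    have K\<kappa>: "\<kappa> N\<^sub>h \<le> K" "\<kappa> N' \<le> K" using K by auto
    have tri: "triangle_constant r N\<^sub>h (\<kappa> N\<^sub>h)" "triangle_constant p N' (\<kappa> N')"
      using \<kappa>[OF assms(16)] \<kappa>[OF N'(1)] by blast+
    obtain f0 where f0: "\<And>x. corresponding_centers p N h K x (f0 x)"
      using corresponding_centers_exist[OF PG(2) cover(1) assms(18) tri(1) K\<kappa>(1)] by metis
    obtain g where g: "\<And>y. corresponding_centers r N h' K y (g y)"
      using corresponding_centers_exist[OF PG(1) cover(2) N'(2) tri(2) K\<kappa>(2)] by metis
    obtain C1 where C1: "\<And>x x' y y'. corresponding_centers p M h K x y \<Longrightarrow> corresponding_centers p M h K x' y' \<Longrightarrow>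
        dist x x' \<le> 1 \<Longrightarrow> dist y y' \<le> C1"
      using image_centers_close[OF PG \<kappa> assms(9,10) M(1) K0 zero_le_one] by blast
    obtain C2 where C2: "\<And>x x' y y'. corresponding_centers r M h' K x y \<Longrightarrow> corresponding_centers r M h' K x' y' \<Longrightarrow>
        dist x x' \<le> 1 \<Longrightarrow> dist y y' \<le> C2"
      using image_centers_close[OF PG(2,1) \<kappa>' assms(11,12) M(1) K0 zero_le_one] by blast
    show ?thesis
    proof (intro conjI allI impI)
      have "center_map p r N h K (f0(p := r))" using f0 by (simp add: center_map_iff)
      then show "\<exists>f. center_map p r N h K f" by blast
      fix f assume f: "center_map p r N h K f"
      define f1 where "f1 = f(p := f0 p)"
      have f1: "corresponding_centers p N h K x (f1 x)" for x
        using f f0 by (simp add: f1_def center_map_iff)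
      note f1M = corresponding_centers_mono[OF f1 NM] and gM = corresponding_centers_mono[OF g NM]
      have lip: "dist (f1 x) (f1 y) \<le> C1" if "dist x y \<le> 1" for x y
        by (rule C1[OF f1M f1M that])
      have g_lip: "dist (g x) (g y) \<le> C2" if "dist x y \<le> 1" for x y
        by (rule C2[OF gM gM that])
      \<comment> \<open>Both \<open>x\<close> and \<open>g (f1 x)\<close> correspond to
        \<open>f1 x\<close> under \<open>h'\<close>, possibly through different triangles, so they
        are within \<open>C2\<close> of each other.\<close>
      have "corresponding_centers r M h' K (f1 x) x" for x
        using corresponding_centers_inverse[OF f1 assms(18) inv] M(2) by (rule corresponding_centers_mono)
      then have gf: "dist (g (f1 x)) x \<le> C2" for x by (rule C2[OF gM]) simp
      have "corresponding_centers p M h K (g y) y" for y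
        using corresponding_centers_inverse[OF g N'(2) inv'] M(3) by (rule corresponding_centers_mono)
      then have fg: "dist (f1 (g y)) y \<le> C1" for y by (rule C1[OF f1M]) simp
      have "quasi_isometry f1"
        by (rule quasi_isometry_if_coarse_inverse[OF PG, of _ "max C1 C2" g])
          (use lip g_lip gf fg in \<open>auto simp: le_max_iff_disj\<close>)
      moreover have "dist (f1 x) (f x) \<le> dist (f0 p) (f p)" for x by (simp add: f1_def)
      ultimately show "quasi_isometry f" by (rule quasi_isometry_close)
    qed
  qed
  then show ?thesis by (intro exI[of _ "max K\<^sub>0 (max (\<kappa> N\<^sub>h) (\<kappa> N'))"]) auto
qed

end
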